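(* Let $G$ be an abelian group. (1) Any nontrivial $G$-grading on the real octonion division algebra $\mathbb{O}$ is isomorphic to exactly one of the following gradings: (a) $\Gamma_{\mathbb{O}}(G,\mathbb{H},T)$ for a subgroup $T$ of order $2$ in $G$; (b) $\Gamma_{\mathbb{O}}(G,\mathbb{C},T)$ for an elementary abelian subgroup $T$ of order $4$ in $G$; (c) $\Gamma_{\mathbb{O}}(G,\mathbb{R},T)$ for an elementary abelian subgroup $T$ of order $8$ in $G$. (2) Any $G$-grading on the real split octonion algebra $\mathbb{O}_s$ is isomorphic to one of the following gradings: (a) $\Gamma_{\mathbb{O}_s}(G,\gamma)$ for a triple $\gamma=(g_1,g_2,g_3)\in G^3$ with $g_1g_2g_3=e$, with two such gradings, corresponding to $\gamma$ and $\gamma'$, being isomorphic if and only if $\gamma\sim\gamma'$; (b) $\Gamma_{\mathbb{O}_s}(G,\mathbb{H},T)$ for a subgroup $T$ of order $2$ in $G$; (c) $\Gamma_{\mathbb{O}_s}(G,\mathbb{C},T,\mu)$ for an elementary abelian subgroup $T$ of order $4$ in $G$ and a nontrivial group homomorphism $\mu\colon T\to\{\pm1\}$ (so, for each such $T$, there are three different possibilities for $\mu$, which give nonisomorphic gradings); (d) $\Gamma_{\mathbb{O}_s}(G,\mathbb{R},T,\mu)$ for an elementary abelian subgroup $T$ of order $8$ in $G$ and a nontrivial group homomorphism $\mu\colon T\to\{\pm1\}$ (so, for each such $T$, there are seven different possibilities for $\mu$, which give nonisomorphic gradings).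
   Context: A $G$-grading on an algebra $\mathcal{U}$ is a decomposition $\mathcal{U}=\bigoplus_{g\in G}\mathcal{U}_g$ with $\mathcal{U}_g\mathcal{U}_h\subset\mathcal{U}_{gh}$; two are isomorphic if some algebra isomorphism maps the degree-$g$ component onto the degree-$g$ component for all $g$; nontrivial means $\mathcal{U}\neq\mathcal{U}_e$. Let $\mathcal{C}$ be $\mathbb{O}$ or $\mathbb{O}_s$, with norm $n$ (orthogonality is with respect to its polar form). * $\Gamma_{\mathbb{O}_s}(G,\gamma)$, $\gamma=(g_1,g_2,g_3)$, $g_1g_2g_3=e$: with respect to a basis $\{e_1,e_2,u_i,v_i\}_{i=1,2,3}$ of $\mathbb{O}_s$ with $e_i^2=e_i$, $e_1u_j=u_je_2=u_j$, $e_2v_j=v_je_1=v_j$, $u_ju_k=\varepsilon_{jkl}v_l$, $v_jv_k=\varepsilon_{jkl}u_l$ (Levi-Civita symbol), $u_jv_j=-e_1$, $v_ju_j=-e_2$, other products $0$, set $\deg e_i=e$, $\deg u_i=g_i$, $\deg v_i=g_i^{-1}$. Write $\gamma\sim\gamma'$ if there is $\pi\in\mathrm{Sym}(3)$ with either $g_i'=g_{\pi(i)}$ for all $i$ or $g_i'=g_{\pi(i)}^{-1}$ for all $i$. * $\Gamma_{\mathcal{C}}(G,\mathbb{H},T)$, $T=\langle t\rangle$ of order $2$: $\mathcal{C}_e$ is a subalgebra isomorphic to $\mathbb{H}$ and $\mathcal{C}_t=\mathcal{C}_e^\perp$. * $\Gamma_{\mathcal{C}}(G,\mathbb{C},T,\mu)$,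 $T$ elementary abelian ($2$-group) of order $4$ with generators $t_1,t_2$: $\mathcal{C}_e=\mathcal{K}$ is a subalgebra isomorphic to $\mathbb{C}$, $\mathcal{C}_{t_1}=\mathcal{K}u$, $\mathcal{C}_{t_2}=\mathcal{K}v$, $\mathcal{C}_{t_1t_2}=\mathcal{K}(uv)$, where $\mathcal{C}=\mathcal{K}\oplus\mathcal{K}u\oplus\mathcal{K}v\oplus\mathcal{K}(uv)$ by Cayley–Dickson doubling, and $\mu(t)\in\{\pm1\}$ is the sign of $n$ on $\mathcal{C}_t\setminus\{0\}$. * $\Gamma_{\mathcal{C}}(G,\mathbb{R},T,\mu)$, $T$ elementary abelian ($2$-group) of order $8$: $\mathcal{C}=\mathrm{span}\{1,u,v,uv,w,uw,vw,(uv)w\}$ by Cayley–Dickson doubling from $\mathbb{R}$, with $\deg u,\deg v,\deg w$ generators of $T$, and $\mu(t)$ the sign of $n$ on $\mathcal{C}_t\setminus\{0\}$. For $\mathcal{C}=\mathbb{O}$, $\mu$ is trivial and omitted from the notation. These gradings depend, up to isomorphism, only on the listed data. *)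

theory Defs
  imports
    "HOL-Analysis.Analysis"
    "HOL-Algebra.Generated_Groups"
    "HOL-Algebra.Sym_Groups"
    "HOL-Combinatorics.Permutations"
begin

section \<open>Real Cayley algebras\<close>

text \<open>
  The algebras are in general not associative, so they are records over a real vector space
  consisting of a product, a unit, a conjugation and a norm (quadratic form).
\<close>

record 'v calg =
  amult :: "'v \<Rightarrow> 'v \<Rightarrow> 'v"
  aunit :: 'v
  aconj :: "'v \<Rightarrow> 'v"
  anorm :: "'v \<Rightarrow> real"

text \<open>
  The Cayley--Dickson double \<open>A \<oplus> A w\<close> with \<open>w\<^sup>2 = \<alpha>\<close>; the pair \<open>(a, b)\<close> stands for \<open>a + b w\<close>.
\<close>

definition cayley_dickson :: "('v::real_vector) calg \<Rightarrow> real \<Rightarrow> ('v \<times> 'v) calg" where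
  "cayley_dickson A \<alpha> =
    \<lparr> amult = (\<lambda>(a, b) (c, d).
         (amult A a c + \<alpha> *\<^sub>R amult A (aconj A d) b, amult A d a + amult A b (aconj A c))),
      aunit = (aunit A, 0),
      aconj = (\<lambda>(a, b). (aconj A a, - b)),
      anorm = (\<lambda>(a, b). anorm A a - \<alpha> * anorm A b) \<rparr>"

definition complex_alg :: "complex calg" where
  "complex_alg = \<lparr> amult = (*), aunit = 1, aconj = cnj, anorm = (\<lambda>z. (cmod z)\<^sup>2) \<rparr>"

type_synonym quat = "complex \<times> complex"
type_synonym oct = "quat \<times> quat"

definition quaternion_alg :: "quat calg" where
  "quaternion_alg = cayley_dickson complex_alg (- 1)"

definition octonion_alg :: "oct calg" where
  "octonion_alg = cayley_dickson quaternion_alg (- 1)"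

definition split_octonion_alg :: "oct calg" where
  "split_octonion_alg = cayley_dickson quaternion_alg 1"

definition polar :: "('v::real_vector) calg \<Rightarrow> 'v \<Rightarrow> 'v \<Rightarrow> real" where
  "polar A x y = anorm A (x + y) - anorm A x - anorm A y"

definition orth :: "('v::real_vector) calg \<Rightarrow> 'v set \<Rightarrow> 'v set" where
  "orth A S = {x. \<forall>y\<in>S. polar A x y = 0}"

definition rmul :: "'v calg \<Rightarrow> 'v set \<Rightarrow> 'v \<Rightarrow> 'v set" where
  "rmul A S u = (\<lambda>k. amult A k u) ` S"

definition subalgebra_isomorphic_to ::
  "('v::real_vector) calg \<Rightarrow> 'v set \<Rightarrow> ('w::real_vector) calg \<Rightarrow> bool" where
  "subalgebra_isomorphic_to A S B \<longleftrightarrow>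
    subspace S \<and> aunit A \<in> S \<and> (\<forall>x\<in>S. \<forall>y\<in>S. amult A x y \<in> S) \<and>
    (\<exists>\<phi>. linear \<phi> \<and> bij_betw \<phi> UNIV S \<and>
         (\<forall>x y. \<phi> (amult B x y) = amult A (\<phi> x) (\<phi> y)))"


section \<open>Gradings\<close>

text \<open>
  A grading is given by its family of components; values outside \<open>carrier G\<close> are irrelevant.
  The direct sum over the possibly infinite group is expressed by unique finitely supported
  decompositions.
\<close>

definition direct_sum_decomposition :: "'g set \<Rightarrow> ('g \<Rightarrow> ('v::real_vector) set) \<Rightarrow> bool" where
  "direct_sum_decomposition I U \<longleftrightarrow>
    (\<forall>g\<in>I. subspace (U g)) \<and>
    (\<forall>x. \<exists>!f. (\<forall>g\<in>I. f g \<in> U g) \<and> (\<forall>g. g \<notin> I \<longrightarrow> f g = 0) \<and>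
              finite {g. f g \<noteq> 0} \<and> x = (\<Sum>g | f g \<noteq> 0. f g))"

definition grading ::
  "('g, 'b) monoid_scheme \<Rightarrow> ('v::real_vector) calg \<Rightarrow> ('g \<Rightarrow> 'v set) \<Rightarrow> bool" where
  "grading G A U \<longleftrightarrow>
    direct_sum_decomposition (carrier G) U \<and>
    (\<forall>g\<in>carrier G. \<forall>h\<in>carrier G. \<forall>x\<in>U g. \<forall>y\<in>U h. amult A x y \<in> U (g \<otimes>\<^bsub>G\<^esub> h))"

definition nontrivial_grading ::
  "('g, 'b) monoid_scheme \<Rightarrow> ('g \<Rightarrow> 'v set) \<Rightarrow> bool" where
  "nontrivial_grading G U \<longleftrightarrow> U \<one>\<^bsub>G\<^esub> \<noteq> UNIV"

definition grading_iso ::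
  "('g, 'b) monoid_scheme \<Rightarrow> ('v::real_vector) calg \<Rightarrow> ('g \<Rightarrow> 'v set) \<Rightarrow> ('g \<Rightarrow> 'v set) \<Rightarrow> bool" where
  "grading_iso G A U U' \<longleftrightarrow>
    (\<exists>\<phi>. linear \<phi> \<and> bij \<phi> \<and> (\<forall>x y. \<phi> (amult A x y) = amult A (\<phi> x) (\<phi> y)) \<and>
         (\<forall>g\<in>carrier G. \<phi> ` U g = U' g))"

text \<open>
  The named gradings below are given by predicates \<open>P\<close> on families of components, since their
  descriptions involve choices. \<open>determines_grading\<close> says that \<open>P\<close> describes one grading
  up to isomorphism, and \<open>isomorphic_to\<close> that a given grading is isomorphic to it.
\<close>

definition determines_grading ::
  "('g, 'b) monoid_scheme \<Rightarrow> ('v::real_vector) calg \<Rightarrow> (('g \<Rightarrow> 'v set) \<Rightarrow> bool) \<Rightarrow> bool" where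
  "determines_grading G A P \<longleftrightarrow>
    (\<exists>U. P U) \<and> (\<forall>U. P U \<longrightarrow> grading G A U) \<and>
    (\<forall>U U'. P U \<longrightarrow> P U' \<longrightarrow> grading_iso G A U U')"

definition isomorphic_to ::
  "('g, 'b) monoid_scheme \<Rightarrow> ('v::real_vector) calg \<Rightarrow> ('g \<Rightarrow> 'v set) \<Rightarrow>
    (('g \<Rightarrow> 'v set) \<Rightarrow> bool) \<Rightarrow> bool" where
  "isomorphic_to G A U P \<longleftrightarrow> (\<exists>U'. P U' \<and> grading_iso G A U U')"


section \<open>Subgroups and sign characters\<close>

definition elementary_abelian_2 :: "('g, 'b) monoid_scheme \<Rightarrow> 'g set \<Rightarrow> bool" where
  "elementary_abelian_2 G T \<longleftrightarrow> subgroup T G \<and> (\<forall>t\<in>T. t \<otimes>\<^bsub>G\<^esub> t = \<one>\<^bsub>G\<^esub>)"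

definition order_2_subgroups :: "('g, 'b) monoid_scheme \<Rightarrow> 'g set set" where
  "order_2_subgroups G = {T. subgroup T G \<and> card T = 2}"

definition elementary_abelian_2_subgroups ::
  "('g, 'b) monoid_scheme \<Rightarrow> nat \<Rightarrow> 'g set set" where
  "elementary_abelian_2_subgroups G n = {T. elementary_abelian_2 G T \<and> card T = n}"

text \<open>
  Characters are \<open>extensional\<close> so that they can be counted; \<open>sign_img\<close> is the group \<open>{-1, 1}\<close>.
\<close>

definition sign_characters :: "('g, 'b) monoid_scheme \<Rightarrow> 'g set \<Rightarrow> ('g \<Rightarrow> int) set" where
  "sign_characters G T = hom (G\<lparr>carrier := T\<rparr>) sign_img \<inter> extensional T"

definition trivial_character :: "'g set \<Rightarrow> 'g \<Rightarrow> int" where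
  "trivial_character T = (\<lambda>t\<in>T. 1)"

definition nontrivial_sign_characters ::
  "('g, 'b) monoid_scheme \<Rightarrow> 'g set \<Rightarrow> ('g \<Rightarrow> int) set" where
  "nontrivial_sign_characters G T = sign_characters G T - {trivial_character T}"

definition norm_signs ::
  "('v::real_vector) calg \<Rightarrow> 'g set \<Rightarrow> ('g \<Rightarrow> int) \<Rightarrow> ('g \<Rightarrow> 'v set) \<Rightarrow> bool" where
  "norm_signs A T \<mu> U \<longleftrightarrow> (\<forall>t\<in>T. \<forall>x\<in>U t - {0}. sgn (anorm A x) = real_of_int (\<mu> t))"


section \<open>The gradings with support an elementary abelian 2-group\<close>

definition Gamma_H ::
  "('g, 'b) monoid_scheme \<Rightarrow> ('v::real_vector) calg \<Rightarrow> 'g set \<Rightarrow> ('g \<Rightarrow> 'v set) \<Rightarrow> bool" where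
  "Gamma_H G A T U \<longleftrightarrow>
    (\<exists>t. t \<noteq> \<one>\<^bsub>G\<^esub> \<and> T = generate G {t} \<and>
      subalgebra_isomorphic_to A (U \<one>\<^bsub>G\<^esub>) quaternion_alg \<and>
      U t = orth A (U \<one>\<^bsub>G\<^esub>) \<and>
      (\<forall>g\<in>carrier G - T. U g = {0}))"

text \<open>
  Cayley--Dickson doubling inside a Cayley algebra adjoins to a subalgebra \<open>Q\<close> an element \<open>u\<close>
  orthogonal to \<open>Q\<close> with nonzero norm; the next subalgebra is \<open>Q \<oplus> Q u\<close>.
\<close>

definition Gamma_C ::
  "('g, 'b) monoid_scheme \<Rightarrow> ('v::real_vector) calg \<Rightarrow> 'g set \<Rightarrow> ('g \<Rightarrow> int) \<Rightarrow>
    ('g \<Rightarrow> 'v set) \<Rightarrow> bool" where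
  "Gamma_C G A T \<mu> U \<longleftrightarrow>
    (\<exists>t1 t2 u v K.
      t1 \<in> T \<and> t2 \<in> T \<and> generate G {t1, t2} = T \<and>
      subalgebra_isomorphic_to A K complex_alg \<and>
      u \<in> orth A K \<and> anorm A u \<noteq> 0 \<and>
      v \<in> orth A (K \<union> rmul A K u) \<and> anorm A v \<noteq> 0 \<and>
      U \<one>\<^bsub>G\<^esub> = K \<and>
      U t1 = rmul A K u \<and>
      U t2 = rmul A K v \<and>
      U (t1 \<otimes>\<^bsub>G\<^esub> t2) = rmul A K (amult A u v) \<and>
      (\<forall>g\<in>carrier G - T. U g = {0})) \<and>
    norm_signs A T \<mu> U"

definition Gamma_R ::
  "('g, 'b) monoid_scheme \<Rightarrow> ('v::real_vector) calg \<Rightarrow> 'g set \<Rightarrow> ('g \<Rightarrow> int) \<Rightarrow>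
    ('g \<Rightarrow> 'v set) \<Rightarrow> bool" where
  "Gamma_R G A T \<mu> U \<longleftrightarrow>
    (\<exists>a b c u v w.
      a \<in> T \<and> b \<in> T \<and> c \<in> T \<and> generate G {a, b, c} = T \<and>
      u \<in> orth A {aunit A} \<and> anorm A u \<noteq> 0 \<and>
      v \<in> orth A {aunit A, u} \<and> anorm A v \<noteq> 0 \<and>
      w \<in> orth A {aunit A, u, v, amult A u v} \<and> anorm A w \<noteq> 0 \<and>
      U \<one>\<^bsub>G\<^esub> = span {aunit A} \<and>
      U a = span {u} \<and>
      U b = span {v} \<and>
      U (a \<otimes>\<^bsub>G\<^esub> b) = span {amult A u v} \<and>
      U c = span {w} \<and>
      U (a \<otimes>\<^bsub>G\<^esub> c) = span {amult A u w} \<and>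
      U (b \<otimes>\<^bsub>G\<^esub> c) = span {amult A v w} \<and>
      U (a \<otimes>\<^bsub>G\<^esub> b \<otimes>\<^bsub>G\<^esub> c) = span {amult A (amult A u v) w} \<and>
      (\<forall>g\<in>carrier G - T. U g = {0})) \<and>
    norm_signs A T \<mu> U"


section \<open>The gradings given by triples\<close>

abbreviation I3 :: "nat set" where "I3 \<equiv> {1, 2, 3}"

definition levi_civita :: "nat \<Rightarrow> nat \<Rightarrow> nat \<Rightarrow> real" where
  "levi_civita j k l =
    (if (j, k, l) \<in> {(1, 2, 3), (2, 3, 1), (3, 1, 2)} then 1
     else if (j, k, l) \<in> {(1, 3, 2), (3, 2, 1), (2, 1, 3)} then - 1
     else 0)"

definition canonical_basis ::
  "('v::real_vector) calg \<Rightarrow> 'v \<Rightarrow> 'v \<Rightarrow> (nat \<Rightarrow> 'v) \<Rightarrow> (nat \<Rightarrow> 'v) \<Rightarrow> bool" where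
  "canonical_basis A e1 e2 u v \<longleftrightarrow>
    (let B = {e1, e2} \<union> u ` I3 \<union> v ` I3 in card B = 8 \<and> independent B \<and> span B = UNIV) \<and>
    amult A e1 e1 = e1 \<and> amult A e2 e2 = e2 \<and> amult A e1 e2 = 0 \<and> amult A e2 e1 = 0 \<and>
    (\<forall>j\<in>I3.
      amult A e1 (u j) = u j \<and> amult A (u j) e2 = u j \<and>
      amult A e2 (u j) = 0 \<and> amult A (u j) e1 = 0 \<and>
      amult A e2 (v j) = v j \<and> amult A (v j) e1 = v j \<and>
      amult A e1 (v j) = 0 \<and> amult A (v j) e2 = 0) \<and>
    (\<forall>j\<in>I3. \<forall>k\<in>I3.
      amult A (u j) (u k) = (\<Sum>l\<in>I3. levi_civita j k l *\<^sub>R v l) \<and>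
      amult A (v j) (v k) = (\<Sum>l\<in>I3. levi_civita j k l *\<^sub>R u l) \<and>
      amult A (u j) (v k) = (if j = k then - e1 else 0) \<and>
      amult A (v j) (u k) = (if j = k then - e2 else 0))"

definition degree_triple :: "('g, 'b) monoid_scheme \<Rightarrow> (nat \<Rightarrow> 'g) \<Rightarrow> bool" where
  "degree_triple G \<gamma> \<longleftrightarrow>
    (\<forall>i\<in>I3. \<gamma> i \<in> carrier G) \<and> \<gamma> 1 \<otimes>\<^bsub>G\<^esub> \<gamma> 2 \<otimes>\<^bsub>G\<^esub> \<gamma> 3 = \<one>\<^bsub>G\<^esub>"

definition Gamma_triple ::
  "('g, 'b) monoid_scheme \<Rightarrow> ('v::real_vector) calg \<Rightarrow> (nat \<Rightarrow> 'g) \<Rightarrow> ('g \<Rightarrow> 'v set) \<Rightarrow> bool" where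
  "Gamma_triple G A \<gamma> U \<longleftrightarrow>
    (\<exists>e1 e2 u v. canonical_basis A e1 e2 u v \<and>
      (\<forall>g\<in>carrier G.
        U g = span ({e. e \<in> {e1, e2} \<and> g = \<one>\<^bsub>G\<^esub>} \<union>
                    {u i |i. i \<in> I3 \<and> \<gamma> i = g} \<union>
                    {v i |i. i \<in> I3 \<and> inv\<^bsub>G\<^esub> (\<gamma> i) = g})))"

definition triple_equiv ::
  "('g, 'b) monoid_scheme \<Rightarrow> (nat \<Rightarrow> 'g) \<Rightarrow> (nat \<Rightarrow> 'g) \<Rightarrow> bool" where
  "triple_equiv G \<gamma> \<gamma>' \<longleftrightarrow>
    (\<exists>\<pi>. \<pi> permutes I3 \<and>
      ((\<forall>i\<in>I3. \<gamma>' i = \<gamma> (\<pi> i)) \<or> (\<forall>i\<in>I3. \<gamma>' i = inv\<^bsub>G\<^esub> (\<gamma> (\<pi> i)))))"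

end

theory Submission
  imports Defs
begin

text \<open>
  Let \<open>A\<close> be one of the two algebras, \<open>n\<close> its norm with polar form \<open>n(x, y)\<close>, and \<open>U\<close> a
  \<open>G\<close>-grading. Every \<open>x\<close> satisfies \<open>x\<^sup>2 = n(x, 1) x - n(x) 1\<close>. Comparing degrees in this equation
  shows that homogeneous elements of degree other than \<open>e\<close> have trace zero (\<open>trace_zero\<close>). Hence
  \<open>n(U\<^sub>g, U\<^sub>h) = 0\<close> unless \<open>g h = e\<close>, the polar form pairs \<open>U\<^sub>g\<close> with the component of degree
  \<open>inv g\<close>, and \<open>n\<close> is nondegenerate on \<open>U\<^sub>e\<close>. Everything depends on whether \<open>n\<close> is anisotropic
  there.

  Suppose it is. For a nonzero \<open>x\<close> in \<open>U\<^sub>t\<close> choose \<open>y\<close> of the inverse degree with \<open>n(x, y) \<noteq> 0\<close>;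
  the product of \<open>x\<close> with the conjugate of \<open>y\<close> is a nonzero element of \<open>U\<^sub>e\<close>, so \<open>n(x) \<noteq> 0\<close>. It
  follows that \<open>t\<^sup>2 = e\<close> and \<open>U\<^sub>t = U\<^sub>e x\<close> (\<open>homogeneous_norm_nonzero\<close>, \<open>component_eq_rmul\<close>). The
  norm is positive definite on \<open>U\<^sub>e\<close>, which is therefore a copy of \<open>\<real>\<close>, \<open>\<complex>\<close> or the quaternions, or
  is all of \<open>A\<close> (\<open>neutral_component_cases\<close>). Doubling \<open>U\<^sub>e\<close> by homogeneous elements of new degrees
  exhausts \<open>A\<close>, and each doubling step also doubles the group of degrees reached
  (\<open>partial_model_double\<close>). So the support \<open>T\<close> is an elementary abelian \<open>2\<close>-group of order
  \<open>8 / dim U\<^sub>e\<close>, and the sign of \<open>n\<close> on the components is a character of \<open>T\<close>, trivial exactly when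
  \<open>n\<close> is positive definite (\<open>sign_char_in\<close>, \<open>sign_char_trivial_iff\<close>). Two such gradings with the
  same signs and isomorphic neutral components arise from the same chain of doublings, with the
  same parameters after rescaling, and are isomorphic
  (\<open>grading_iso_if_neutral_components_isomorphic\<close>).

  If \<open>n\<close> is isotropic on \<open>U\<^sub>e\<close>, then \<open>U\<^sub>e\<close> contains an idempotent \<open>c\<close> with \<open>n(c) = 0\<close> and trace
  \<open>1\<close>. The orthogonal complement of a graded nondegenerate subalgebra is graded and contains
  homogeneous \<open>p\<close> and \<open>q\<close> of inverse degrees with \<open>p = c p\<close>, \<open>q = (1 - c) q\<close> and \<open>n(p, q) = 1\<close>
  (\<open>ex_peirce_pair\<close>). Doubling \<open>\<real> c + \<real> (1 - c)\<close> twice by elements \<open>p + q\<close> of this kind gives all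
  of \<open>A\<close>, and the canonical basis of the double consists of homogeneous elements
  (\<open>Gamma_triple_if_neutral_isotropic\<close>). The dimensions of the components then determine the
  triple of degrees up to permutation and inversion of single entries; since the product of the
  entries is \<open>e\<close>, the inversions can be taken to be simultaneous
  (\<open>triple_equiv_if_degree_count_eq\<close>).

  Conversely, doubling by an element of degree \<open>t = inv t\<close> turns a grading \<open>X\<close> into
  \<open>g \<mapsto> X\<^sub>g \<times> X\<^sub>g\<^sub>t\<close> (\<open>grading_cd_grading\<close>), and the described families are images of such
  gradings. They exist for every admissible character, because the generators of \<open>T\<close> can be chosen
  such that the character takes on them the signs of the norms of the standard doubling elements
  (\<open>adapted_generators_4\<close>, \<open>adapted_generators_8\<close>). Finally, the sign character is an isomorphism
  invariant, as automorphisms preserve the norm, and there are \<open>|T|\<close> characters of \<open>T\<close>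
  (\<open>card_sign_characters\<close>).
\<close>

section \<open>Composition algebras\<close>

text \<open>
  The class \<open>euclidean_space\<close> provides the finite dimension; its inner product is unrelated to the
  norm, which may be indefinite. Conjugation is expressed by the polar form as \<open>cj\<close>, so that it
  can be used before it is identified with the conjugation that a concrete algebra carries.
\<close>

locale composition_algebra =
  fixes A :: "('v::euclidean_space) calg"
  assumes bilinear_mult: "bilinear (amult A)"
    and unit_left [simp]: "amult A (aunit A) x = x"
    and unit_right [simp]: "amult A x (aunit A) = x"
    and bilinear_polar: "bilinear (polar A)"
    and norm_scale: "anorm A (r *\<^sub>R x) = r\<^sup>2 * anorm A x"
    and norm_mult: "anorm A (amult A x y) = anorm A x * anorm A y"
    and nondegenerate: "(\<And>y. polar A x y = 0) \<Longrightarrow> x = 0"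
begin

abbreviation mul (infixl "\<odot>" 70) where "x \<odot> y \<equiv> amult A x y"
abbreviation one ("\<e>") where "\<e> \<equiv> aunit A"
abbreviation N where "N \<equiv> anorm A"
abbreviation P where "P \<equiv> polar A"

definition cj :: "'v \<Rightarrow> 'v" where "cj x = P x \<e> *\<^sub>R \<e> - x"

lemmas mult_simps =
  bilinear_ladd[OF bilinear_mult] bilinear_radd[OF bilinear_mult]
  bilinear_lmul[OF bilinear_mult] bilinear_rmul[OF bilinear_mult]
  bilinear_lsub[OF bilinear_mult] bilinear_rsub[OF bilinear_mult]
  bilinear_lneg[OF bilinear_mult] bilinear_rneg[OF bilinear_mult]
  bilinear_lzero[OF bilinear_mult] bilinear_rzero[OF bilinear_mult]

lemmas polar_simps =
  bilinear_ladd[OF bilinear_polar] bilinear_radd[OF bilinear_polar]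
  bilinear_lmul[OF bilinear_polar] bilinear_rmul[OF bilinear_polar]
  bilinear_lsub[OF bilinear_polar] bilinear_rsub[OF bilinear_polar]
  bilinear_lneg[OF bilinear_polar] bilinear_rneg[OF bilinear_polar]
  bilinear_lzero[OF bilinear_polar] bilinear_rzero[OF bilinear_polar]

lemma norm_add: "N (x + y) = N x + N y + P x y"
  by (simp add: polar_def)

lemma polar_commute: "P x y = P y x"
  by (simp add: polar_def add.commute)

lemma norm_zero [simp]: "N 0 = 0"
  using norm_scale[of 0 0] by simp

lemma polar_self: "P x x = 2 * N x"
  using norm_scale[of 2 x] by (simp add: polar_def scaleR_2)

text \<open>
  Identities between products are proved by pairing both sides with an arbitrary element: factors
  can be moved across the polar form, although the product is not associative.
\<close>

lemma eq_if_polar_eq: "(\<And>z. P x z = P y z) \<Longrightarrow> x = y"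
  using nondegenerate[of "x - y"] by (simp add: polar_simps)

text \<open>
  The norm of the unit is idempotent. If it were zero, multiplicativity would make the whole norm
  vanish, against nondegeneracy.
\<close>

lemma norm_unit [simp]: "N \<e> = 1"
proof -
  have "N \<e> = 1 \<or> N \<e> = 0" using norm_mult[of \<e> \<e>] by auto
  moreover have False if "N \<e> = 0"
  proof -
    have "N x = 0" for x using norm_mult[of \<e> x] that by simp
    then have "x = 0" for x :: 'v by (intro nondegenerate) (simp add: polar_def)
    then show False using nonempty_Basis nonzero_Basis by blast
  qed
  ultimately show ?thesis by blast
qed

lemma unit_nonzero [simp]: "\<e> \<noteq> 0"
  using norm_unit by fastforce

lemma polar_mult_left: "P (x \<odot> y) (x \<odot> z) = N x * P y z"
  using norm_mult[of x "y + z"] by (simp add: mult_simps norm_add norm_mult algebra_simps)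

lemma polar_mult_right: "P (x \<odot> z) (y \<odot> z) = P x y * N z"
  using norm_mult[of "x + y" z] by (simp add: mult_simps norm_add norm_mult algebra_simps)

text \<open>
  This is the full linearization of the multiplicativity of the norm. Replacing one argument by
  the unit turns it into the adjointness of multiplication by \<open>x\<close> and by its conjugate.
\<close>

lemma polar_exchange: "P (x \<odot> y) (z \<odot> w) + P (x \<odot> w) (z \<odot> y) = P x z * P y w"
  using polar_mult_left[of "x + z" y w] polar_mult_left[of x y w] polar_mult_left[of z y w]
  by (simp add: mult_simps polar_simps norm_add polar_commute algebra_simps)

lemma cj_unit [simp]: "cj \<e> = \<e>"
  by (simp add: cj_def polar_self scaleR_2)

lemma cj_cj [simp]: "cj (cj x) = x"
  by (simp add: cj_def polar_simps polar_self algebra_simps)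

lemma linear_cj: "linear cj"
  by (rule linearI) (simp_all add: cj_def polar_simps algebra_simps)

lemmas cj_simps = linear_add[OF linear_cj] linear_diff[OF linear_cj] linear_neg[OF linear_cj]
  linear_scale[OF linear_cj] linear_0[OF linear_cj]

lemma polar_cj: "P (cj x) (cj y) = P x y"
  by (simp add: cj_def polar_simps polar_self polar_commute algebra_simps)

lemma norm_cj [simp]: "N (cj x) = N x"
  using polar_cj[of x x] by (simp add: polar_self)

lemma adjoint_left: "P (x \<odot> y) z = P y (cj x \<odot> z)"
  using polar_exchange[of x y \<e> z]
  by (simp add: cj_def mult_simps polar_simps polar_commute algebra_simps)

lemma adjoint_right: "P (x \<odot> y) z = P x (z \<odot> cj y)"
  using polar_exchange[of x y z \<e>]
  by (simp add: cj_def mult_simps polar_simps polar_commute algebra_simps)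

lemma cj_mult_cancel: "cj x \<odot> (x \<odot> y) = N x *\<^sub>R y"
  by (rule eq_if_polar_eq) (simp add: adjoint_left[of "cj x"] polar_mult_left polar_simps)

lemma mult_cj_cancel: "(y \<odot> x) \<odot> cj x = N x *\<^sub>R y"
  by (rule eq_if_polar_eq) (simp add: adjoint_right[of _ "cj x"] polar_mult_right polar_simps)

lemma mult_cj: "x \<odot> cj x = N x *\<^sub>R \<e>"
  using mult_cj_cancel[of \<e> x] by simp

text \<open>
  Every element is a root of a quadratic polynomial whose coefficients are its trace and its norm.
  Through this equation gradings and homomorphisms, which only know the product, control the norm.
\<close>

lemma quadratic_equation: "x \<odot> x = P x \<e> *\<^sub>R x - N x *\<^sub>R \<e>"
  using mult_cj[of x] by (simp add: cj_def mult_simps algebra_simps)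

lemma cj_mult_cancel_linearized: "cj x \<odot> (z \<odot> y) + cj z \<odot> (x \<odot> y) = P x z *\<^sub>R y"
  using cj_mult_cancel[of "x + z" y]
  by (simp add: mult_simps cj_simps cj_mult_cancel norm_add algebra_simps)

lemma mult_cj_cancel_linearized: "(y \<odot> z) \<odot> cj x + (y \<odot> x) \<odot> cj z = P x z *\<^sub>R y"
  using mult_cj_cancel[of y "x + z"]
  by (simp add: mult_simps cj_simps mult_cj_cancel norm_add algebra_simps)

text \<open>
  Both sides have the same pairing with every \<open>z\<close>, because in \<open>P (x \<odot> y) z\<close> either factor can be
  moved to the other side.
\<close>

lemma cj_mult: "cj (x \<odot> y) = cj y \<odot> cj x"
proof (rule eq_if_polar_eq)
  fix z
  have "P (cj (x \<odot> y)) z = P (x \<odot> y) (cj z)"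
    using polar_cj[of "x \<odot> y" "cj z"] by simp
  also have "\<dots> = P (z \<odot> x) (cj y)"
    by (metis adjoint_left adjoint_right cj_cj polar_commute)
  also have "\<dots> = P (cj y \<odot> cj x) z"
    by (metis adjoint_right polar_commute)
  finally show "P (cj (x \<odot> y)) z = P (cj y \<odot> cj x) z" .
qed

lemma polar_unit_mult_cj: "P (x \<odot> cj y) \<e> = P x y"
  by (simp add: adjoint_right)

section \<open>Cayley--Dickson doubling inside a composition algebra\<close>

definition unital_subalgebra where
  "unital_subalgebra Q \<longleftrightarrow> subspace Q \<and> \<e> \<in> Q \<and> (\<forall>x\<in>Q. \<forall>y\<in>Q. x \<odot> y \<in> Q)"

text \<open>
  Conjugation is a combination of the identity and the trace, so a subspace containing the unit is
  closed under it.
\<close>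

lemma unital_subalgebra_cj: "unital_subalgebra Q \<Longrightarrow> x \<in> Q \<Longrightarrow> cj x \<in> Q"
  unfolding unital_subalgebra_def cj_def by (auto intro: subspace_diff subspace_scale)

lemma cj_orth:
  assumes "P u \<e> = 0" shows "cj u = - u"
  using assms by (simp add: cj_def)

text \<open>
  Let \<open>Q\<close> be closed under products and \<open>u\<close> orthogonal to it. Then \<open>Q + Q u\<close> multiplies by the
  Cayley--Dickson formulas. The reason is that the elements of \<open>Q u\<close> have trace zero, hence are
  skew under conjugation, and that the linearized cancellation laws lose the term \<open>P x u\<close> for \<open>x\<close>
  in \<open>Q\<close>.
\<close>

context
  fixes Q u
  assumes Q: "unital_subalgebra Q" and u: "u \<in> orth A Q"
begin

lemma orth_u: "x \<in> Q \<Longrightarrow> P u x = 0" "x \<in> Q \<Longrightarrow> P x u = 0"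
  using u by (auto simp: orth_def polar_commute)

lemma polar_double: "a \<in> Q \<Longrightarrow> b \<in> Q \<Longrightarrow> P a (b \<odot> u) = 0"
  using Q orth_u(1)[of "cj b \<odot> a"] unital_subalgebra_cj[OF Q]
  by (simp add: polar_commute[of a] adjoint_left unital_subalgebra_def)

lemma cj_double: "b \<in> Q \<Longrightarrow> cj (b \<odot> u) = - (b \<odot> u)"
  using polar_double[of \<e> b] Q by (intro cj_orth) (simp add: polar_commute unital_subalgebra_def)

lemma double_swap: "b \<in> Q \<Longrightarrow> b \<odot> u = u \<odot> cj b"
  using cj_double[of b] cj_double[of \<e>] Q
  by (simp add: cj_mult unital_subalgebra_def mult_simps)

lemma double_left:
  assumes a: "a \<in> Q" and b: "b \<in> Q" shows "a \<odot> (b \<odot> u) = (b \<odot> a) \<odot> u"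
proof -
  have cu: "cj u = - u" using cj_double[of \<e>] Q by (simp add: unital_subalgebra_def)
  have "a \<odot> (u \<odot> cj b) = u \<odot> (cj a \<odot> cj b)"
    using cj_mult_cancel_linearized[of "cj a" u "cj b"] cu orth_u(2)[OF unital_subalgebra_cj[OF Q a]]
    by (simp add: mult_simps)
  also have "\<dots> = (b \<odot> a) \<odot> u"
    using Q a b by (simp add: double_swap cj_mult unital_subalgebra_def)
  finally show ?thesis using b by (simp add: double_swap)
qed

lemma double_right:
  assumes b: "b \<in> Q" and c: "c \<in> Q" shows "(b \<odot> u) \<odot> c = (b \<odot> cj c) \<odot> u"
proof -
  have cc: "cj c \<in> Q" "b \<odot> cj c \<in> Q" using unital_subalgebra_cj[OF Q c] Q b by (auto simp: unital_subalgebra_def)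
  have "cj ((b \<odot> u) \<odot> c) = - ((b \<odot> cj c) \<odot> u)"
    using b cc by (simp add: cj_mult[of "b \<odot> u"] cj_double double_left mult_simps)
  also have "\<dots> = cj ((b \<odot> cj c) \<odot> u)" using cc by (simp add: cj_double)
  finally show ?thesis by (metis cj_cj)
qed

lemma double_double:
  assumes b: "b \<in> Q" and d: "d \<in> Q" shows "(b \<odot> u) \<odot> (d \<odot> u) = - N u *\<^sub>R (cj d \<odot> b)"
proof -
  have cu: "cj u = - u" using cj_double[of \<e>] Q by (simp add: unital_subalgebra_def)
  have uu: "((d \<odot> b) \<odot> u) \<odot> u = - N u *\<^sub>R (d \<odot> b)"
    using mult_cj_cancel[of "d \<odot> b" u] cu by (simp add: mult_simps)
      (metis add.inverse_inverse)
  have "P (d \<odot> u) u = P d \<e> * N u" using polar_mult_right[of d u \<e>] by simp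
  then show ?thesis
    using mult_cj_cancel_linearized[of b u "d \<odot> u"] uu b d
    by (simp add: cj_double double_left cu mult_simps) (simp add: cj_def mult_simps algebra_simps)
qed

end

definition cd_map :: "('b \<Rightarrow> 'v) \<Rightarrow> 'v \<Rightarrow> 'b \<times> 'b \<Rightarrow> 'v" where
  "cd_map \<phi> u = (\<lambda>(a, b). \<phi> a + \<phi> b \<odot> u)"

text \<open>
  Isometric homomorphisms are the maps that extend to doubles. The conditions on norm and
  conjugation are part of the notion because the product of a double involves the conjugation, and
  the element \<open>u\<close> used for doubling enters through its norm.
\<close>

definition embedding :: "('b::euclidean_space) calg \<Rightarrow> ('b \<Rightarrow> 'v) \<Rightarrow> bool" where
  "embedding B \<phi> \<longleftrightarrow> linear \<phi> \<and> \<phi> (aunit B) = \<e> \<and> (\<forall>x y. \<phi> (amult B x y) = \<phi> x \<odot> \<phi> y) \<and>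
    (\<forall>x. N (\<phi> x) = anorm B x) \<and> (\<forall>x. \<phi> (aconj B x) = cj (\<phi> x))"

lemma unital_subalgebra_range: "embedding B \<phi> \<Longrightarrow> unital_subalgebra (range \<phi>)"
  unfolding embedding_def unital_subalgebra_def
  by (auto simp: linear_subspace_image) (metis rangeI)+

lemma embedding_polar: "embedding B \<phi> \<Longrightarrow> P (\<phi> x) (\<phi> y) = polar B x y"
  unfolding embedding_def polar_def by (metis linear_add)

text \<open>
  Since \<open>u\<close> is orthogonal to the image, it has trace zero and \<open>u\<^sup>2 = - n(u) 1\<close>, so \<open>- n(u)\<close> is the
  parameter of the double. The products of elements \<open>a + b u\<close> are given by the lemmas on
  \<open>Q + Q u\<close>.
\<close>

lemma embedding_cd:
  assumes \<phi>: "embedding B \<phi>" and u: "u \<in> orth A (range \<phi>)" and Nu: "\<alpha> = - N u"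
  shows "embedding (cayley_dickson B \<alpha>) (cd_map \<phi> u)"
proof -
  note Q = unital_subalgebra_range[OF \<phi>]
  note D = polar_double[OF Q u] cj_double[OF Q u] double_left[OF Q u] double_right[OF Q u]
    double_double[OF Q u]
  have l: "linear \<phi>" and h: "\<phi> (aunit B) = \<e>" "\<And>x y. \<phi> (amult B x y) = \<phi> x \<odot> \<phi> y"
     "\<And>x. N (\<phi> x) = anorm B x" "\<And>x. \<phi> (aconj B x) = cj (\<phi> x)"
    using \<phi> by (auto simp: embedding_def)
  note ls = linear_add[OF l] linear_diff[OF l] linear_scale[OF l] linear_0[OF l] linear_neg[OF l]
  have "linear (cd_map \<phi> u)"
    by (rule linearI) (auto simp: cd_map_def ls mult_simps algebra_simps)
  then show ?thesis
    by (auto simp: embedding_def cayley_dickson_def cd_map_def ls h mult_simps D norm_add norm_mult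
        cj_simps Nu algebra_simps)
qed

end

text \<open>
  This property is inherited by doubles with nonzero parameter and forces embeddings to be
  injective. It holds for iterated doubles of which one does not know beforehand that their norm
  is multiplicative.
\<close>

definition nondegenerate_norm :: "('b::real_vector) calg \<Rightarrow> bool" where
  "nondegenerate_norm B \<longleftrightarrow> anorm B 0 = 0 \<and> (\<forall>x. (\<forall>y. polar B x y = 0) \<longrightarrow> x = 0)"

lemma nondegenerate_norm_cd:
  assumes "nondegenerate_norm B" "\<alpha> \<noteq> 0"
  shows "nondegenerate_norm (cayley_dickson B \<alpha>)"
proof -
  have p: "polar (cayley_dickson B \<alpha>) (a, b) (c, d) = polar B a c - \<alpha> * polar B b d" for a b c d
    by (simp add: polar_def cayley_dickson_def algebra_simps)
  have z: "polar B a 0 = 0" for a using assms by (simp add: polar_def nondegenerate_norm_def)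
  have "a = 0 \<and> b = 0" if *: "\<And>c d. polar (cayley_dickson B \<alpha>) (a, b) (c, d) = 0" for a b
    using *[of _ 0] *[of 0] assms by (simp add: p z nondegenerate_norm_def)
  moreover have "anorm (cayley_dickson B \<alpha>) 0 = 0"
    using assms by (simp add: cayley_dickson_def nondegenerate_norm_def case_prod_beta)
  ultimately show ?thesis
    by (auto simp: nondegenerate_norm_def zero_prod_def)
qed

context composition_algebra
begin

lemma embedding_inj:
  assumes \<phi>: "embedding B \<phi>" and B: "nondegenerate_norm B" shows "inj \<phi>"
proof -
  have "linear \<phi>" using \<phi> by (simp add: embedding_def)
  moreover have "x = 0" if "\<phi> x = 0" for x
    using B embedding_polar[OF \<phi>, of x] that by (auto simp: nondegenerate_norm_def polar_simps)
  ultimately show ?thesis by (simp add: linear_injective_0)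
qed

lemma embedding_bij:
  assumes \<phi>: "embedding (B :: 'b::euclidean_space calg) \<phi>" and B: "nondegenerate_norm B"
    and "DIM('b) = DIM('v)" shows "bij \<phi>"
proof -
  have l: "linear \<phi>" using \<phi> by (simp add: embedding_def)
  have "dim (range \<phi>) = DIM('v)"
    using dim_image_eq[OF l, of UNIV] embedding_inj[OF \<phi> B] assms(3) by simp
  then have "range \<phi> = UNIV"
    using l linear_subspace_image[OF l subspace_UNIV] dim_eq_full[of "range \<phi>"] span_eq_iff by metis
  then show ?thesis using embedding_inj[OF \<phi> B] by (simp add: bij_def)
qed

text \<open>
  The polar form is \<open>T x \<bullet> y\<close> for an injective linear \<open>T\<close>. Its orthogonal complement of \<open>R\<close> is the
  euclidean complement of \<open>T ` R\<close> and so has complementary dimension.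
\<close>

lemma nondegenerate_subspace_decomposition:
  assumes R: "subspace R" and nd: "\<And>x. x \<in> R \<Longrightarrow> (\<And>y. y \<in> R \<Longrightarrow> P x y = 0) \<Longrightarrow> x = 0"
  obtains r s where "r \<in> R" "s \<in> orth A R" "x = r + s"
proof -
  define T where "T x = (\<Sum>b\<in>Basis. P x b *\<^sub>R b)" for x
  have PT: "P x y = T x \<bullet> y" for x y
  proof -
    have "P x y = P x (\<Sum>b\<in>Basis. (y \<bullet> b) *\<^sub>R b)" by (simp add: euclidean_representation)
    also have "\<dots> = (\<Sum>b\<in>Basis. (y \<bullet> b) * P x b)"
      using linear_sum[of "P x" "\<lambda>b. (y \<bullet> b) *\<^sub>R b" Basis] bilinear_polar
      by (simp add: bilinear_def linear_scale)
    also have "\<dots> = T x \<bullet> y"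
      by (simp add: T_def inner_sum_right inner_commute[of _ y] mult.commute)
    finally show ?thesis .
  qed
  have lT: "linear T"
    by (rule linearI) (simp_all add: T_def polar_simps scaleR_add_left sum.distrib scaleR_sum_right)
  have "inj T" unfolding linear_injective_0[OF lT] using nondegenerate PT by auto
  then have dT: "dim (T ` R) = dim R" by (intro dim_image_eq[OF lT]) (auto intro: inj_on_subset)
  have sT: "subspace (T ` R)" using lT R linear_subspace_image by blast
  have oe: "orth A R = {y. \<forall>x\<in>T ` R. orthogonal x y}"
    by (auto simp: orth_def orthogonal_def polar_commute[of _ "_"] PT[symmetric])
  have so: "subspace (orth A R)" unfolding orth_def by (rule subspaceI) (auto simp: polar_simps)
  have d: "dim (orth A R) + dim R = DIM('v)"
    using dim_subspace_orthogonal_to_vectors[OF sT subspace_UNIV] dT by (simp add: oe)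
  have "R \<inter> orth A R = {0}"
    using nd subspace_0[OF R] subspace_0[OF so] by (auto simp: orth_def)
  then have "dim {x + y |x y. x \<in> R \<and> y \<in> orth A R} = DIM('v)"
    using dim_sums_Int[OF R so] d by simp
  then have "{x + y |x y. x \<in> R \<and> y \<in> orth A R} = UNIV"
    unfolding dim_eq_full using subspace_sums[OF R so] by (simp only: span_eq_iff[THEN iffD2])
  then show thesis using that by blast
qed

lemma embedding_decomposition:
  assumes \<phi>: "embedding B \<phi>" and B: "nondegenerate_norm B"
  obtains r s where "r \<in> range \<phi>" "s \<in> orth A (range \<phi>)" "x = r + s"
proof -
  have "x = 0" if x: "x \<in> range \<phi>" and 0: "\<And>y. y \<in> range \<phi> \<Longrightarrow> P x y = 0" for x
  proof -
    obtain a where a: "x = \<phi> a" using x by blast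
    have "polar B a y = 0" for y using 0[of "\<phi> y"] by (simp add: a embedding_polar[OF \<phi>])
    then have "a = 0" using B unfolding nondegenerate_norm_def by blast
    then show ?thesis using \<phi> by (simp add: a embedding_def linear_0)
  qed
  then show thesis
    using nondegenerate_subspace_decomposition[of "range \<phi>"] unital_subalgebra_range[OF \<phi>] that
    unfolding unital_subalgebra_def by blast
qed

lemma embedding_not_surj:
  assumes "embedding (B :: 'b::euclidean_space calg) \<phi>" "DIM('b) < DIM('v)"
  obtains z where "z \<notin> range \<phi>"
proof -
  have l: "linear \<phi>" using assms(1) by (simp add: embedding_def)
  have "range \<phi> \<noteq> UNIV"
  proof
    assume "range \<phi> = UNIV"
    then show False using dim_image_le[OF l, of UNIV] assms(2) by simp
  qed
  then show thesis using that by blast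
qed

end

section \<open>The Cayley algebras as composition algebras\<close>

lemma polar_cd:
  "polar (cayley_dickson B \<alpha>) x y = polar B (fst x) (fst y) - \<alpha> * polar B (snd x) (snd y)"
  by (simp add: polar_def cayley_dickson_def case_prod_beta algebra_simps)

text \<open>
  The norm of a product in the double contains the cross terms \<open>n(a c, d\<^sup>* b)\<close> and
  \<open>n(d a, b c\<^sup>*)\<close>, with \<open>x\<^sup>*\<close> the conjugate of \<open>x\<close>; they enter with opposite signs and cancel.
  Moving factors across the polar form shows that they agree if \<open>B\<close> is associative.
\<close>

lemma composition_algebra_cd:
  assumes B: "composition_algebra B" and cj: "\<And>x. aconj B x = polar B x (aunit B) *\<^sub>R aunit B - x"
    and assoc: "\<And>x y z. amult B (amult B x y) z = amult B x (amult B y z)" and \<alpha>: "\<alpha> \<noteq> 0"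
  shows "composition_algebra (cayley_dickson B \<alpha>)"
proof -
  interpret B: composition_algebra B by (rule B)
  have cj': "aconj B = B.cj" by (auto simp: cj B.cj_def)
  let ?A = "cayley_dickson B \<alpha>"
  note p = polar_cd[of B \<alpha>]
  show ?thesis
  proof
    show "bilinear (amult ?A)"
      by (auto simp: bilinear_def cayley_dickson_def cj' B.mult_simps B.cj_simps algebra_simps
          intro!: linearI)
    show "bilinear (polar ?A)"
      by (auto simp: bilinear_def p B.polar_simps algebra_simps intro!: linearI)
    show "amult ?A (aunit ?A) x = x" "amult ?A x (aunit ?A) = x" for x
      by (auto simp: cayley_dickson_def cj' B.mult_simps B.cj_simps case_prod_beta)
    show "anorm ?A (r *\<^sub>R x) = r\<^sup>2 * anorm ?A x" for r x
      by (auto simp: cayley_dickson_def B.norm_scale case_prod_beta algebra_simps)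
    show "anorm ?A (amult ?A x y) = anorm ?A x * anorm ?A y" for x y
    proof -
      obtain a b c d where xy: "x = (a, b)" "y = (c, d)" by fastforce
      have "B.P (amult B a c) (amult B (B.cj d) b) = B.P (amult B d a) (amult B b (B.cj c))"
        by (metis B.adjoint_left B.adjoint_right B.cj_cj assoc B.polar_commute)
      then show ?thesis
        by (simp add: xy cayley_dickson_def cj' B.norm_add B.norm_mult B.norm_scale B.polar_simps
            power2_eq_square algebra_simps)
    qed
    show "x = 0" if "\<And>y. polar ?A x y = 0" for x
    proof -
      have "fst x = 0" using that[of "(_, 0)"] by (intro B.nondegenerate) (simp add: p B.polar_simps)
      moreover have "snd x = 0"
        using that[of "(0, _)"] \<alpha> by (intro B.nondegenerate) (simp add: p B.polar_simps)
      ultimately show ?thesis by (simp add: prod_eq_iff)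
    qed
  qed
qed

lemma aconj_cd:
  assumes "\<And>x. aconj B x = polar B x (aunit B) *\<^sub>R aunit B - x" "anorm B 0 = 0"
  shows "aconj (cayley_dickson B \<alpha>) x =
    polar (cayley_dickson B \<alpha>) x (aunit (cayley_dickson B \<alpha>)) *\<^sub>R aunit (cayley_dickson B \<alpha>) - x"
proof -
  have "polar B y 0 = 0" for y using assms(2) by (simp add: polar_def)
  then show ?thesis
    unfolding polar_cd by (simp add: cayley_dickson_def assms(1) prod_eq_iff case_prod_beta)
qed

lemma composition_algebra_complex: "composition_algebra complex_alg"
proof
  have p: "polar complex_alg x y = 2 * (x \<bullet> y)" for x y
    by (simp add: polar_def complex_alg_def power2_norm_eq_inner inner_add inner_commute)
  show "bilinear (polar complex_alg)"
    by (auto simp: bilinear_def p inner_add algebra_simps intro!: linearI)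
  show "x = 0" if "\<And>y. polar complex_alg x y = 0" for x
    using that[of x] by (simp add: p)
qed (auto simp: complex_alg_def bilinear_def norm_mult power_mult_distrib algebra_simps intro!: linearI)

lemma aconj_complex: "aconj complex_alg x = polar complex_alg x (aunit complex_alg) *\<^sub>R aunit complex_alg - x"
  by (simp add: complex_alg_def polar_def complex_eq_iff cmod_power2) (simp add: power2_eq_square algebra_simps)

lemma aconj_quaternion:
  "aconj quaternion_alg x = polar quaternion_alg x (aunit quaternion_alg) *\<^sub>R aunit quaternion_alg - x"
  unfolding quaternion_alg_def by (intro aconj_cd aconj_complex) (simp add: complex_alg_def)

lemma composition_algebra_quaternion: "composition_algebra quaternion_alg"
  unfolding quaternion_alg_def
  by (rule composition_algebra_cd[OF composition_algebra_complex aconj_complex])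
    (auto simp: complex_alg_def)

lemma quaternion_assoc:
  "amult quaternion_alg (amult quaternion_alg x y) z = amult quaternion_alg x (amult quaternion_alg y z)"
  by (cases x; cases y; cases z)
     (simp add: quaternion_alg_def cayley_dickson_def complex_alg_def algebra_simps)

text \<open>
  This treats both algebras at once: \<open>\<delta> = - 1\<close> gives the octonions and \<open>\<delta> = 1\<close> the split
  octonions.
\<close>

definition cayley_alg :: "real \<Rightarrow> oct calg" where
  "cayley_alg \<delta> = cayley_dickson quaternion_alg \<delta>"

lemma composition_algebra_cayley: "\<delta> \<noteq> 0 \<Longrightarrow> composition_algebra (cayley_alg \<delta>)"
  unfolding cayley_alg_def
  by (intro composition_algebra_cd composition_algebra_quaternion aconj_quaternion quaternion_assoc)

section \<open>Direct sum decompositions\<close>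

definition homogeneous_decomposition ::
  "'g set \<Rightarrow> ('g \<Rightarrow> 'v::real_vector set) \<Rightarrow> 'v \<Rightarrow> ('g \<Rightarrow> 'v) \<Rightarrow> bool" where
  "homogeneous_decomposition I U x f \<longleftrightarrow> (\<forall>g\<in>I. f g \<in> U g) \<and> (\<forall>g. g \<notin> I \<longrightarrow> f g = 0) \<and>
    finite {g. f g \<noteq> 0} \<and> x = (\<Sum>g | f g \<noteq> 0. f g)"

lemma direct_sum_decomposition_iff_unique:
  "direct_sum_decomposition I U \<longleftrightarrow>
    (\<forall>g\<in>I. subspace (U g)) \<and> (\<forall>x. \<exists>!f. homogeneous_decomposition I U x f)"
  unfolding direct_sum_decomposition_def homogeneous_decomposition_def ..

lemma homogeneous_decompositionI:
  assumes "\<And>g. g \<in> I \<Longrightarrow> f g \<in> U g" "\<And>g. g \<notin> I \<Longrightarrow> f g = 0"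
    and F: "finite F" "\<And>g. g \<notin> F \<Longrightarrow> f g = 0" and x: "x = sum f F"
  shows "homogeneous_decomposition I U x f"
proof -
  have sub: "{g. f g \<noteq> 0} \<subseteq> F" using F(2) by blast
  have "(\<Sum>g | f g \<noteq> 0. f g) = sum f F" using F(1) sub by (intro sum.mono_neutral_left) auto
  then show ?thesis
    using assms finite_subset[OF sub F(1)] by (simp add: homogeneous_decomposition_def)
qed

lemma homogeneous_decomposition_superset:
  assumes "homogeneous_decomposition I U x f" "finite F" "{g. f g \<noteq> 0} \<subseteq> F"
  shows "x = sum f F"
proof -
  have "x = (\<Sum>g | f g \<noteq> 0. f g)" using assms(1) unfolding homogeneous_decomposition_def by (elim conjE)
  also have "\<dots> = sum f F" using assms(2,3) by (rule sum.mono_neutral_left) simp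
  finally show ?thesis .
qed

lemma homogeneous_decomposition_linear:
  assumes sub: "\<forall>g\<in>I. subspace (U g)"
    and f: "homogeneous_decomposition I U x f" and h: "homogeneous_decomposition I U y h"
  shows "homogeneous_decomposition I U (r *\<^sub>R x + s *\<^sub>R y) (\<lambda>g. r *\<^sub>R f g + s *\<^sub>R h g)"
proof (rule homogeneous_decompositionI)
  let ?F = "{g. f g \<noteq> 0} \<union> {g. h g \<noteq> 0}"
  show fin: "finite ?F" using f h by (simp add: homogeneous_decomposition_def)
  have xy: "x = sum f ?F" "y = sum h ?F"
    using homogeneous_decomposition_superset[OF f fin] homogeneous_decomposition_superset[OF h fin] by auto
  show "r *\<^sub>R x + s *\<^sub>R y = (\<Sum>g\<in>?F. r *\<^sub>R f g + s *\<^sub>R h g)"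
    unfolding sum.distrib scaleR_sum_right[symmetric] xy[symmetric] ..
  show "r *\<^sub>R f g + s *\<^sub>R h g \<in> U g" if "g \<in> I" for g
    using f h sub that by (simp add: homogeneous_decomposition_def subspace_add subspace_scale)
qed (use f h in \<open>auto simp: homogeneous_decomposition_def\<close>)

lemma homogeneous_decomposition_single:
  assumes "\<forall>g\<in>I. subspace (U g)" "h \<in> I" "x \<in> U h"
  shows "homogeneous_decomposition I U x (\<lambda>g. if g = h then x else 0)"
proof (rule homogeneous_decompositionI)
  show "(if g = h then x else 0) \<in> U g" if "g \<in> I" for g
    using assms that by (simp add: subspace_0)
  show "finite {h}" "x = (\<Sum>g\<in>{h}. if g = h then x else 0)" by simp_all
qed (use assms(2) in auto)

lemma direct_sum_independent:
  assumes U: "direct_sum_decomposition I U" and F: "finite F" "F \<subseteq> I"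
    and f: "\<And>g. g \<in> F \<Longrightarrow> f g \<in> U g" and s: "sum f F = 0" and g: "g \<in> F"
  shows "f g = 0"
proof -
  let ?f = "\<lambda>g. if g \<in> F then f g else 0"
  have 0: "0 \<in> U g" if "g \<in> I" for g
    using U that subspace_0 unfolding direct_sum_decomposition_def by blast
  have "homogeneous_decomposition I U 0 ?f"
  proof (rule homogeneous_decompositionI[OF _ _ F(1)])
    show "0 = sum ?f F" using s by simp
  qed (use F f 0 in auto)
  moreover have "homogeneous_decomposition I U 0 (\<lambda>g. 0)"
    using 0 by (simp add: homogeneous_decomposition_def)
  ultimately have "?f = (\<lambda>g. 0)" using U unfolding direct_sum_decomposition_iff_unique by blast
  then show ?thesis using g by meson
qed

text \<open>
  Spanning and independence, in contrast to unique decomposability, can be verified separately for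
  images, doubles and spans of basis vectors.
\<close>

lemma direct_sum_decomposition_iff:
  "direct_sum_decomposition I U \<longleftrightarrow>
    (\<forall>g\<in>I. subspace (U g)) \<and> span (\<Union>g\<in>I. U g) = UNIV \<and>
    (\<forall>F f. finite F \<longrightarrow> F \<subseteq> I \<longrightarrow> (\<forall>g\<in>F. f g \<in> U g) \<longrightarrow> sum f F = 0 \<longrightarrow> (\<forall>g\<in>F. f g = 0))"
  (is "?L \<longleftrightarrow> ?R")
proof
  assume L: ?L
  have "x \<in> span (\<Union>g\<in>I. U g)" for x
  proof -
    obtain f where f: "\<forall>g\<in>I. f g \<in> U g" "\<forall>g. g \<notin> I \<longrightarrow> f g = 0" "x = (\<Sum>g | f g \<noteq> 0. f g)"
      using L unfolding direct_sum_decomposition_iff_unique homogeneous_decomposition_def by blast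
    have "f g \<in> span (\<Union>g\<in>I. U g)" if "f g \<noteq> 0" for g using f that by (blast intro: span_base)
    then show ?thesis unfolding f(3) by (intro span_sum) simp
  qed
  then show ?R using L direct_sum_independent[OF L] by (auto simp: direct_sum_decomposition_def)
next
  assume R: ?R
  then have sub: "\<forall>g\<in>I. subspace (U g)" by simp
  let ?D = "homogeneous_decomposition I U"
  have ex: "\<exists>f. ?D x f" for x
  proof -
    have "x \<in> span (\<Union>g\<in>I. U g)" using R by auto
    then show ?thesis
    proof (induction rule: span_induct_alt)
      case base
      show ?case
        by (intro exI[of _ "\<lambda>_. 0"]) (use sub in \<open>simp add: homogeneous_decomposition_def subspace_0\<close>)
    next
      case (step c x y)
      then obtain h f where h: "h \<in> I" "x \<in> U h" and f: "?D y f" by blast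
      show ?case
        using homogeneous_decomposition_linear[OF sub homogeneous_decomposition_single[OF sub h] f, of c 1]
        by auto
    qed
  qed
  have un: "f = h" if f: "?D x f" and h: "?D x h" for x f h
  proof
    fix g
    have d: "?D 0 (\<lambda>g. f g - h g)" using homogeneous_decomposition_linear[OF sub f h, of 1 "- 1"] by simp
    define F where "F = {g. f g - h g \<noteq> 0}"
    have F: "finite F" "F \<subseteq> I" "\<forall>g\<in>F. f g - h g \<in> U g" "(\<Sum>g\<in>F. f g - h g) = 0"
      using d unfolding homogeneous_decomposition_def F_def by auto
    have "(\<forall>g\<in>F. k g \<in> U g) \<longrightarrow> sum k F = 0 \<longrightarrow> (\<forall>g\<in>F. k g = 0)" for k
      using R F(1,2) by blast
    from this[of "\<lambda>g. f g - h g"] have "\<forall>g\<in>F. f g - h g = 0" using F(3,4) by blast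
    then show "f g = h g" by (auto simp: F_def)
  qed
  have "\<exists>!f. ?D x f" for x using ex[of x] un[of x] by (rule ex_ex1I)
  then show ?L using sub unfolding direct_sum_decomposition_iff_unique by simp
qed

lemma direct_sum_subspace: "direct_sum_decomposition I U \<Longrightarrow> g \<in> I \<Longrightarrow> subspace (U g)"
  by (simp add: direct_sum_decomposition_def)

lemma direct_sum_span: "direct_sum_decomposition I U \<Longrightarrow> span (\<Union>g\<in>I. U g) = UNIV"
  by (drule direct_sum_decomposition_iff[THEN iffD1]) (elim conjE)

definition homogeneous_projection ::
  "'g set \<Rightarrow> ('g \<Rightarrow> 'v::real_vector set) \<Rightarrow> 'g \<Rightarrow> ('v \<Rightarrow> 'v) \<Rightarrow> bool" where
  "homogeneous_projection I U g p \<longleftrightarrow> linear p \<and> (\<forall>x. p x \<in> U g) \<and> (\<forall>x\<in>U g. p x = x) \<and>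
    (\<forall>h\<in>I - {g}. \<forall>x\<in>U h. p x = 0)"

text \<open>
  The projection takes the \<open>g\<close>-th entry of the decomposition; it is linear because the
  decomposition of a linear combination is, by uniqueness, the linear combination of the
  decompositions.
\<close>

lemma ex_homogeneous_projection:
  assumes U: "direct_sum_decomposition I U" and g: "g \<in> I"
  shows "\<exists>p. homogeneous_projection I U g p"
proof -
  have sub: "\<forall>g\<in>I. subspace (U g)" using direct_sum_subspace[OF U] by blast
  define c where "c x = (THE f. homogeneous_decomposition I U x f)" for x
  have ex1: "\<exists>!f. homogeneous_decomposition I U x f" for x
    using U unfolding direct_sum_decomposition_iff_unique by blast
  have c: "homogeneous_decomposition I U x (c x)" for x unfolding c_def by (rule theI'[OF ex1])
  have c_eq: "c x = f" if "homogeneous_decomposition I U x f" for x f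
    using ex1[of x] c[of x] that by blast
  have lin: "c (r *\<^sub>R x + s *\<^sub>R y) = (\<lambda>g. r *\<^sub>R c x g + s *\<^sub>R c y g)" for r s x y
    by (rule c_eq[OF homogeneous_decomposition_linear[OF sub c c]])
  have "linear (\<lambda>x. c x g)"
  proof (rule linearI)
    show "c (x + y) g = c x g + c y g" for x y using lin[of 1 x 1 y] by simp
    show "c (r *\<^sub>R x) g = r *\<^sub>R c x g" for r x using lin[of r x 0 x] by simp
  qed
  moreover have "c x h = (if h = k then x else 0)" if "k \<in> I" "x \<in> U k" for x h k
    using c_eq[OF homogeneous_decomposition_single[OF sub that]] by simp
  moreover have "c x g \<in> U g" for x using c[of x] g by (simp add: homogeneous_decomposition_def)
  ultimately have "homogeneous_projection I U g (\<lambda>x. c x g)"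
    using g by (auto simp: homogeneous_projection_def)
  then show ?thesis by blast
qed

text \<open>
  The projection onto \<open>U' g\<close> fixes \<open>U g\<close> and vanishes on the other \<open>U h\<close>. As these span the space,
  all its values lie in \<open>U g\<close>, and its values include \<open>U' g\<close>.
\<close>

lemma direct_sum_mono_eq:
  assumes U: "direct_sum_decomposition I U" and U': "direct_sum_decomposition I U'"
    and le: "\<And>g. g \<in> I \<Longrightarrow> U g \<subseteq> U' g" and g: "g \<in> I"
  shows "U g = U' g"
proof -
  obtain p where "homogeneous_projection I U' g p" using ex_homogeneous_projection[OF U' g] ..
  then have p: "linear p" "\<And>x. p x \<in> U' g" "\<And>x. x \<in> U' g \<Longrightarrow> p x = x"
    "\<And>h x. h \<in> I \<Longrightarrow> h \<noteq> g \<Longrightarrow> x \<in> U' h \<Longrightarrow> p x = 0"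
    by (auto simp: homogeneous_projection_def)
  have sg: "subspace (U g)" using U g by (auto simp: direct_sum_subspace direct_sum_span)
  have pU: "p x \<in> U g" for x
  proof -
    have "x \<in> span (\<Union>g\<in>I. U g)" using U by (auto simp: direct_sum_subspace direct_sum_span)
    then show ?thesis
    proof (induction rule: span_induct_alt)
      case base show ?case using p(1) sg by (simp add: linear_0 subspace_0)
    next
      case (step c x y)
      then obtain h where h: "h \<in> I" "x \<in> U h" by blast
      have "p x \<in> U g"
        using h p(3)[of x] p(4)[of h x] le[of h] sg by (cases "h = g") (auto simp: subspace_0)
      then show ?case using step p(1) sg
        by (simp add: linear_add linear_scale subspace_add subspace_scale)
    qed
  qed
  have "x \<in> U g" if "x \<in> U' g" for x using pU[of x] p(3)[OF that] by simp
  then show ?thesis using le[OF g] by blast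
qed

lemma direct_sum_image:
  assumes U: "direct_sum_decomposition I U" and l: "linear \<phi>" and b: "bij \<phi>"
  shows "direct_sum_decomposition I (\<lambda>g. \<phi> ` U g)"
  unfolding direct_sum_decomposition_iff
proof (intro conjI ballI allI impI)
  have dU: "\<And>g. g \<in> I \<Longrightarrow> subspace (U g)" "span (\<Union>g\<in>I. U g) = UNIV" using U by (auto simp: direct_sum_subspace direct_sum_span)
  show "subspace (\<phi> ` U g)" if "g \<in> I" for g using that dU l by (simp add: linear_subspace_image)
  have "span (\<Union>g\<in>I. \<phi> ` U g) = \<phi> ` span (\<Union>g\<in>I. U g)"
    using linear_span_image[OF l] by (metis image_UN)
  then show "span (\<Union>g\<in>I. \<phi> ` U g) = UNIV" using dU b by (simp add: bij_is_surj)
  fix F f g assume F: "finite F" "F \<subseteq> I" "\<forall>g\<in>F. f g \<in> \<phi> ` U g" "sum f F = 0" "g \<in> F"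
  have inv: "inv_into UNIV \<phi> (f g) \<in> U g" "\<phi> (inv_into UNIV \<phi> (f g)) = f g" if "g \<in> F" for g
    using F(3) that b by (auto simp: bij_is_inj bij_is_surj surj_f_inv_f)
  have "\<phi> (\<Sum>g\<in>F. inv_into UNIV \<phi> (f g)) = 0" using F inv by (simp add: linear_sum[OF l])
  then have "(\<Sum>g\<in>F. inv_into UNIV \<phi> (f g)) = 0" using b l by (metis bij_is_inj linear_0 injD)
  then have "inv_into UNIV \<phi> (f g) = 0" using F inv by (intro direct_sum_independent[OF U, of F "\<lambda>g. inv_into UNIV \<phi> (f g)"])
  then show "f g = 0" using inv(2)[OF F(5)] l by (metis linear_0)
qed

lemma direct_sum_basis_family:
  fixes b :: "'i \<Rightarrow> 'v::euclidean_space"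
  assumes J: "finite J" "inj_on b J" "independent (b ` J)" "span (b ` J) = UNIV"
    and d: "\<And>i. i \<in> J \<Longrightarrow> d i \<in> I"
  shows "direct_sum_decomposition I (\<lambda>g. span (b ` {i \<in> J. d i = g}))"
  unfolding direct_sum_decomposition_iff
proof (intro conjI ballI allI impI)
  show "subspace (span (b ` {i \<in> J. d i = g}))" for g by simp
  have "b ` J \<subseteq> (\<Union>g\<in>I. span (b ` {i \<in> J. d i = g}))" using d by (auto intro: span_base)
  then show "span (\<Union>g\<in>I. span (b ` {i \<in> J. d i = g})) = UNIV"
    using J(4) by (metis span_mono top.extremum_uniqueI)
  fix F f g assume F: "finite F" "F \<subseteq> I" "\<forall>g\<in>F. f g \<in> span (b ` {i \<in> J. d i = g})" "sum f F = 0" "g \<in> F"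
  have "\<exists>c. f g = (\<Sum>i\<in>{i \<in> J. d i = g}. c i *\<^sub>R b i)" if "g \<in> F" for g
  proof -
    have "f g \<in> span (b ` {i \<in> J. d i = g})" using F(3) that by blast
    then obtain c where "f g = (\<Sum>x\<in>b ` {i \<in> J. d i = g}. c x *\<^sub>R x)"
      using span_finite[of "b ` {i \<in> J. d i = g}"] J(1) by auto
    also have "\<dots> = (\<Sum>i\<in>{i \<in> J. d i = g}. c (b i) *\<^sub>R b i)"
      by (subst sum.reindex) (auto intro: inj_on_subset[OF J(2)])
    finally show ?thesis by (rule exI[of _ "\<lambda>i. c (b i)"])
  qed
  then obtain c where c: "\<And>g. g \<in> F \<Longrightarrow> f g = (\<Sum>i\<in>{i \<in> J. d i = g}. c g i *\<^sub>R b i)" by metis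
  let ?J = "{i \<in> J. d i \<in> F}"
  have "0 = (\<Sum>g\<in>F. \<Sum>i\<in>{i \<in> ?J. d i = g}. c (d i) i *\<^sub>R b i)"
    unfolding F(4)[symmetric] by (intro sum.cong refl) (auto simp: c intro!: sum.cong)
  also have "\<dots> = (\<Sum>i\<in>?J. c (d i) i *\<^sub>R b i)"
    using J F by (intro sum.group) auto
  also have "\<dots> = (\<Sum>x\<in>b ` ?J. (\<lambda>x. c (d (the_inv_into J b x)) (the_inv_into J b x)) x *\<^sub>R x)"
    by (subst sum.reindex) (auto intro: inj_on_subset[OF J(2)] simp: the_inv_into_f_f[OF J(2)])
  finally have 0: "(\<Sum>x\<in>b ` ?J. (\<lambda>x. c (d (the_inv_into J b x)) (the_inv_into J b x)) x *\<^sub>R x) = 0" ..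
  have "c (d i) i = 0" if "i \<in> ?J" for i
    using independentD[OF J(3) _ _ 0, of "b i"] J(1) that by (auto simp: the_inv_into_f_f[OF J(2)])
  then have "c g i = 0" if "i \<in> {i \<in> J. d i = g}" for i using F(5) that by blast
  then show "f g = 0" using F(5) by (simp add: c)
qed

section \<open>Gradings of Cayley--Dickson doubles\<close>

text \<open>
  If the new element \<open>w\<close> has degree \<open>t\<close> with \<open>t = inv t\<close>, then \<open>b w\<close> has degree \<open>g\<close> exactly when
  \<open>b\<close> has degree \<open>g t\<close>.
\<close>

definition cd_grading :: "('g, 'b) monoid_scheme \<Rightarrow> ('g \<Rightarrow> 'v set) \<Rightarrow> 'g \<Rightarrow> 'g \<Rightarrow> ('v \<times> 'v) set" where
  "cd_grading G X t g = X g \<times> X (g \<otimes>\<^bsub>G\<^esub> t)"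

definition trivial_grading :: "('g, 'b) monoid_scheme \<Rightarrow> 'g \<Rightarrow> ('v::zero) set" where
  "trivial_grading G g = (if g = \<one>\<^bsub>G\<^esub> then UNIV else {0})"

lemma linear_Pair0: "linear (\<lambda>x. (x, 0))" "linear (Pair 0)"
  by (auto intro!: linearI)

lemma (in comm_group) involution_cancel:
  assumes "t \<in> carrier G" "t \<otimes> t = \<one>" "g \<in> carrier G"
  shows "g \<otimes> t \<otimes> t = g"
  using assms by (simp add: m_assoc)

text \<open>
  The first coordinates decompose along \<open>X\<close>, and so do the second ones after the permutation
  \<open>g \<mapsto> g t\<close> of the degrees.
\<close>

lemma (in comm_group) direct_sum_cd_grading:
  fixes X :: "'a \<Rightarrow> ('v::real_vector) set"
  assumes X: "direct_sum_decomposition (carrier G) X" and t: "t \<in> carrier G" "t \<otimes> t = \<one>"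
  shows "direct_sum_decomposition (carrier G) (cd_grading G X t)"
  unfolding direct_sum_decomposition_iff
proof (intro conjI ballI allI impI)
  have sX: "subspace (X g)" if "g \<in> carrier G" for g using X that by (auto simp: direct_sum_subspace direct_sum_span)
  note inv = involution_cancel[OF t]
  show "subspace (cd_grading G X t g)" if "g \<in> carrier G" for g
    using that t by (auto simp: cd_grading_def intro!: subspace_Times sX)
  let ?S = "\<Union>g\<in>carrier G. cd_grading G X t g"
  have "(a, 0) \<in> span ?S" for a
  proof -
    have "(\<lambda>x. (x, 0)) ` (\<Union>g\<in>carrier G. X g) \<subseteq> ?S"
      using t by (auto simp: cd_grading_def intro!: subspace_0[OF sX])
    moreover have "(a, 0::'v) \<in> (\<lambda>x. (x, 0)) ` span (\<Union>g\<in>carrier G. X g)"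
      using X by (auto simp: direct_sum_subspace direct_sum_span)
    ultimately show ?thesis
      using linear_span_image[OF linear_Pair0(1), of "\<Union>g\<in>carrier G. X g"] by (auto dest: span_mono)
  qed
  moreover have "(0, a) \<in> span ?S" for a
  proof -
    have "Pair 0 ` (\<Union>g\<in>carrier G. X g) \<subseteq> ?S"
    proof
      fix y :: "'v \<times> 'v" assume "y \<in> Pair 0 ` (\<Union>g\<in>carrier G. X g)"
      then obtain g x where g: "g \<in> carrier G" "x \<in> X g" "y = (0, x)" by blast
      then have "y \<in> cd_grading G X t (g \<otimes> t)"
        using t inv[OF g(1)] subspace_0[OF sX] by (simp add: cd_grading_def)
      then show "y \<in> ?S" using g t by blast
    qed
    moreover have "(0::'v, a) \<in> Pair 0 ` span (\<Union>g\<in>carrier G. X g)"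
      using X by (auto simp: direct_sum_subspace direct_sum_span)
    ultimately show ?thesis
      using linear_span_image[OF linear_Pair0(2), of "\<Union>g\<in>carrier G. X g"] by (auto dest: span_mono)
  qed
  ultimately have "(a, 0) + (0, b) \<in> span ?S" for a b by (intro span_add)
  then show "span ?S = UNIV" by auto
  fix F f g assume F: "finite F" "F \<subseteq> carrier G" "\<forall>g\<in>F. f g \<in> cd_grading G X t g" "sum f F = 0" "g \<in> F"
  have "fst (f g) = 0"
    using F by (intro direct_sum_independent[OF X, of F "\<lambda>g. fst (f g)"])
      (auto simp: cd_grading_def mem_Times_iff fst_sum[symmetric])
  moreover have "snd (f ((g \<otimes> t) \<otimes> t)) = 0"
  proof (rule direct_sum_independent[OF X, of "(\<lambda>g. g \<otimes> t) ` F" "\<lambda>g. snd (f (g \<otimes> t))"])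
    have "inj_on (\<lambda>g. g \<otimes> t) F" using F(2) t by (intro inj_onI) (metis inv subsetD)
    then have "(\<Sum>g\<in>(\<lambda>g. g \<otimes> t) ` F. snd (f (g \<otimes> t))) = (\<Sum>g\<in>F. snd (f g))"
      using F(2) inv by (subst sum.reindex) (auto intro!: sum.cong)
    then show "(\<Sum>g\<in>(\<lambda>g. g \<otimes> t) ` F. snd (f (g \<otimes> t))) = 0" using F by (simp add: snd_sum[symmetric])
    show "snd (f (h \<otimes> t)) \<in> X h" if "h \<in> (\<lambda>g. g \<otimes> t) ` F" for h
      using that F inv by (auto simp: cd_grading_def mem_Times_iff subset_iff)
  qed (use F t in auto)
  ultimately show "f g = 0" using F inv by (auto simp: prod_eq_iff subset_iff)
qed

text \<open>
  Gradings are extended to doubles, whose product involves conjugates; these have to keep their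
  degree.
\<close>

definition conj_invariant :: "('g, 'b) monoid_scheme \<Rightarrow> 'v calg \<Rightarrow> ('g \<Rightarrow> 'v set) \<Rightarrow> bool" where
  "conj_invariant G B X \<longleftrightarrow> (\<forall>g\<in>carrier G. \<forall>x\<in>X g. aconj B x \<in> X g)"

text \<open>
  Degrees are compatible with the product of the double because \<open>(g t) (h t) = g h\<close> and
  \<open>(g t) h = g (h t) = (g h) t\<close>.
\<close>

lemma (in comm_group) grading_cd_grading:
  assumes X: "grading G B X" and cj: "conj_invariant G B X" and t: "t \<in> carrier G" "t \<otimes> t = \<one>"
  shows "grading G (cayley_dickson B \<alpha>) (cd_grading G X t)"
    "conj_invariant G (cayley_dickson B \<alpha>) (cd_grading G X t)"
proof -
  note inv = involution_cancel[OF t]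
  have sX: "subspace (X g)" if "g \<in> carrier G" for g using X that by (auto simp: grading_def direct_sum_subspace)
  have m: "amult B x y \<in> X k" if "x \<in> X g" "y \<in> X h" "k = g \<otimes> h" "g \<in> carrier G" "h \<in> carrier G" for x y g h k
    using X that by (auto simp: grading_def)
  have c: "aconj B x \<in> X g" if "x \<in> X g" "g \<in> carrier G" for x g
    using cj that by (auto simp: conj_invariant_def)
  have e: "(h \<otimes> t) \<otimes> (g \<otimes> t) = g \<otimes> h" "(h \<otimes> t) \<otimes> g = (g \<otimes> h) \<otimes> t" "(g \<otimes> t) \<otimes> h = (g \<otimes> h) \<otimes> t"
     if "g \<in> carrier G" "h \<in> carrier G" for g h
    using that t m_ac inv by (auto simp: m_ac)
  show "grading G (cayley_dickson B \<alpha>) (cd_grading G X t)"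
    unfolding grading_def
  proof (intro conjI ballI)
    show "direct_sum_decomposition (carrier G) (cd_grading G X t)"
      using direct_sum_cd_grading t X by (auto simp: grading_def)
    fix g h x y
    assume g: "g \<in> carrier G" and h: "h \<in> carrier G" and x: "x \<in> cd_grading G X t g" and y: "y \<in> cd_grading G X t h"
    obtain a b c' d where xy: "x = (a, b)" "y = (c', d)" by fastforce
    have *: "a \<in> X g" "b \<in> X (g \<otimes> t)" "c' \<in> X h" "d \<in> X (h \<otimes> t)"
      using x y by (auto simp: xy cd_grading_def)
    have "amult B a c' \<in> X (g \<otimes> h)" "amult B (aconj B d) b \<in> X (g \<otimes> h)"
      "amult B d a \<in> X (g \<otimes> h \<otimes> t)" "amult B b (aconj B c') \<in> X (g \<otimes> h \<otimes> t)"
      using * g h t e c m by (metis m_closed)+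
    then show "amult (cayley_dickson B \<alpha>) x y \<in> cd_grading G X t (g \<otimes> h)"
      using g h t by (simp add: xy cayley_dickson_def cd_grading_def sX subspace_add subspace_scale)
  qed
  show "conj_invariant G (cayley_dickson B \<alpha>) (cd_grading G X t)"
    using t by (auto simp: conj_invariant_def cayley_dickson_def cd_grading_def c sX subspace_neg)
qed

lemma (in group) grading_trivial_grading:
  assumes "bilinear (amult B)"
  shows "grading G B (trivial_grading G)"
  unfolding grading_def direct_sum_decomposition_iff
proof (intro conjI ballI allI impI)
  show "subspace (trivial_grading G g)" for g by (simp add: trivial_grading_def)
  have "UNIV \<subseteq> (\<Union>g\<in>carrier G. trivial_grading G g)" by (auto simp: trivial_grading_def intro!: bexI[of _ \<one>])
  then show "span (\<Union>g\<in>carrier G. trivial_grading G g) = UNIV"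
    by (metis span_UNIV top.extremum_uniqueI)
  show "amult B x y \<in> trivial_grading G (g \<otimes> h)"
    if "g \<in> carrier G" "h \<in> carrier G" "x \<in> trivial_grading G g" "y \<in> trivial_grading G h" for g h x y
    using that by (auto simp: trivial_grading_def bilinear_lzero[OF assms] bilinear_rzero[OF assms] split: if_splits)
  fix F f g
  assume F: "finite F" "F \<subseteq> carrier G" "\<forall>g\<in>F. f g \<in> trivial_grading G g" "sum f F = 0" "g \<in> F"
  have z: "f g = 0" if "g \<in> F" "g \<noteq> \<one>" for g using F that by (auto simp: trivial_grading_def)
  show "f g = 0"
  proof (cases "g = \<one>")
    case True
    have "sum f F = f \<one> + sum f (F - {\<one>})" using F True by (subst sum.remove[of _ \<one>]) auto
    also have "sum f (F - {\<one>}) = 0" using z by (intro sum.neutral) auto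
    finally show ?thesis using F True by simp
  qed (use z F in auto)
qed

lemma grading_image:
  assumes X: "grading G B X" and \<phi>: "linear \<phi>" "bij \<phi>" "\<And>x y. \<phi> (amult B x y) = amult A (\<phi> x) (\<phi> y)"
    and U: "\<And>g. g \<in> carrier G \<Longrightarrow> U g = \<phi> ` X g" and G: "group G"
  shows "grading G A U"
proof -
  interpret group G by (rule G)
  have "direct_sum_decomposition (carrier G) U = direct_sum_decomposition (carrier G) (\<lambda>g. \<phi> ` X g)"
    unfolding direct_sum_decomposition_def using U by (simp cong: ball_cong)
  then show ?thesis using direct_sum_image[of "carrier G" X \<phi>] X \<phi> U
    unfolding grading_def by auto (metis \<phi>(3) image_eqI)
qed

section \<open>Subgroups generated by involutions\<close>

text \<open>
  For an involution \<open>t\<close> outside a subgroup \<open>S\<close> this is the subgroup generated by \<open>S\<close> and \<open>t\<close>.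
  Enlarging the group of degrees in this way runs parallel to Cayley--Dickson doubling.
\<close>

definition coset_extension :: "('g, 'b) monoid_scheme \<Rightarrow> 'g set \<Rightarrow> 'g \<Rightarrow> 'g set" where
  "coset_extension G S t = S \<union> (\<lambda>s. s \<otimes>\<^bsub>G\<^esub> t) ` S"

context comm_group
begin

lemma subgroup_coset_extension:
  assumes S: "subgroup S G" and t: "t \<in> carrier G" "t \<otimes> t = \<one>"
  shows "subgroup (coset_extension G S t) G"
proof -
  interpret S: subgroup S G by (rule S)
  note inv = involution_cancel[OF t]
  have it: "inv t = t" using t by (simp add: inv_equality)
  have e: "a \<otimes> (b \<otimes> t) = a \<otimes> b \<otimes> t" "a \<otimes> t \<otimes> b = a \<otimes> b \<otimes> t" "a \<otimes> t \<otimes> (b \<otimes> t) = a \<otimes> b"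
    if "a \<in> S" "b \<in> S" for a b
    using that t inv[of b] by (simp_all add: m_ac)
  show ?thesis
  proof (rule subgroupI)
    show "coset_extension G S t \<subseteq> carrier G" using t by (auto simp: coset_extension_def)
    show "coset_extension G S t \<noteq> {}" using S.one_closed unfolding coset_extension_def by blast
    show "inv a \<in> coset_extension G S t" if "a \<in> coset_extension G S t" for a
      using that t it by (auto simp: coset_extension_def inv_mult)
    show "a \<otimes> b \<in> coset_extension G S t" if "a \<in> coset_extension G S t" "b \<in> coset_extension G S t" for a b
      using that by (auto simp: coset_extension_def e)
  qed
qed

lemma coset_extension_disjoint:
  assumes S: "subgroup S G" and t: "t \<in> carrier G" "t \<otimes> t = \<one>" "t \<notin> S" and s: "s \<in> S"
  shows "s \<otimes> t \<notin> S"
proof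
  interpret S: subgroup S G by (rule S)
  assume "s \<otimes> t \<in> S"
  then have "inv s \<otimes> (s \<otimes> t) \<in> S" using s by blast
  then show False using s t by (simp add: m_assoc[symmetric])
qed

lemma card_coset_extension:
  assumes S: "subgroup S G" and t: "t \<in> carrier G" "t \<otimes> t = \<one>" "t \<notin> S" and fin: "finite S"
  shows "card (coset_extension G S t) = 2 * card S"
proof -
  interpret S: subgroup S G by (rule S)
  have "inj_on (\<lambda>s. s \<otimes> t) S" using t by (auto intro!: inj_onI)
  moreover have "S \<inter> (\<lambda>s. s \<otimes> t) ` S = {}"
    using coset_extension_disjoint[OF S t] by blast
  ultimately show ?thesis
    unfolding coset_extension_def using fin by (simp add: card_Un_disjoint card_image)
qed

lemma generate_insert_involution:
  assumes t: "t \<in> carrier G" "t \<otimes> t = \<one>" and S: "S \<subseteq> carrier G"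
  shows "generate G (insert t S) = coset_extension G (generate G S) t"
proof
  have g: "subgroup (generate G S) G" using S generate_is_subgroup by blast
  have "t \<in> coset_extension G (generate G S) t"
    using t generate.one[of G S] by (force simp: coset_extension_def)
  moreover have "S \<subseteq> coset_extension G (generate G S) t"
    by (auto simp: coset_extension_def intro: generate.incl)
  ultimately show "generate G (insert t S) \<subseteq> coset_extension G (generate G S) t"
    using generate_subgroup_incl subgroup_coset_extension[OF g t] by blast
  have "generate G S \<subseteq> generate G (insert t S)" by (rule mono_generate) blast
  then show "coset_extension G (generate G S) t \<subseteq> generate G (insert t S)"
    by (auto simp: coset_extension_def intro!: generate.eng intro: generate.incl)
qed

lemma generate_chain:
  assumes "t \<in> carrier G" "t \<otimes> t = \<one>"
  shows "generate G {t} = coset_extension G {\<one>} t"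
    and "s \<in> carrier G \<Longrightarrow> generate G {s, t} = coset_extension G (generate G {s}) t"
    and "s \<in> carrier G \<Longrightarrow> r \<in> carrier G \<Longrightarrow>
      generate G {r, s, t} = coset_extension G (generate G {r, s}) t"
proof -
  show "generate G {t} = coset_extension G {\<one>} t"
    using generate_insert_involution[OF assms, of "{}"] generate_empty by simp
  show "generate G {s, t} = coset_extension G (generate G {s}) t" if "s \<in> carrier G"
    using generate_insert_involution[OF assms, of "{s}"] that by (simp add: insert_commute)
  have "{r, s, t} = insert t {r, s}" by blast
  then show "generate G {r, s, t} = coset_extension G (generate G {r, s}) t"
    if "s \<in> carrier G" "r \<in> carrier G"
    using generate_insert_involution[OF assms, of "{r, s}"] that by simp
qed

lemma subgroup_generate_mem:
  assumes "subgroup T G" "T = generate G S" shows "S \<subseteq> carrier G"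
  using assms by (auto intro: generate.incl dest: subgroup.subset)

text \<open>
  The products of the generators exhaust \<open>T\<close>, so by counting they have to be distinct.
\<close>

lemma generate_two_distinct:
  assumes T: "T \<in> elementary_abelian_2_subgroups G 4" and gen: "generate G {s, t} = T"
  shows "T = {\<one>, s, t, s \<otimes> t}" "distinct [\<one>, s, t, s \<otimes> t]" "s \<in> carrier G" "t \<in> carrier G"
    "s \<otimes> s = \<one>" "t \<otimes> t = \<one>"
proof -
  have Tg: "subgroup T G" "card T = 4" "\<And>x. x \<in> T \<Longrightarrow> x \<otimes> x = \<one>"
    using T by (auto simp: elementary_abelian_2_subgroups_def elementary_abelian_2_def)
  show st: "s \<in> carrier G" "t \<in> carrier G" using subgroup_generate_mem[OF Tg(1) gen[symmetric]] by auto
  have "s \<in> T" "t \<in> T" using gen by (auto intro: generate.incl)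
  then show inv: "s \<otimes> s = \<one>" "t \<otimes> t = \<one>" using Tg(3) by auto
  show T': "T = {\<one>, s, t, s \<otimes> t}"
    unfolding gen[symmetric] generate_insert_involution[OF st(1) inv(1), of "{t}", simplified, OF st(2)]
      generate_insert_involution[OF st(2) inv(2), of "{}", simplified] generate_empty
    using st m_comm by (auto simp: coset_extension_def)
  then show "distinct [\<one>, s, t, s \<otimes> t]" using Tg(2) by (intro card_distinct) simp
qed

lemma generate_three_distinct:
  assumes T: "T \<in> elementary_abelian_2_subgroups G 8" and gen: "generate G {r, s, t} = T"
  shows "T = {\<one>, r, s, r \<otimes> s, t, r \<otimes> t, s \<otimes> t, r \<otimes> s \<otimes> t}"
    "distinct [\<one>, r, s, r \<otimes> s, t, r \<otimes> t, s \<otimes> t, r \<otimes> s \<otimes> t]"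
    "r \<in> carrier G" "s \<in> carrier G" "t \<in> carrier G" "r \<otimes> r = \<one>" "s \<otimes> s = \<one>" "t \<otimes> t = \<one>"
proof -
  have Tg: "subgroup T G" "card T = 8" "\<And>x. x \<in> T \<Longrightarrow> x \<otimes> x = \<one>"
    using T by (auto simp: elementary_abelian_2_subgroups_def elementary_abelian_2_def)
  show st: "r \<in> carrier G" "s \<in> carrier G" "t \<in> carrier G"
    using subgroup_generate_mem[OF Tg(1) gen[symmetric]] by auto
  have "r \<in> T" "s \<in> T" "t \<in> T" using gen by (auto intro: generate.incl)
  then show inv: "r \<otimes> r = \<one>" "s \<otimes> s = \<one>" "t \<otimes> t = \<one>" using Tg(3) by auto
  show T': "T = {\<one>, r, s, r \<otimes> s, t, r \<otimes> t, s \<otimes> t, r \<otimes> s \<otimes> t}"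
    unfolding gen[symmetric] generate_insert_involution[OF st(1) inv(1), of "{s, t}", simplified, OF conjI[OF st(2,3)]]
      generate_insert_involution[OF st(2) inv(2), of "{t}", simplified, OF st(3)]
      generate_insert_involution[OF st(3) inv(3), of "{}", simplified] generate_empty
    using st by (auto simp: coset_extension_def m_ac)
  then show "distinct [\<one>, r, s, r \<otimes> s, t, r \<otimes> t, s \<otimes> t, r \<otimes> s \<otimes> t]"
    using Tg(2) by (intro card_distinct) simp
qed

end

section \<open>Gradings of composition algebras\<close>

locale graded_composition_algebra = composition_algebra A + comm_group G
  for A :: "'v::euclidean_space calg" and G :: "('g, 'b) monoid_scheme" (structure) +
  fixes U :: "'g \<Rightarrow> 'v set"
  assumes grading: "grading G A U"
begin

lemma direct_sum: "direct_sum_decomposition (carrier G) U"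
  using grading by (simp add: grading_def)

lemma subspace_component: "g \<in> carrier G \<Longrightarrow> subspace (U g)"
  using direct_sum_subspace[OF direct_sum] .

lemma zero_in [simp]: "g \<in> carrier G \<Longrightarrow> 0 \<in> U g"
  by (simp add: subspace_0 subspace_component)

lemma mult_in: "x \<in> U g \<Longrightarrow> y \<in> U h \<Longrightarrow> g \<in> carrier G \<Longrightarrow> h \<in> carrier G \<Longrightarrow> x \<odot> y \<in> U (g \<otimes> h)"
  using grading by (simp add: grading_def)

definition hproj where "hproj g = (SOME p. homogeneous_projection (carrier G) U g p)"

lemma hproj:
  assumes "g \<in> carrier G"
  shows linear_hproj: "linear (hproj g)" and hproj_in: "hproj g x \<in> U g" and hproj_id: "x \<in> U g \<Longrightarrow> hproj g x = x"
    and hproj_other: "h \<in> carrier G \<Longrightarrow> h \<noteq> g \<Longrightarrow> x \<in> U h \<Longrightarrow> hproj g x = 0"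
proof -
  have "homogeneous_projection (carrier G) U g (hproj g)"
    unfolding hproj_def using ex_homogeneous_projection[OF direct_sum assms] by (rule someI_ex)
  then show "linear (hproj g)" "hproj g x \<in> U g" "x \<in> U g \<Longrightarrow> hproj g x = x"
    "h \<in> carrier G \<Longrightarrow> h \<noteq> g \<Longrightarrow> x \<in> U h \<Longrightarrow> hproj g x = 0"
    by (auto simp: homogeneous_projection_def)
qed

lemma homogeneous_induct [case_names zero add homogeneous]:
  assumes "Q 0" "\<And>x y. Q x \<Longrightarrow> Q y \<Longrightarrow> Q (x + y)" "\<And>g x. g \<in> carrier G \<Longrightarrow> x \<in> U g \<Longrightarrow> Q x"
  shows "Q x"
proof -
  have "x \<in> span (\<Union>g\<in>carrier G. U g)" using direct_sum_span[OF direct_sum] by simp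
  then show ?thesis
  proof (induction rule: span_induct_alt)
    case (step c x y)
    then obtain g where "g \<in> carrier G" "x \<in> U g" by blast
    then have "Q (c *\<^sub>R x)" by (intro assms(3)) (auto intro: subspace_scale subspace_component)
    then show ?case using assms(2) step by blast
  qed (rule assms)
qed

text \<open>
  Let \<open>\<epsilon>\<close> be the component of degree \<open>e\<close> of the unit. For homogeneous \<open>x\<close>, the component of degree
  \<open>deg x\<close> in \<open>x = 1 x\<close> is \<open>x = \<epsilon> x\<close>. So \<open>\<epsilon>\<close> is a left unit, and \<open>1 = \<epsilon> 1 = \<epsilon>\<close>.
\<close>

lemma unit_in: "\<e> \<in> U \<one>"
proof -
  let ?\<epsilon> = "hproj \<one> \<e>"
  \<comment> \<open>Right multiplication by \<open>x\<close> of degree \<open>h\<close> moves only the neutral component of \<open>y\<close> into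
      degree \<open>h\<close>.\<close>
  have *: "hproj h (y \<odot> x) = hproj \<one> y \<odot> x" if h: "h \<in> carrier G" "x \<in> U h" for h x y
  proof (induction y rule: homogeneous_induct)
    case zero
    then show ?case using h by (simp add: linear_0[OF linear_hproj] mult_simps)
  next
    case (add y z)
    then show ?case using h by (simp add: linear_add[OF linear_hproj] mult_simps)
  next
    case (homogeneous g y)
    show ?case
    proof (cases "g = \<one>")
      case True
      then show ?thesis using homogeneous h mult_in[of y \<one> x h] by (simp add: hproj_id)
    next
      case False
      then have "g \<otimes> h \<noteq> h" using homogeneous h by (simp add: r_cancel_one)
      then show ?thesis
        using homogeneous h mult_in[of y g x h] False hproj_other[of h "g \<otimes> h"] hproj_other[of \<one> g y]
        by (simp add: mult_simps)
    qed
  qed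
  have "?\<epsilon> \<odot> x = x" for x
  proof (induction x rule: homogeneous_induct)
    case (homogeneous g y)
    then show ?case using *[of g y \<e>] by (simp add: hproj_id)
  qed (simp_all add: mult_simps)
  from this[of \<e>] show ?thesis using hproj_in[of \<one> \<e>] by simp
qed

text \<open>
  In \<open>x\<^sup>2 = n(x, 1) x - n(x) 1\<close> the square has degree \<open>g\<^sup>2 \<noteq> g\<close> and the unit has degree \<open>e \<noteq> g\<close>,
  so the component of degree \<open>g\<close> is \<open>0 = n(x, 1) x\<close>.
\<close>

lemma trace_zero: "x \<in> U g \<Longrightarrow> g \<in> carrier G \<Longrightarrow> g \<noteq> \<one> \<Longrightarrow> P x \<e> = 0"
proof -
  assume x: "x \<in> U g" and g: "g \<in> carrier G" "g \<noteq> \<one>"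
  have "hproj g (x \<odot> x) = 0"
    using x g mult_in[OF x x] by (intro hproj_other[of g "g \<otimes> g"]) (simp_all add: r_cancel_one)
  moreover have "hproj g \<e> = 0" using g unit_in by (intro hproj_other[of g \<one>]) auto
  ultimately have "P x \<e> *\<^sub>R x = 0"
    using g x by (simp add: quadratic_equation linear_diff[OF linear_hproj] linear_scale[OF linear_hproj] hproj_id)
  then show ?thesis by (auto simp: polar_simps)
qed

lemma cj_in: "x \<in> U g \<Longrightarrow> g \<in> carrier G \<Longrightarrow> cj x \<in> U g"
  using trace_zero[of x g] unit_in subspace_component[of g] unfolding cj_def
  by (cases "g = \<one>") (auto intro: subspace_diff subspace_scale simp: subspace_neg)

text \<open>
  The number \<open>P x y\<close> is the trace of \<open>x \<odot> cj y\<close>, an element of degree \<open>g \<otimes> h\<close>.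
\<close>

lemma polar_zero:
  "x \<in> U g \<Longrightarrow> y \<in> U h \<Longrightarrow> g \<in> carrier G \<Longrightarrow> h \<in> carrier G \<Longrightarrow> g \<otimes> h \<noteq> \<one> \<Longrightarrow> P x y = 0"
  using trace_zero[of "x \<odot> cj y" "g \<otimes> h"] mult_in[of x g "cj y" h] cj_in[of y h]
  by (simp add: polar_unit_mult_cj)

lemma polar_hproj:
  assumes x: "x \<in> U g" "g \<in> carrier G" shows "P x z = P x (hproj (inv g) z)"
proof (induction z rule: homogeneous_induct)
  case zero
  then show ?case using x by (simp add: linear_0[OF linear_hproj])
next
  case (add y z)
  then show ?case using x by (simp add: linear_add[OF linear_hproj] polar_simps)
next
  case (homogeneous h y)
  show ?case
  proof (cases "h = inv g")
    case False
    then have "g \<otimes> h \<noteq> \<one>" using homogeneous x by (metis inv_equality m_comm)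
    then show ?thesis using homogeneous x False hproj_other[of "inv g" h y] by (simp add: polar_zero polar_simps)
  qed (use homogeneous x in \<open>simp add: hproj_id\<close>)
qed

lemma polar_partner:
  assumes x: "x \<in> U g" "g \<in> carrier G" "x \<noteq> 0"
  obtains y where "y \<in> U (inv g)" "P x y \<noteq> 0"
  using nondegenerate[of x] polar_hproj[OF x(1,2)] hproj_in[of "inv g"] x by (metis inv_closed)

end

section \<open>Gradings with anisotropic neutral component\<close>

locale anisotropic_grading = graded_composition_algebra +
  assumes anisotropic: "x \<in> U \<one> \<Longrightarrow> N x = 0 \<Longrightarrow> x = 0"
begin

text \<open>
  For \<open>y\<close> of the inverse degree with \<open>P x y \<noteq> 0\<close>, the element \<open>x \<odot> cj y\<close> of the neutral component
  has nonzero trace, hence is nonzero and of nonzero norm. Then \<open>P x x = 2 * N x\<close> is nonzero too,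
  which is only possible for \<open>g \<otimes> g = \<one>\<close>.
\<close>

lemma homogeneous_norm_nonzero:
  assumes x: "x \<in> U g" "g \<in> carrier G" "x \<noteq> 0"
  shows "N x \<noteq> 0" and "g \<otimes> g = \<one>"
proof -
  obtain y where y: "y \<in> U (inv g)" "P x y \<noteq> 0" using polar_partner[OF x] .
  have w: "x \<odot> cj y \<in> U \<one>" using mult_in[of x g "cj y" "inv g"] cj_in[of y "inv g"] x y by simp
  have "P (x \<odot> cj y) \<e> \<noteq> 0" using y by (simp add: polar_unit_mult_cj)
  then have "x \<odot> cj y \<noteq> 0" by (metis bilinear_lzero[OF bilinear_polar])
  then show N: "N x \<noteq> 0" using anisotropic[OF w] by (auto simp: norm_mult)
  then show "g \<otimes> g = \<one>" using polar_zero[of x g x g] x by (auto simp: polar_self)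
qed

lemma polar_zero_distinct: "x \<in> U g \<Longrightarrow> y \<in> U h \<Longrightarrow> g \<in> carrier G \<Longrightarrow> h \<in> carrier G \<Longrightarrow> g \<noteq> h \<Longrightarrow> P x y = 0"
  by (metis homogeneous_norm_nonzero(2) inv_equality inv_inv polar_zero bilinear_lzero[OF bilinear_polar])

text \<open>
  If \<open>N x\<close> were negative, the quadratic polynomial \<open>N (x + s \<e>)\<close> in \<open>s\<close> would have a real root and
  the neutral component an isotropic vector.
\<close>

lemma neutral_norm_pos:
  assumes x: "x \<in> U \<one>" "x \<noteq> 0" shows "N x > 0"
proof (rule ccontr)
  assume "\<not> N x > 0"
  then have neg: "N x < 0" using anisotropic x by force
  \<comment> \<open>The discriminant of \<open>s\<^sup>2 + P x \<e> * s + N x\<close> is positive, and \<open>s\<close> is one of its two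
      roots.\<close>
  define d where "d = sqrt ((P x \<e>)\<^sup>2 - 4 * N x)"
  define s where "s = (d - P x \<e>) / 2"
  have "d\<^sup>2 = (P x \<e>)\<^sup>2 - 4 * N x" unfolding d_def using neg zero_le_power2[of "P x \<e>"] by (intro real_sqrt_pow2) linarith
  then have "N (x + s *\<^sub>R \<e>) = 0"
    by (simp add: norm_add norm_scale polar_simps s_def power2_eq_square field_simps)
  moreover have "x + s *\<^sub>R \<e> \<in> U \<one>"
    using x unit_in by (auto intro: subspace_add subspace_scale subspace_component)
  ultimately have "x + s *\<^sub>R \<e> = 0" using anisotropic by blast
  then have "x = - s *\<^sub>R \<e>" by (simp add: eq_neg_iff_add_eq_0)
  then show False using neg norm_scale[of "- s" \<e>] by auto
qed

text \<open>
  A homogeneous \<open>x\<close> is invertible, so \<open>y\<close> can be divided by it on the right within the grading.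
\<close>

lemma component_eq:
  assumes x: "x \<in> U t" "t \<in> carrier G" "x \<noteq> 0" and s: "s \<in> carrier G" and y: "y \<in> U (s \<otimes> t)"
  obtains c where "c \<in> U s" "y = c \<odot> x"
proof
  let ?c = "(1 / N x) *\<^sub>R (y \<odot> cj x)"
  have "s \<otimes> t \<otimes> t = s" using homogeneous_norm_nonzero(2)[OF x] x s by (simp add: m_assoc)
  then show "?c \<in> U s"
    using mult_in[OF y cj_in[OF x(1,2)]] x s by (auto intro: subspace_scale subspace_component)
  show "y = ?c \<odot> x"
    using mult_cj_cancel[of y "cj x"] homogeneous_norm_nonzero(1)[OF x] by (simp add: mult_simps)
qed

lemma component_eq_rmul:
  assumes x: "x \<in> U t" "t \<in> carrier G" "x \<noteq> 0"
  shows "U t = rmul A (U \<one>) x"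
proof
  show "U t \<subseteq> rmul A (U \<one>) x"
  proof
    fix y assume "y \<in> U t"
    then have "y \<in> U (\<one> \<otimes> t)" using x by simp
    then show "y \<in> rmul A (U \<one>) x" using component_eq[OF x one_closed] unfolding rmul_def by blast
  qed
  show "rmul A (U \<one>) x \<subseteq> U t" using mult_in[of _ \<one> x t] x by (auto simp: rmul_def)
qed

text \<open>
  The quotient of \<open>y\<close> by \<open>x\<close> lies in the neutral component, where the norm is positive.
\<close>

lemma sign_constant:
  assumes "x \<in> U t" "y \<in> U t" "t \<in> carrier G" "x \<noteq> 0" "y \<noteq> 0"
  shows "sgn (N x) = sgn (N y)"
proof -
  obtain c where c: "c \<in> U \<one>" "y = c \<odot> x"
    using component_eq_rmul[of x t] assms by (auto simp: rmul_def)
  then have "N c > 0" using assms by (intro neutral_norm_pos) (auto simp: mult_simps)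
  then show ?thesis by (simp add: c norm_mult sgn_mult)
qed

text \<open>
  A partial model describes the part of the graded algebra with degrees in the subgroup \<open>S\<close>: the
  map \<open>\<phi>\<close> embeds \<open>B\<close> onto the sum of the components \<open>U g\<close> with \<open>g \<in> S\<close>, and \<open>X\<close> is the grading of
  \<open>B\<close> that corresponds to \<open>U\<close>.
\<close>

definition partial_model :: "'b set \<Rightarrow> ('d::euclidean_space) calg \<Rightarrow> ('d \<Rightarrow> 'a) \<Rightarrow> ('b \<Rightarrow> 'd set) \<Rightarrow> bool" where
  "partial_model S B \<phi> X \<longleftrightarrow> subgroup S G \<and> embedding B \<phi> \<and> nondegenerate_norm B \<and>
    (\<forall>g\<in>S. \<phi> ` X g = U g) \<and> (\<forall>g\<in>carrier G - S. X g = {0}) \<and> range \<phi> \<subseteq> span (\<Union>g\<in>S. U g)"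

lemma partial_model_neutral:
  assumes "embedding B \<phi>" "nondegenerate_norm B" "range \<phi> = U \<one>"
  shows "partial_model {\<one>} B \<phi> (trivial_grading G)"
  using assms triv_subgroup
  by (auto simp: partial_model_def trivial_grading_def intro: span_base)

lemma partial_model_orth:
  assumes st: "partial_model S B \<phi> X" and t: "t \<in> carrier G" "t \<notin> S" and u: "u \<in> U t"
  shows "u \<in> orth A (range \<phi>)"
proof -
  have sub: "S \<subseteq> carrier G" using st subgroup.subset by (auto simp: partial_model_def)
  have "P u x = 0" if "x \<in> span (\<Union>g\<in>S. U g)" for x using that
  proof (induction rule: span_induct_alt)
    case (step c x y)
    then show ?case using polar_zero_distinct[OF u _ t(1)] t sub by (auto simp: polar_simps)
  qed (simp add: polar_simps)
  then show ?thesis using st by (auto simp: partial_model_def orth_def subset_iff)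
qed

text \<open>
  Right multiplication by \<open>u\<close> maps \<open>U s\<close> onto \<open>U (s \<otimes> t)\<close>. Thus doubling by \<open>u\<close> adds exactly the
  components with degree in the coset of \<open>t\<close>.
\<close>

lemma partial_model_double:
  assumes st: "partial_model S B \<phi> X" and t: "t \<in> carrier G" "t \<notin> S" and u: "u \<in> U t" "u \<noteq> 0"
  shows "partial_model (coset_extension G S t) (cayley_dickson B (- N u)) (cd_map \<phi> u) (cd_grading G X t)"
proof -
  have S: "subgroup S G" and em: "embedding B \<phi>" and nd: "nondegenerate_norm B"
    and X: "\<And>g. g \<in> S \<Longrightarrow> \<phi> ` X g = U g" "\<And>g. g \<in> carrier G \<Longrightarrow> g \<notin> S \<Longrightarrow> X g = {0}"
    and range: "range \<phi> \<subseteq> span (\<Union>g\<in>S. U g)"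
    using st by (auto simp: partial_model_def)
  interpret S: subgroup S G by (rule S)
  have tt: "t \<otimes> t = \<one>" and Nu: "N u \<noteq> 0" using homogeneous_norm_nonzero[of u t] u t by auto
  note inv = involution_cancel[OF t(1) tt]
  have l: "linear \<phi>" and \<phi>0: "\<phi> 0 = 0" using em by (auto simp: embedding_def linear_0)
  note disj = coset_extension_disjoint[OF S t(1) tt t(2)]
  have o: "u \<in> orth A (range \<phi>)" using partial_model_orth[OF st t u(1)] .
  have 1: "cd_map \<phi> u ` cd_grading G X t g = U g" if g: "g \<in> S" for g
    using X(1)[OF g] X(2)[of "g \<otimes> t"] disj[OF g] g t
    by (auto simp: cd_map_def cd_grading_def \<phi>0 mult_simps image_iff) (metis image_iff)+
  have 2: "cd_map \<phi> u ` cd_grading G X t (s \<otimes> t) = U (s \<otimes> t)" if s: "s \<in> S" for s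
  proof -
    have "cd_map \<phi> u ` cd_grading G X t (s \<otimes> t) = (\<lambda>c. c \<odot> u) ` \<phi> ` X s"
      using X(2)[of "s \<otimes> t"] disj[OF s] s t inv[of s]
      by (auto simp: cd_map_def cd_grading_def \<phi>0 image_iff)
    also have "\<dots> = U (s \<otimes> t)"
      unfolding X(1)[OF s]
      using component_eq[OF u(1) t(1) u(2), of s] mult_in[OF _ u(1), of _ s] s t by (auto; blast)
    finally show ?thesis .
  qed
  have "cd_map \<phi> u ` cd_grading G X t g = U g" if "g \<in> coset_extension G S t" for g
    using that 1 2 by (auto simp: coset_extension_def)
  moreover have "cd_grading G X t g = {0}" if g: "g \<in> carrier G - coset_extension G S t" for g
  proof -
    have "g \<otimes> t \<notin> S" using inv[of g] g unfolding coset_extension_def by force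
    then show ?thesis using g t X(2) by (auto simp: cd_grading_def coset_extension_def zero_prod_def)
  qed
  moreover have "cd_map \<phi> u (a, b) \<in> span (\<Union>g\<in>coset_extension G S t. U g)" for a b
  proof -
    have "\<phi> a \<in> span (\<Union>g\<in>coset_extension G S t. U g)"
      using range span_mono[of "\<Union>g\<in>S. U g" "\<Union>g\<in>coset_extension G S t. U g"]
      by (auto simp: coset_extension_def)
    moreover have "x \<odot> u \<in> span (\<Union>g\<in>coset_extension G S t. U g)" if "x \<in> span (\<Union>g\<in>S. U g)" for x
      using that
    proof (induction rule: span_induct_alt)
      case base show ?case by (simp add: mult_simps span_zero)
    next
      case (step c x y)
      then obtain s where s: "s \<in> S" "x \<in> U s" by blast
      then have "x \<odot> u \<in> (\<Union>g\<in>coset_extension G S t. U g)"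
        using mult_in[of x s u t] u t by (auto simp: coset_extension_def)
      then show ?case using step by (auto simp: mult_simps intro: span_add span_scale span_base)
    qed
    then have "\<phi> b \<odot> u \<in> span (\<Union>g\<in>coset_extension G S t. U g)" using range by blast
    ultimately show ?thesis by (simp add: cd_map_def span_add)
  qed
  then have "range (cd_map \<phi> u) \<subseteq> span (\<Union>g\<in>coset_extension G S t. U g)" by auto
  ultimately show ?thesis
    unfolding partial_model_def
    using subgroup_coset_extension[OF S t(1) tt] embedding_cd[OF em o] nondegenerate_norm_cd[OF nd] Nu
    by simp
qed

lemma partial_model_continue:
  assumes st: "partial_model S (B :: 'd::euclidean_space calg) \<phi> X" and "DIM('d) < DIM('a)"
  obtains t u where "t \<in> carrier G" "t \<notin> S" "u \<in> U t" "u \<noteq> 0"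
proof -
  have em: "embedding B \<phi>" and nd: "nondegenerate_norm B" and X: "\<And>g. g \<in> S \<Longrightarrow> \<phi> ` X g = U g"
    using st by (auto simp: partial_model_def)
  have l: "linear \<phi>" using em by (simp add: embedding_def)
  have False if "\<And>t. t \<in> carrier G \<Longrightarrow> t \<notin> S \<Longrightarrow> U t \<subseteq> {0}"
  proof -
    have sr: "subspace (range \<phi>)" using l by (simp add: linear_subspace_image)
    have "x \<in> range \<phi>" for x
    proof (induction x rule: homogeneous_induct)
      case zero show ?case using sr by (rule subspace_0)
    next
      case (add x y) then show ?case using sr by (simp add: subspace_add)
    next
      case (homogeneous g x)
      then show ?case using that[of g] X[of g] subspace_0[OF sr] by (cases "g \<in> S") auto
    qed
    then have "DIM('a) \<le> DIM('d)"
      using dim_image_le[OF l, of UNIV] by (metis UNIV_eq_I dim_UNIV)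
    then show False using assms(2) by simp
  qed
  then show thesis using that by blast
qed

text \<open>
  Components with degree outside \<open>S\<close> are orthogonal to the image, hence vanish as soon as the
  image is everything.
\<close>

lemma partial_model_final:
  assumes st: "partial_model S (B :: 'd::euclidean_space calg) \<phi> X" and "DIM('d) = DIM('a)"
  shows "bij \<phi>" and "g \<in> carrier G \<Longrightarrow> \<phi> ` X g = U g" and "g \<in> carrier G \<Longrightarrow> g \<notin> S \<Longrightarrow> U g = {0}"
proof -
  have em: "embedding B \<phi>" and nd: "nondegenerate_norm B" and X: "\<And>g. g \<in> S \<Longrightarrow> \<phi> ` X g = U g"
     and X0: "\<And>g. g \<in> carrier G \<Longrightarrow> g \<notin> S \<Longrightarrow> X g = {0}" and S: "S \<subseteq> carrier G"
    using st subgroup.subset by (auto simp: partial_model_def)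
  have l: "linear \<phi>" using em by (simp add: embedding_def)
  show b: "bij \<phi>" using embedding_bij[OF em nd assms(2)] .
  show *: "U g = {0}" if "g \<in> carrier G" "g \<notin> S" for g
  proof -
    have "u = 0" if "u \<in> U g" for u
      using partial_model_orth[OF st \<open>g \<in> carrier G\<close> \<open>g \<notin> S\<close> that] bij_is_surj[OF b]
      by (intro nondegenerate) (auto simp: orth_def)
    then show ?thesis using that zero_in by blast
  qed
  show "\<phi> ` X g = U g" if "g \<in> carrier G"
    using X[of g] X0[of g] *[of g] that linear_0[OF l] by (cases "g \<in> S") auto
qed

end

section \<open>Homomorphisms are isometric\<close>

context composition_algebra
begin

text \<open>
  Unless \<open>x\<close> is a multiple of the unit, the images of \<open>x\<close> and of the unit are linearly
  independent. Comparing the quadratic equation of \<open>\<phi> x\<close> with the image of that of \<open>x\<close> then gives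
  equality of both coefficients.
\<close>

lemma injective_hom_norm:
  assumes B: "composition_algebra B" and l: "linear \<phi>" and i: "inj \<phi>"
    and m: "\<And>x y. \<phi> (amult B x y) = \<phi> x \<odot> \<phi> y" and u: "\<phi> (aunit B) = \<e>"
  shows "N (\<phi> x) = anorm B x"
proof -
  interpret B: composition_algebra B by (rule B)
  show ?thesis
  proof (cases "\<exists>r. x = r *\<^sub>R aunit B")
    case True
    then show ?thesis using u by (auto simp: linear_scale[OF l] norm_scale B.norm_scale)
  next
    case False
    define t where "t = polar B x (aunit B)"
    have "P (\<phi> x) \<e> *\<^sub>R \<phi> x - N (\<phi> x) *\<^sub>R \<e> = \<phi> (amult B x x)" by (simp add: m quadratic_equation)
    also have "\<dots> = t *\<^sub>R \<phi> x - anorm B x *\<^sub>R \<e>"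
      by (simp add: B.quadratic_equation t_def linear_diff[OF l] linear_scale[OF l] u)
    finally have eq: "(P (\<phi> x) \<e> - t) *\<^sub>R \<phi> x = (N (\<phi> x) - anorm B x) *\<^sub>R \<e>"
      by (simp add: algebra_simps)
    have "P (\<phi> x) \<e> - t = 0"
    proof (rule ccontr)
      assume "P (\<phi> x) \<e> - t \<noteq> 0"
      then have "\<phi> x = ((N (\<phi> x) - anorm B x) / (P (\<phi> x) \<e> - t)) *\<^sub>R \<phi> (aunit B)"
        using arg_cong[OF eq, of "\<lambda>y. (1 / (P (\<phi> x) \<e> - t)) *\<^sub>R y"] u by simp
      then have "x = ((N (\<phi> x) - anorm B x) / (P (\<phi> x) \<e> - t)) *\<^sub>R aunit B"
        using i by (metis injD linear_scale[OF l])
      then show False using False by blast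
    qed
    then show ?thesis using eq by simp
  qed
qed

lemma injective_hom_embedding:
  assumes B: "composition_algebra B" and cj: "\<And>x. aconj B x = polar B x (aunit B) *\<^sub>R aunit B - x"
    and l: "linear \<phi>" and i: "inj \<phi>"
    and m: "\<And>x y. \<phi> (amult B x y) = \<phi> x \<odot> \<phi> y" and u: "\<phi> (aunit B) = \<e>"
  shows "embedding B \<phi>"
proof -
  note n = injective_hom_norm[OF B l i m u]
  have p: "P (\<phi> x) (\<phi> y) = polar B x y" for x y
    unfolding polar_def n[symmetric] linear_add[OF l] ..
  show ?thesis
    unfolding embedding_def using l m u n
    by (simp add: cj cj_def linear_diff[OF l] linear_scale[OF l] flip: u p)
qed

lemma automorphism_unit:
  assumes "bij \<phi>" "\<And>x y. \<phi> (x \<odot> y) = \<phi> x \<odot> \<phi> y" shows "\<phi> \<e> = \<e>"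
proof -
  obtain y where "\<phi> y = \<e>" using assms(1) by (metis bij_pointE)
  then show ?thesis by (metis assms(2) unit_left unit_right)
qed

lemma automorphism_norm:
  assumes "linear \<phi>" "bij \<phi>" "\<And>x y. \<phi> (x \<odot> y) = \<phi> x \<odot> \<phi> y" shows "N (\<phi> x) = N x"
  by (rule injective_hom_norm[where B = A and \<phi> = \<phi>])
     (fact composition_algebra_axioms assms(1) bij_is_inj[OF assms(2)] assms(3) automorphism_unit[OF assms(2,3)])+

lemma embedding_subalgebra:
  assumes "embedding B \<phi>" "nondegenerate_norm B"
  shows "subalgebra_isomorphic_to A (range \<phi>) B"
proof -
  have "unital_subalgebra (range \<phi>)" using unital_subalgebra_range assms(1) .
  moreover have "bij_betw \<phi> UNIV (range \<phi>)"
    using embedding_inj[OF assms] by (simp add: bij_betw_def)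
  ultimately show ?thesis
    using assms(1) unfolding subalgebra_isomorphic_to_def unital_subalgebra_def embedding_def by blast
qed

text \<open>
  Being isomorphic as an algebra is all that the descriptions of the gradings require of the
  neutral component; the isomorphism is automatically isometric by \<open>injective_hom_norm\<close>.
\<close>

lemma subalgebra_embedding:
  assumes "subalgebra_isomorphic_to A S B" and B: "composition_algebra B"
    and cj: "\<And>x. aconj B x = polar B x (aunit B) *\<^sub>R aunit B - x"
  obtains \<phi> where "embedding B \<phi>" "range \<phi> = S"
proof -
  obtain \<phi> where \<phi>: "linear \<phi>" "bij_betw \<phi> UNIV S" "\<And>x y. \<phi> (amult B x y) = \<phi> x \<odot> \<phi> y"
    and e: "\<e> \<in> S"
    using assms(1) by (auto simp: subalgebra_isomorphic_to_def)
  have r: "range \<phi> = S" "inj \<phi>" using \<phi>(2) by (auto simp: bij_betw_def)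
  obtain y where y: "\<phi> y = \<e>" using e r(1) by (metis rangeE)
  have "\<phi> (aunit B) = \<e>"
    by (metis B \<phi>(3) composition_algebra.unit_left unit_right y)
  then show thesis using that injective_hom_embedding[OF B cj \<phi>(1) r(2) \<phi>(3)] r by blast
qed

end

section \<open>The neutral component of an anisotropic grading\<close>

text \<open>
  The reals are the starting point of the doublings when the neutral component is one-dimensional.
\<close>

definition real_alg :: "real calg" where
  "real_alg = \<lparr> amult = (*), aunit = 1, aconj = (\<lambda>x. x), anorm = (\<lambda>x. x\<^sup>2) \<rparr>"

lemma nondegenerate_real: "nondegenerate_norm real_alg"
proof -
  have "x = 0" if "\<And>y. polar real_alg x y = 0" for x
    using that[of x] by (simp add: polar_def real_alg_def power2_eq_square algebra_simps)
  then show ?thesis by (auto simp: nondegenerate_norm_def real_alg_def)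
qed

lemma (in composition_algebra) nondegenerate_self: "nondegenerate_norm A"
  using nondegenerate by (auto simp: nondegenerate_norm_def)

lemmas nondegenerate_complex = composition_algebra.nondegenerate_self[OF composition_algebra_complex]
lemmas nondegenerate_quaternion = composition_algebra.nondegenerate_self[OF composition_algebra_quaternion]

context composition_algebra
begin

lemma embedding_real: "embedding real_alg (\<lambda>r. r *\<^sub>R \<e>)"
  by (simp add: embedding_def real_alg_def norm_scale mult_simps cj_simps linear_scaleR_left mult.commute)

lemma embedding_complex:
  assumes u: "P u \<e> = 0" "N u = 1"
  shows "embedding complex_alg (\<lambda>z. Re z *\<^sub>R \<e> + Im z *\<^sub>R u)"
proof -
  have uu: "u \<odot> u = - \<e>" using quadratic_equation[of u] u by simp
  have eu: "P \<e> u = 0" using u polar_commute by simp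
  show ?thesis
    by (auto simp: embedding_def complex_alg_def norm_add norm_scale mult_simps cj_simps polar_simps uu eu
        cj_orth[OF u(1)] u cmod_power2 algebra_simps intro!: linearI)
qed

end

context anisotropic_grading
begin

text \<open>
  Splitting an element of the neutral component outside the image into its components in the image
  and orthogonal to it yields a nonzero orthogonal vector, which has positive norm and can be
  normalized.
\<close>

lemma neutral_orth_vector:
  assumes em: "embedding B \<phi>" and nd: "nondegenerate_norm B"
    and r: "range \<phi> \<subseteq> U \<one>" "range \<phi> \<noteq> U \<one>"
  obtains u where "u \<in> U \<one>" "u \<in> orth A (range \<phi>)" "N u = 1"
proof -
  have s1: "subspace (U \<one>)" by (simp add: subspace_component)
  obtain z where z: "z \<in> U \<one>" "z \<notin> range \<phi>" using r by blast
  obtain p s where ps: "p \<in> range \<phi>" "s \<in> orth A (range \<phi>)" "z = p + s"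
    using embedding_decomposition[OF em nd] by blast
  have p1: "p \<in> U \<one>" using ps(1) r(1) by blast
  have s: "s \<in> U \<one>" using subspace_diff[OF s1 z(1) p1] ps(3) by simp
  have "s \<noteq> 0" using ps z(2) by auto
  with s have pos: "N s > 0" by (rule neutral_norm_pos)
  show thesis
  proof
    let ?u = "(1 / sqrt (N s)) *\<^sub>R s"
    show "?u \<in> U \<one>" using s by (intro subspace_scale[OF s1])
    show "?u \<in> orth A (range \<phi>)" using ps(2) by (auto simp: orth_def polar_simps)
    show "N ?u = 1" using pos by (simp add: norm_scale power_divide)
  qed
qed

lemma range_cd_map_neutral:
  assumes "range \<phi> \<subseteq> U \<one>" "u \<in> U \<one>" shows "range (cd_map \<phi> u) \<subseteq> U \<one>"
proof -
  have "\<phi> a + \<phi> b \<odot> u \<in> U \<one>" for a b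
    using mult_in[of "\<phi> b" \<one> u \<one>] assms by (auto intro!: subspace_add subspace_component)
  then show ?thesis by (auto simp: cd_map_def)
qed

text \<open>
  The norm is positive definite on the neutral component. Beginning with the multiples of the unit
  and doubling by unit vectors as long as the neutral component is not exhausted, one passes
  through copies of the complex numbers and of the quaternions; a third doubling would give the
  whole algebra.
\<close>

lemma neutral_component_cases:
  assumes dim: "DIM('a) = 8" and nt: "U \<one> \<noteq> UNIV"
  obtains (real) "range (\<lambda>r. r *\<^sub>R \<e>) = U \<one>"
  | (complex) \<phi> where "embedding complex_alg \<phi>" "range \<phi> = U \<one>"
  | (quaternion) \<phi> where "embedding quaternion_alg \<phi>" "range \<phi> = U \<one>"
proof (cases "range (\<lambda>r. r *\<^sub>R \<e>) = U \<one>")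
  case False
  have s1: "subspace (U \<one>)" by (simp add: subspace_component)
  have "range (\<lambda>r. r *\<^sub>R \<e>) \<subseteq> U \<one>" using unit_in by (auto intro: subspace_scale[OF s1])
  then obtain u where u: "u \<in> U \<one>" "u \<in> orth A (range (\<lambda>r. r *\<^sub>R \<e>))" "N u = 1"
    using neutral_orth_vector[OF embedding_real nondegenerate_real] False by blast
  have "P u (1 *\<^sub>R \<e>) = 0" using u(2) unfolding orth_def by blast
  then have em1: "embedding complex_alg (\<lambda>z. Re z *\<^sub>R \<e> + Im z *\<^sub>R u)" (is "embedding _ ?\<phi>")
    using embedding_complex u(3) by simp
  have r1: "range ?\<phi> \<subseteq> U \<one>" using u(1) unit_in by (auto intro!: subspace_add[OF s1] subspace_scale[OF s1])
  show thesis
  proof (cases "range ?\<phi> = U \<one>")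
    case True
    then show thesis using complex[OF em1] by blast
  next
    case False
    obtain v where v: "v \<in> U \<one>" "v \<in> orth A (range ?\<phi>)" "N v = 1"
      using neutral_orth_vector[OF em1 nondegenerate_complex r1 False] .
    have em2: "embedding quaternion_alg (cd_map ?\<phi> v)"
      unfolding quaternion_alg_def using embedding_cd[OF em1 v(2)] v(3) by simp
    note r2 = range_cd_map_neutral[OF r1 v(1)]
    show thesis
    proof (cases "range (cd_map ?\<phi> v) = U \<one>")
      case True
      then show thesis using quaternion[OF em2] by blast
    next
      case False
      obtain w where w: "w \<in> U \<one>" "w \<in> orth A (range (cd_map ?\<phi> v))" "N w = 1"
        using neutral_orth_vector[OF em2 nondegenerate_quaternion r2 False] .
      have em3: "embedding (cayley_dickson quaternion_alg (- 1)) (cd_map (cd_map ?\<phi> v) w)"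
        using embedding_cd[OF em2 w(2)] w(3) by simp
      have "bij (cd_map (cd_map ?\<phi> v) w)"
        using em3 by (rule embedding_bij) (simp_all add: nondegenerate_norm_cd nondegenerate_quaternion dim)
      then have "U \<one> = UNIV" using range_cd_map_neutral[OF r2 w(1)] by (auto dest: bij_is_surj)
      then show thesis using nt by blast
    qed
  qed
qed (use real in blast)

end

section \<open>Uniqueness from signs\<close>

definition same_signs ::
  "('g, 'b) monoid_scheme \<Rightarrow> 'v::real_vector calg \<Rightarrow> ('g \<Rightarrow> 'v set) \<Rightarrow> ('g \<Rightarrow> 'v set) \<Rightarrow> bool" where
  "same_signs G A U U' \<longleftrightarrow> (\<forall>t\<in>carrier G. (U t = {0} \<longleftrightarrow> U' t = {0}) \<and>
    (\<forall>x\<in>U t - {0}. \<forall>x'\<in>U' t - {0}. sgn (anorm A x) = sgn (anorm A x')))"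

locale anisotropic_grading_pair =
  U: anisotropic_grading A G U + U': anisotropic_grading A G U'
  for A :: "'v::euclidean_space calg" and G :: "('g, 'b) monoid_scheme" (structure) and U U' +
  assumes signs: "same_signs G A U U'"
begin

text \<open>
  Both gradings are doubled in the same degree \<open>t\<close>. As the signs agree, the second vector can be
  rescaled to have the norm of the first one, so that the parameters of the two doubles agree.
\<close>

lemma partial_model_pair_double:
  assumes st: "U.partial_model S (B :: 'd::euclidean_space calg) \<phi> X" and st': "U'.partial_model S B \<phi>' X"
    and dim: "DIM('d) < DIM('v)"
  obtains S1 \<alpha> \<psi> \<psi>' X1 where "U.partial_model S1 (cayley_dickson B \<alpha>) \<psi> X1" "U'.partial_model S1 (cayley_dickson B \<alpha>) \<psi>' X1"
proof -
  obtain t u where t: "t \<in> carrier G" "t \<notin> S" and u: "u \<in> U t" "u \<noteq> 0"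
    using U.partial_model_continue[OF st dim] .
  have "U' t \<noteq> {0}" using signs t(1) u by (auto simp: same_signs_def)
  then obtain v where v: "v \<in> U' t" "v \<noteq> 0" using U'.zero_in[OF t(1)] by blast
  have sg: "sgn (U.N u) = sgn (U.N v)" using signs t(1) u v by (auto simp: same_signs_def)
  have Nu: "U.N u \<noteq> 0" using U.homogeneous_norm_nonzero(1)[OF u(1) t(1) u(2)] .
  have pos: "U.N u / U.N v > 0"
    using sg Nu by (auto simp: sgn_if zero_less_divide_iff split: if_splits)
  let ?v = "sqrt (U.N u / U.N v) *\<^sub>R v"
  have v': "?v \<in> U' t" "?v \<noteq> 0"
    using v pos by (auto intro: subspace_scale[OF U'.subspace_component[OF t(1)]])
  have "U.N ?v = U.N u" using pos by (auto simp: U.norm_scale)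
  then show thesis
    using that U.partial_model_double[OF st t u] U'.partial_model_double[OF st' t v'] by simp
qed

text \<open>
  When the common graded model \<open>B\<close> is everything, the isomorphism goes through it.
\<close>

lemma partial_model_pair_iso:
  assumes st: "U.partial_model S (B :: 'd::euclidean_space calg) \<phi> X" and st': "U'.partial_model S B \<phi>' X"
    and dim: "DIM('d) = DIM('v)"
  shows "grading_iso G A U U'"
proof -
  note f = U.partial_model_final[OF st dim] and f' = U'.partial_model_final[OF st' dim]
  have em: "U.embedding B \<phi>" "U.embedding B \<phi>'"
    using st st' by (auto simp: U.partial_model_def U'.partial_model_def)
  define \<theta> where "\<theta> = \<phi>' \<circ> inv_into UNIV \<phi>"
  have \<theta>: "\<theta> (\<phi> x) = \<phi>' x" for x using f(1) by (simp add: \<theta>_def bij_is_inj)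
  have surj: "\<exists>x. y = \<phi> x" for y using f(1) by (metis bij_pointE)
  have l: "linear \<phi>" "linear \<phi>'" and m: "\<And>x y. \<phi> (amult B x y) = amult A (\<phi> x) (\<phi> y)"
     "\<And>x y. \<phi>' (amult B x y) = amult A (\<phi>' x) (\<phi>' y)"
    using em by (auto simp: U.embedding_def)
  have "linear \<theta>"
  proof (rule linearI)
    fix x y and r :: real
    obtain a b where ab: "x = \<phi> a" "y = \<phi> b" using surj by metis
    show "\<theta> (x + y) = \<theta> x + \<theta> y" "\<theta> (r *\<^sub>R x) = r *\<^sub>R \<theta> x"
      unfolding ab linear_add[OF l(1), symmetric] linear_scale[OF l(1), symmetric] \<theta>
      by (simp_all add: linear_add[OF l(2)] linear_scale[OF l(2)])
  qed
  moreover have "bij \<theta>" unfolding \<theta>_def using f(1) f'(1) by (simp add: bij_comp bij_imp_bij_inv)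
  moreover have "\<theta> (amult A x y) = amult A (\<theta> x) (\<theta> y)" for x y
  proof -
    obtain a b where "x = \<phi> a" "y = \<phi> b" using surj by metis
    then show ?thesis by (simp add: \<theta> flip: m)
  qed
  moreover have "\<theta> ` U g = U' g" if "g \<in> carrier G" for g
    unfolding f(2)[OF that, symmetric] f'(2)[OF that, symmetric] by (simp add: image_image \<theta>)
  ultimately show ?thesis unfolding grading_iso_def by blast
qed

text \<open>
  The type of the model changes with every doubling, so the iteration is unrolled: one, two or
  three doublings remain.
\<close>

lemma partial_model_pair_iso_2:
  assumes "U.partial_model S (B :: 'd::euclidean_space calg) \<phi> X" "U'.partial_model S B \<phi>' X" "2 * DIM('d) = DIM('v)"
  shows "grading_iso G A U U'"
proof -
  have lt: "DIM('d) < DIM('v)" using assms(3) DIM_positive[where 'a='d] by linarith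
  obtain S1 \<alpha> \<psi> \<psi>' X1 where "U.partial_model S1 (cayley_dickson B \<alpha>) \<psi> X1" "U'.partial_model S1 (cayley_dickson B \<alpha>) \<psi>' X1"
    using partial_model_pair_double[OF assms(1,2) lt] .
  then show ?thesis by (rule partial_model_pair_iso) (simp add: assms(3)[symmetric])
qed

lemma partial_model_pair_iso_4:
  assumes "U.partial_model S (B :: 'd::euclidean_space calg) \<phi> X" "U'.partial_model S B \<phi>' X" "4 * DIM('d) = DIM('v)"
  shows "grading_iso G A U U'"
proof -
  have lt: "DIM('d) < DIM('v)" using assms(3) DIM_positive[where 'a='d] by linarith
  obtain S1 \<alpha> \<psi> \<psi>' X1 where "U.partial_model S1 (cayley_dickson B \<alpha>) \<psi> X1" "U'.partial_model S1 (cayley_dickson B \<alpha>) \<psi>' X1"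
    using partial_model_pair_double[OF assms(1,2) lt] .
  then show ?thesis by (rule partial_model_pair_iso_2) (simp add: assms(3)[symmetric])
qed

lemma partial_model_pair_iso_8:
  assumes "U.partial_model S (B :: 'd::euclidean_space calg) \<phi> X" "U'.partial_model S B \<phi>' X" "8 * DIM('d) = DIM('v)"
  shows "grading_iso G A U U'"
proof -
  have lt: "DIM('d) < DIM('v)" using assms(3) DIM_positive[where 'a='d] by linarith
  obtain S1 \<alpha> \<psi> \<psi>' X1 where "U.partial_model S1 (cayley_dickson B \<alpha>) \<psi> X1" "U'.partial_model S1 (cayley_dickson B \<alpha>) \<psi>' X1"
    using partial_model_pair_double[OF assms(1,2) lt] .
  then show ?thesis by (rule partial_model_pair_iso_4) (simp add: assms(3)[symmetric])
qed

theorem grading_iso_if_neutral_components_isomorphic: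
  assumes "U.embedding (B :: 'd::euclidean_space calg) \<phi>" "range \<phi> = U \<one>"
    and "U.embedding B \<phi>'" "range \<phi>' = U' \<one>" and B: "nondegenerate_norm B"
    and dim: "DIM('v) \<in> {2 * DIM('d), 4 * DIM('d), 8 * DIM('d)}"
  shows "grading_iso G A U U'"
proof -
  note st = U.partial_model_neutral[OF assms(1) B assms(2)] U'.partial_model_neutral[OF assms(3) B assms(4)]
  show ?thesis
    using partial_model_pair_iso_2[OF st] partial_model_pair_iso_4[OF st] partial_model_pair_iso_8[OF st] dim by auto
qed

end

section \<open>Recognizing the gradings with elementary abelian support\<close>

lemma sign_img_simps: "carrier sign_img = {-1, 1}" "x \<otimes>\<^bsub>sign_img\<^esub> y = x * y"
  by (simp_all add: sign_img_def)

context anisotropic_grading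
begin

definition sign_char :: "'b set \<Rightarrow> 'b \<Rightarrow> int" where
  "sign_char T = (\<lambda>t\<in>T. if \<exists>x\<in>U t. N x > 0 then 1 else - 1)"

lemma sign_char_eq:
  assumes "t \<in> T" "t \<in> carrier G" "x \<in> U t" "x \<noteq> 0"
  shows "real_of_int (sign_char T t) = sgn (N x)"
proof (cases "\<exists>y\<in>U t. N y > 0")
  case True
  then obtain y where y: "y \<in> U t" "N y > 0" by blast
  then have "y \<noteq> 0" by auto
  then have "sgn (N x) = 1" using sign_constant[of x t y] assms y by simp
  then show ?thesis using True assms by (simp add: sign_char_def)
next
  case False
  then have "N x < 0" using homogeneous_norm_nonzero(1)[of x t] assms by force
  then show ?thesis using False assms by (simp add: sign_char_def)
qed

lemma norm_signs_sign_char: "T \<subseteq> carrier G \<Longrightarrow> norm_signs A T (sign_char T) U"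
  unfolding norm_signs_def using sign_char_eq[symmetric] by blast

lemma mult_nonzero:
  assumes "x \<in> U s" "y \<in> U t" "s \<in> carrier G" "t \<in> carrier G" "x \<noteq> 0" "y \<noteq> 0"
  shows "x \<odot> y \<noteq> 0"
proof
  assume "x \<odot> y = 0"
  then have "N x * N y = 0" using norm_mult[of x y] by simp
  then show False
    using homogeneous_norm_nonzero(1)[of x s] homogeneous_norm_nonzero(1)[of y t] assms by simp
qed

text \<open>
  The norm is multiplicative, and products of nonzero homogeneous elements are nonzero, so that
  they can be used to read off the sign in the product degree.
\<close>

lemma sign_char_in:
  assumes T: "subgroup T G" and nz: "\<And>t. t \<in> T \<Longrightarrow> U t \<noteq> {0}"
  shows "sign_char T \<in> sign_characters G T"
proof -
  interpret T: subgroup T G by (rule T)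
  have "sign_char T (s \<otimes> t) = sign_char T s * sign_char T t" if st: "s \<in> T" "t \<in> T" for s t
  proof -
    have c: "s \<in> carrier G" "t \<in> carrier G" "s \<otimes> t \<in> T" using st by auto
    obtain x y where xy: "x \<in> U s" "x \<noteq> 0" "y \<in> U t" "y \<noteq> 0"
      using nz[of s] nz[of t] st zero_in[OF c(1)] zero_in[OF c(2)] by blast
    have "real_of_int (sign_char T (s \<otimes> t)) = sgn (N (x \<odot> y))"
      using xy c mult_in mult_nonzero by (intro sign_char_eq) auto
    also have "\<dots> = real_of_int (sign_char T s * sign_char T t)"
      using sign_char_eq[of s T x] sign_char_eq[of t T y] xy c st by (simp add: norm_mult sgn_mult)
    finally show ?thesis by linarith
  qed
  then show ?thesis
    unfolding sign_characters_def hom_def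
    by (auto simp: sign_img_simps sign_char_def)
qed

text \<open>
  Distinct components are orthogonal, so the norm of an element is the sum of the norms of its
  homogeneous components.
\<close>

lemma norm_nonneg_if_components_nonneg:
  assumes pos: "\<And>g x. g \<in> carrier G \<Longrightarrow> x \<in> U g \<Longrightarrow> N x \<ge> 0"
  shows "N x \<ge> 0"
proof -
  obtain f where f: "homogeneous_decomposition (carrier G) U x f"
    using direct_sum unfolding direct_sum_decomposition_iff_unique by blast
  define F where "F = {g. f g \<noteq> 0}"
  have F: "finite F" "F \<subseteq> carrier G" "\<And>g. g \<in> F \<Longrightarrow> f g \<in> U g" and x: "x = sum f F"
    using f by (auto simp: homogeneous_decomposition_def F_def)
  have "P x x = (\<Sum>g\<in>F. \<Sum>h\<in>F. P (f h) (f g))"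
    unfolding x using bilinear_polar F(1)
    by (simp add: linear_sum bilinear_def linear_sum[of "\<lambda>y. P y _"])
  also have "\<dots> = (\<Sum>g\<in>F. \<Sum>h\<in>F. if h = g then 2 * N (f g) else 0)"
  proof (intro sum.cong refl)
    fix g h assume "g \<in> F" "h \<in> F"
    then show "P (f h) (f g) = (if h = g then 2 * N (f g) else 0)"
      using F(2) F(3)[of g] F(3)[of h] polar_zero_distinct[of "f h" h "f g" g] by (auto simp: polar_self)
  qed
  also have "\<dots> = (\<Sum>g\<in>F. 2 * N (f g))" using F(1) by simp
  also have "\<dots> \<ge> 0" using F pos by (intro sum_nonneg) auto
  finally show ?thesis by (simp add: polar_self)
qed

lemma coset_extension_nonzero:
  assumes "S \<subseteq> carrier G" "\<And>s. s \<in> S \<Longrightarrow> U s \<noteq> {0}" "u \<in> U t" "u \<noteq> 0" "t \<in> carrier G"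
    "s \<in> coset_extension G S t"
  shows "U s \<noteq> {0}"
proof -
  have "U (r \<otimes> t) \<noteq> {0}" if rS: "r \<in> S" for r
  proof -
    have r: "r \<in> carrier G" using assms(1) rS by blast
    obtain x where "x \<in> U r" "x \<noteq> 0" using assms(2)[OF rS] zero_in[OF r] by blast
    then show ?thesis using mult_in[of x r u t] mult_nonzero[of x r u t] r assms by auto
  qed
  then show ?thesis using assms by (auto simp: coset_extension_def)
qed

lemma neutral_nonzero: "U \<one> \<noteq> {0}"
  using unit_in unit_nonzero by blast

lemma elementary_abelian_2_if_nonzero:
  assumes "subgroup T G" "\<And>t. t \<in> T \<Longrightarrow> U t \<noteq> {0}"
  shows "elementary_abelian_2 G T"
proof -
  have "t \<otimes> t = \<one>" if t: "t \<in> T" for t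
  proof -
    have c: "t \<in> carrier G" using assms(1) t subgroup.subset by blast
    obtain x where "x \<in> U t" "x \<noteq> 0" using assms(2)[OF t] zero_in[OF c] by blast
    then show ?thesis using homogeneous_norm_nonzero(2) c by blast
  qed
  then show ?thesis using assms by (simp add: elementary_abelian_2_def)
qed

lemma partial_model_extend:
  assumes st: "partial_model S (B :: 'd::euclidean_space calg) \<phi> X" and dim: "DIM('d) < DIM('a)"
    and nz: "\<And>s. s \<in> S \<Longrightarrow> U s \<noteq> {0}" and fin: "finite S"
  obtains t u where "t \<in> carrier G" "t \<notin> S" "t \<otimes> t = \<one>" "u \<in> U t" "u \<noteq> 0" "N u \<noteq> 0" "u \<in> orth A (range \<phi>)"
    "partial_model (coset_extension G S t) (cayley_dickson B (- N u)) (cd_map \<phi> u) (cd_grading G X t)"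
    "\<And>s. s \<in> coset_extension G S t \<Longrightarrow> U s \<noteq> {0}"
    "finite (coset_extension G S t)" "card (coset_extension G S t) = 2 * card S"
proof -
  have S: "subgroup S G" "S \<subseteq> carrier G" using st subgroup.subset by (auto simp: partial_model_def)
  obtain t u where t: "t \<in> carrier G" "t \<notin> S" and u: "u \<in> U t" "u \<noteq> 0" using partial_model_continue[OF st dim] .
  note n = homogeneous_norm_nonzero[OF u(1) t(1) u(2)]
  show thesis
    using that[OF t n(2) u n(1) partial_model_orth[OF st t u(1)] partial_model_double[OF st t u]
        coset_extension_nonzero[OF S(2) nz u t(1)]]
      card_coset_extension[OF S(1) t(1) n(2) t(2) fin] fin
    by (simp add: coset_extension_def)
qed

lemma subalgebra_isomorphic_neutral:
  "embedding B \<phi> \<Longrightarrow> nondegenerate_norm B \<Longrightarrow> range \<phi> = U \<one> \<Longrightarrow> subalgebra_isomorphic_to A (U \<one>) B"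
  using embedding_subalgebra by metis

text \<open>
  One doubling exhausts the algebra, so there are two components. The second one is the full
  orthogonal complement of the first: the neutral component of an element orthogonal to \<open>U \<one>\<close> is
  itself orthogonal to \<open>U \<one>\<close> and therefore zero.
\<close>

lemma Gamma_H_if_neutral_quaternion:
  assumes em: "embedding quaternion_alg \<phi>" "range \<phi> = U \<one>" and dim: "DIM('a) = 8"
  obtains T where "T \<in> order_2_subgroups G" "Gamma_H G A T U"
proof -
  note st0 = partial_model_neutral[OF em(1) nondegenerate_quaternion em(2)]
  obtain t u where t: "t \<in> carrier G" "t \<notin> {\<one>}" and tt: "t \<otimes> t = \<one>"
    and st1: "partial_model (coset_extension G {\<one>} t) (cayley_dickson quaternion_alg (- N u)) (cd_map \<phi> u)
      (cd_grading G (trivial_grading G) t)" and c: "card (coset_extension G {\<one>} t) = 2"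
    by (rule partial_model_extend[OF st0]) (simp_all add: dim neutral_nonzero)
  let ?T = "coset_extension G {\<one>} t"
  have T: "subgroup ?T G" "card ?T = 2" using st1 c by (simp_all add: partial_model_def)
  have zero: "U g = {0}" if "g \<in> carrier G" "g \<notin> ?T" for g
    using partial_model_final(3)[OF st1 _ that] by (simp add: dim)
  have "x \<in> U t" if x: "x \<in> orth A (U \<one>)" for x
  proof -
    have "P (hproj \<one> x) (hproj \<one> x) = P x (hproj \<one> x)"
      using polar_hproj[of "hproj \<one> x" \<one> x] hproj_in[of \<one> x] polar_commute by simp
    also have "\<dots> = 0" using x hproj_in[of \<one> x] by (simp add: orth_def)
    finally have 0: "hproj \<one> x = 0" using anisotropic[of "hproj \<one> x"] hproj_in[of \<one> x] by (simp add: polar_self)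
    have "y - hproj \<one> y \<in> U t" for y
    proof (induction y rule: homogeneous_induct)
      case zero
      then show ?case using t by (simp add: linear_0[OF linear_hproj])
    next
      case (add y z)
      have "y + z - hproj \<one> (y + z) = (y - hproj \<one> y) + (z - hproj \<one> z)" by (simp add: linear_add[OF linear_hproj])
      then show ?case using add t by (metis subspace_add subspace_component)
    next
      case (homogeneous g y)
      consider "g = \<one>" | "g = t" | "U g = {0}" using zero[of g] homogeneous t by (auto simp: coset_extension_def)
      then show ?case
        using homogeneous t by cases (auto simp: hproj_id hproj_other[of \<one> t] linear_0[OF linear_hproj])
    qed
    from this[of x] show ?thesis using 0 by simp
  qed
  moreover have "U t \<subseteq> orth A (U \<one>)" using polar_zero_distinct[of _ t _ \<one>] t by (auto simp: orth_def)
  ultimately have "U t = orth A (U \<one>)" by blast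
  then have "Gamma_H G A ?T U"
    unfolding Gamma_H_def
    using t generate_chain(1)[OF t(1) tt] subalgebra_isomorphic_neutral[OF em(1) nondegenerate_quaternion em(2)] zero
    by auto
  then show thesis using that T by (auto simp: order_2_subgroups_def)
qed

text \<open>
  Two doublings, by some \<open>u\<close> of degree \<open>t\<close> and some \<open>v\<close> of degree \<open>s\<close>, exhaust the algebra; every
  component is a multiple of the neutral one by any of its nonzero elements.
\<close>

lemma Gamma_C_if_neutral_complex:
  assumes em: "embedding complex_alg \<phi>" "range \<phi> = U \<one>" and dim: "DIM('a) = 8"
  obtains T where "T \<in> elementary_abelian_2_subgroups G 4" "Gamma_C G A T (sign_char T) U"
    "sign_char T \<in> sign_characters G T" "\<And>g. g \<in> carrier G \<Longrightarrow> g \<notin> T \<Longrightarrow> U g = {0}"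
proof -
  note st0 = partial_model_neutral[OF em(1) nondegenerate_complex em(2)]
  obtain t u where t: "t \<in> carrier G" "t \<notin> {\<one>}" and tt: "t \<otimes> t = \<one>" and u: "u \<in> U t" "u \<noteq> 0" "N u \<noteq> 0"
    and ou: "u \<in> orth A (range \<phi>)"
    and st1: "partial_model (coset_extension G {\<one>} t) (cayley_dickson complex_alg (- N u)) (cd_map \<phi> u)
      (cd_grading G (trivial_grading G) t)" and nz1: "\<And>s. s \<in> coset_extension G {\<one>} t \<Longrightarrow> U s \<noteq> {0}"
    and c1: "finite (coset_extension G {\<one>} t)" "card (coset_extension G {\<one>} t) = 2 * card {\<one>}"
    by (rule partial_model_extend[OF st0]) (simp_all add: dim neutral_nonzero)
  let ?S = "coset_extension G {\<one>} t"
  obtain s v where s: "s \<in> carrier G" "s \<notin> ?S" and ss: "s \<otimes> s = \<one>" and v: "v \<in> U s" "v \<noteq> 0" "N v \<noteq> 0"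
    and st2: "partial_model (coset_extension G ?S s) (cayley_dickson (cayley_dickson complex_alg (- N u)) (- N v))
      (cd_map (cd_map \<phi> u) v) (cd_grading G (cd_grading G (trivial_grading G) t) s)"
    and nz: "\<And>g. g \<in> coset_extension G ?S s \<Longrightarrow> U g \<noteq> {0}"
    and c2: "card (coset_extension G ?S s) = 2 * card ?S"
    by (rule partial_model_extend[OF st1 _ nz1 c1(1)]) (simp_all add: dim)
  let ?T = "coset_extension G ?S s"
  have T: "subgroup ?T G" "card ?T = 4" "?T \<subseteq> carrier G"
    using st2 c1 c2 by (auto simp: partial_model_def dest: subgroup.subset)
  have zero: "U g = {0}" if "g \<in> carrier G" "g \<notin> ?T" for g
    using partial_model_final(3)[OF st2 _ that] by (simp add: dim)
  have gen: "generate G {t, s} = ?T" using generate_chain(1,2) t tt s ss by simp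
  have Ku: "U t = rmul A (U \<one>) u" using component_eq_rmul[OF u(1) t(1) u(2)] .
  have s': "s \<noteq> \<one>" "s \<noteq> t" using s t by (auto simp: coset_extension_def)
  have "Gamma_C G A ?T (sign_char ?T) U"
    unfolding Gamma_C_def
  proof (intro conjI exI ballI)
    show "t \<in> ?T" "s \<in> ?T" using t s by (auto simp: coset_extension_def)
    show "generate G {t, s} = ?T" by (rule gen)
    show "subalgebra_isomorphic_to A (U \<one>) complex_alg"
      using subalgebra_isomorphic_neutral[OF em(1) nondegenerate_complex em(2)] .
    show "u \<in> orth A (U \<one>)" using ou em(2) by simp
    show "anorm A u \<noteq> 0" "anorm A v \<noteq> 0" using u v by blast+
    show "v \<in> orth A (U \<one> \<union> rmul A (U \<one>) u)"
      unfolding Ku[symmetric] using polar_zero_distinct[OF v(1)] s s' t by (auto simp: orth_def)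
    show "U t = rmul A (U \<one>) u" by (rule Ku)
    show "U s = rmul A (U \<one>) v" using component_eq_rmul[OF v(1) s(1) v(2)] .
    show "U (t \<otimes> s) = rmul A (U \<one>) (amult A u v)"
      using component_eq_rmul[OF mult_in[OF u(1) v(1) t(1) s(1)]] mult_nonzero[OF u(1) v(1)] u v t s by simp
    show "U g = {0}" if "g \<in> carrier G - ?T" for g using zero that by blast
    show "norm_signs A ?T (sign_char ?T) U" using norm_signs_sign_char[OF T(3)] .
  qed simp
  then show thesis
    using that[of ?T] T sign_char_in[OF T(1) nz] elementary_abelian_2_if_nonzero[OF T(1) nz] zero
    by (simp add: elementary_abelian_2_subgroups_def)
qed

lemma Gamma_R_if_neutral_real:
  assumes r: "range (\<lambda>r. r *\<^sub>R \<e>) = U \<one>" and dim: "DIM('a) = 8"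
  obtains T where "T \<in> elementary_abelian_2_subgroups G 8" "Gamma_R G A T (sign_char T) U"
    "sign_char T \<in> sign_characters G T" "\<And>g. g \<in> carrier G \<Longrightarrow> g \<notin> T \<Longrightarrow> U g = {0}"
proof -
  let ?\<phi> = "\<lambda>r. r *\<^sub>R \<e>"
  note st0 = partial_model_neutral[OF embedding_real nondegenerate_real r]
  obtain t u where t: "t \<in> carrier G" "t \<notin> {\<one>}" and tt: "t \<otimes> t = \<one>" and u: "u \<in> U t" "u \<noteq> 0" "N u \<noteq> 0"
    and st1: "partial_model (coset_extension G {\<one>} t) (cayley_dickson real_alg (- N u)) (cd_map ?\<phi> u)
      (cd_grading G (trivial_grading G) t)" and nz1: "\<And>s. s \<in> coset_extension G {\<one>} t \<Longrightarrow> U s \<noteq> {0}"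
    and c1: "finite (coset_extension G {\<one>} t)" "card (coset_extension G {\<one>} t) = 2 * card {\<one>}"
    by (rule partial_model_extend[OF st0]) (simp_all add: dim neutral_nonzero)
  let ?S = "coset_extension G {\<one>} t"
  obtain s v where s: "s \<in> carrier G" "s \<notin> ?S" and ss: "s \<otimes> s = \<one>" and v: "v \<in> U s" "v \<noteq> 0" "N v \<noteq> 0"
    and st2: "partial_model (coset_extension G ?S s) (cayley_dickson (cayley_dickson real_alg (- N u)) (- N v))
      (cd_map (cd_map ?\<phi> u) v) (cd_grading G (cd_grading G (trivial_grading G) t) s)"
    and nz2: "\<And>g. g \<in> coset_extension G ?S s \<Longrightarrow> U g \<noteq> {0}"
    and c2: "finite (coset_extension G ?S s)" "card (coset_extension G ?S s) = 2 * card ?S"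
    by (rule partial_model_extend[OF st1 _ nz1 c1(1)]) (simp_all add: dim)
  let ?R = "coset_extension G ?S s"
  obtain q w where q: "q \<in> carrier G" "q \<notin> ?R" and qq: "q \<otimes> q = \<one>" and w: "w \<in> U q" "w \<noteq> 0" "N w \<noteq> 0"
    and st3: "partial_model (coset_extension G ?R q)
      (cayley_dickson (cayley_dickson (cayley_dickson real_alg (- N u)) (- N v)) (- N w))
      (cd_map (cd_map (cd_map ?\<phi> u) v) w) (cd_grading G (cd_grading G (cd_grading G (trivial_grading G) t) s) q)"
    and nz: "\<And>g. g \<in> coset_extension G ?R q \<Longrightarrow> U g \<noteq> {0}"
    and c3: "card (coset_extension G ?R q) = 2 * card ?R"
    by (rule partial_model_extend[OF st2 _ nz2 c2(1)]) (simp_all add: dim)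
  let ?T = "coset_extension G ?R q"
  have T: "subgroup ?T G" "card ?T = 8" "?T \<subseteq> carrier G"
    using st3 c1 c2 c3 by (auto simp: partial_model_def dest: subgroup.subset)
  have zero: "U g = {0}" if "g \<in> carrier G" "g \<notin> ?T" for g
    using partial_model_final(3)[OF st3 _ that] by (simp add: dim)
  have gen: "generate G {t, s, q} = ?T" using generate_chain t tt s ss q qq by simp
  have span: "U g = span {x}" if x: "x \<in> U g" "g \<in> carrier G" "x \<noteq> 0" for x g
    unfolding component_eq_rmul[OF x] r[symmetric] by (auto simp: rmul_def mult_simps span_singleton image_image)
  have n: "\<one> \<noteq> s" "t \<noteq> s" "\<one> \<noteq> q" "t \<noteq> q" "s \<noteq> q" "t \<otimes> s \<noteq> q"
    using s t q by (auto simp: coset_extension_def)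
  note uv = mult_in[OF u(1) v(1) t(1) s(1)] mult_nonzero[OF u(1) v(1) t(1) s(1) u(2) v(2)]
  have o: "x \<in> U g \<Longrightarrow> y \<in> U h \<Longrightarrow> g \<in> carrier G \<Longrightarrow> h \<in> carrier G \<Longrightarrow> h \<noteq> g \<Longrightarrow> P x y = 0" for x y g h
    using polar_zero_distinct[of x g y h] by blast
  have "Gamma_R G A ?T (sign_char ?T) U"
    unfolding Gamma_R_def
  proof (intro conjI exI ballI)
    show "t \<in> ?T" "s \<in> ?T" "q \<in> ?T" using t s q by (auto simp: coset_extension_def)
    show "generate G {t, s, q} = ?T" by (rule gen)
    show "anorm A u \<noteq> 0" "anorm A v \<noteq> 0" "anorm A w \<noteq> 0"
      using u v w by blast+
    show "u \<in> orth A {\<e>}" using o[OF u(1) unit_in] t by (simp add: orth_def)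
    show "v \<in> orth A {\<e>, u}" using o[OF v(1) unit_in] o[OF v(1) u(1)] t s n by (simp add: orth_def)
    show "w \<in> orth A {\<e>, u, v, u \<odot> v}"
      using o[OF w(1) unit_in] o[OF w(1) u(1)] o[OF w(1) v(1)] o[OF w(1) uv(1)] t s q n by (simp add: orth_def)
    show "U \<one> = span {\<e>}" by (rule span) (simp_all add: unit_in)
    show "U t = span {u}" "U s = span {v}" "U q = span {w}" using span u v w t s q by blast+
    show "U (t \<otimes> s) = span {u \<odot> v}" using span uv t s by blast
    show "U (t \<otimes> q) = span {u \<odot> w}"
      using span[OF mult_in[OF u(1) w(1) t(1) q(1)]] mult_nonzero[OF u(1) w(1) t(1) q(1) u(2) w(2)] t q by simp
    show "U (s \<otimes> q) = span {v \<odot> w}"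
      using span[OF mult_in[OF v(1) w(1) s(1) q(1)]] mult_nonzero[OF v(1) w(1) s(1) q(1) v(2) w(2)] s q by simp
    show "U (t \<otimes> s \<otimes> q) = span {(u \<odot> v) \<odot> w}"
      using span[OF mult_in[OF uv(1) w(1)]] mult_nonzero[OF uv(1) w(1) _ q(1) uv(2) w(2)] t s q by simp
    show "U g = {0}" if "g \<in> carrier G - ?T" for g using zero that by blast
    show "norm_signs A ?T (sign_char ?T) U" using norm_signs_sign_char[OF T(3)] .
  qed
  then show thesis
    using that[of ?T] T sign_char_in[OF T(1) nz] elementary_abelian_2_if_nonzero[OF T(1) nz] zero
    by (simp add: elementary_abelian_2_subgroups_def)
qed

end

section \<open>The described families are gradings\<close>

locale eight_dim_composition_algebra = composition_algebra A + comm_group G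
  for A :: "'v::euclidean_space calg" and G :: "('g, 'b) monoid_scheme" (structure) +
  assumes dim_8: "DIM('v) = 8"
begin

text \<open>
  In an iterated double of a trivially graded algebra, each coordinate is therefore concentrated
  in one degree.
\<close>

lemma trivial_grading_shift:
  assumes "h \<in> carrier G" "h \<otimes> h = \<one>" "g \<in> carrier G"
  shows "trivial_grading G (g \<otimes> h) = (if g = h then UNIV else {0})"
proof -
  have "g \<otimes> h = \<one> \<longleftrightarrow> g = h" using assms by (metis inv_equality inv_inv)
  then show ?thesis by (simp add: trivial_grading_def)
qed

lemma trivial_grading_neutral: "trivial_grading G g = (if g = \<one> then UNIV else {0})"
  by (simp add: trivial_grading_def)

lemma grading_embedding_image:
  assumes em: "embedding (B :: 'd::euclidean_space calg) \<psi>" and "nondegenerate_norm B" "DIM('d) = 8"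
    and X: "grading G B X" and U: "\<And>g. g \<in> carrier G \<Longrightarrow> U g = \<psi> ` X g"
  shows "grading G A U"
  using X _ _ _ U group_axioms
proof (rule grading_image)
  show "bij \<psi>" using embedding_bij[OF em assms(2)] assms(3) dim_8 by simp
  show "linear \<psi>" "\<And>x y. \<psi> (amult B x y) = \<psi> x \<odot> \<psi> y" using em by (auto simp: embedding_def)
qed

lemma conj_invariant_trivial: "linear (aconj B) \<Longrightarrow> conj_invariant G B (trivial_grading G)"
  by (auto simp: conj_invariant_def trivial_grading_def linear_0)

text \<open>
  The polar form is nondegenerate on the complement. If \<open>s\<close> and \<open>s'\<close> pair nontrivially there, then
  one of \<open>s\<close>, \<open>s'\<close> and \<open>s + s'\<close> has nonzero norm.
\<close>

lemma ex_orth_nonzero_norm: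
  assumes em: "embedding (B :: 'd::euclidean_space calg) \<phi>" and nd: "nondegenerate_norm B"
    and dim: "DIM('d) < DIM('v)"
  obtains w where "w \<in> orth A (range \<phi>)" "N w \<noteq> 0"
proof -
  note dec = embedding_decomposition[OF em nd]
  obtain z where "z \<notin> range \<phi>" using embedding_not_surj[OF em dim] .
  moreover obtain r s where rs: "r \<in> range \<phi>" "s \<in> orth A (range \<phi>)" "z = r + s" using dec[of z] by blast
  ultimately have "s \<noteq> 0" by auto
  then obtain y where "P s y \<noteq> 0" using nondegenerate by blast
  moreover obtain r' s' where rs': "r' \<in> range \<phi>" "s' \<in> orth A (range \<phi>)" "y = r' + s'" using dec[of y] by blast
  ultimately have "P s s' \<noteq> 0" using rs(2) by (auto simp: polar_simps orth_def)
  then have "N (s + s') \<noteq> 0 \<or> N s \<noteq> 0 \<or> N s' \<noteq> 0" by (auto simp: norm_add)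
  moreover have "s + s' \<in> orth A (range \<phi>)" using rs(2) rs'(2) by (auto simp: orth_def polar_simps)
  ultimately show thesis using that rs(2) rs'(2) by blast
qed

text \<open>
  This identifies the component of degree \<open>t\<close> in the description of \<open>Gamma_H\<close>, an orthogonal
  complement, with the second summand of a double.
\<close>

lemma orth_range_cd_map:
  assumes em: "embedding B \<phi>" and nd: "nondegenerate_norm B" and w: "w \<in> orth A (range \<phi>)"
    and surj: "surj (cd_map \<phi> w)"
  shows "orth A (range \<phi>) = range (\<lambda>b. \<phi> b \<odot> w)"
proof -
  note Q = unital_subalgebra_range[OF em]
  have l: "linear \<phi>" using em by (simp add: embedding_def)
  have dbl: "P (\<phi> a) (\<phi> b \<odot> w) = 0" for a b using polar_double[OF Q w] by blast
  have "x \<in> range (\<lambda>b. \<phi> b \<odot> w)" if x: "x \<in> orth A (range \<phi>)" for x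
  proof -
    obtain a b where ab: "x = \<phi> a + \<phi> b \<odot> w"
      using surj unfolding cd_map_def surj_def by (metis case_prod_conv surj_pair)
    have "polar B a c = 0" for c
    proof -
      have "P x (\<phi> c) = 0" using x by (auto simp: orth_def)
      moreover have "P (\<phi> b \<odot> w) (\<phi> c) = 0" using dbl polar_commute by metis
      ultimately show ?thesis by (simp add: ab polar_simps embedding_polar[OF em])
    qed
    then have "a = 0" using nd by (simp add: nondegenerate_norm_def)
    then show ?thesis by (simp add: ab linear_0[OF l])
  qed
  moreover have "\<phi> b \<odot> w \<in> orth A (range \<phi>)" for b
    using dbl polar_commute by (auto simp: orth_def)
  ultimately show ?thesis by blast
qed

lemma cd_map_image:
  assumes "\<phi> 0 = 0"
  shows "cd_map \<phi> u ` (S \<times> {0}) = \<phi> ` S" "cd_map \<phi> u ` ({0} \<times> S) = (\<lambda>x. x \<odot> u) ` \<phi> ` S"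
    "cd_map \<phi> u 0 = 0"
  using assms by (auto simp: cd_map_def mult_simps image_iff zero_prod_def)

lemma anisotropic_gradingI:
  assumes gr: "grading G A U" and em: "embedding B \<phi>" "range \<phi> = U \<one>"
    and an: "\<And>z. anorm B z = 0 \<Longrightarrow> z = 0"
  shows "anisotropic_grading A G U"
proof
  have l: "linear \<phi>" using em by (simp add: embedding_def)
  show "grading G A U" by (rule gr)
  fix x assume x: "x \<in> U \<one>" "N x = 0"
  then obtain z where "x = \<phi> z" using em(2) by blast
  then show "x = 0" using x an[of z] em(1) linear_0[OF l] by (auto simp: embedding_def)
qed

lemma anorm_quaternion_zero: "anorm quaternion_alg z = 0 \<Longrightarrow> z = 0"
  by (cases z) (simp add: quaternion_alg_def cayley_dickson_def complex_alg_def zero_prod_def)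

lemma anorm_complex_zero: "anorm complex_alg z = 0 \<Longrightarrow> z = 0"
  by (simp add: complex_alg_def)

lemma anorm_real_zero: "anorm real_alg z = 0 \<Longrightarrow> z = 0"
  by (simp add: real_alg_def)

lemma linear_aconj:
  "linear (aconj complex_alg)" "linear (aconj real_alg)" "linear (aconj quaternion_alg)"
  by (auto simp: complex_alg_def real_alg_def quaternion_alg_def cayley_dickson_def intro!: linearI)

lemma bilinear_real: "bilinear (amult real_alg)"
  by (auto simp: bilinear_def real_alg_def algebra_simps intro!: linearI)

text \<open>
  Here and in the two analogous lemmas, the description of the family yields an embedding of an
  iterated double of \<open>\<real>\<close>, \<open>\<complex>\<close> or the quaternions under which \<open>U\<close> is the image of the iterated
  \<open>cd_grading\<close> of the trivial grading.
\<close>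

lemma Gamma_H_grading:
  assumes T: "T \<in> order_2_subgroups G" and U: "Gamma_H G A T U"
  obtains \<phi> where "anisotropic_grading A G U" "embedding quaternion_alg \<phi>" "range \<phi> = U \<one>"
    "\<And>g. g \<in> carrier G \<Longrightarrow> U g \<noteq> {0} \<longleftrightarrow> g \<in> T"
proof -
  obtain t where t1: "t \<noteq> \<one>" and gen: "T = generate G {t}" and sub: "subalgebra_isomorphic_to A (U \<one>) quaternion_alg"
    and Ut: "U t = orth A (U \<one>)" and U0: "\<And>g. g \<in> carrier G \<Longrightarrow> g \<notin> T \<Longrightarrow> U g = {0}"
    using U unfolding Gamma_H_def by blast
  have Tg: "subgroup T G" "card T = 2" using T by (auto simp: order_2_subgroups_def)
  interpret T: subgroup T G by (rule Tg)
  have tT: "t \<in> T" unfolding gen by (rule generate.incl) simp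
  then have t: "t \<in> carrier G" by (rule T.mem_carrier)
  have "{\<one>, t} = T" using Tg(2) tT t1 by (intro card_seteq) (auto intro: card_ge_0_finite)
  then have T': "T = {\<one>, t}" ..
  have "t \<otimes> t \<in> T" "t \<otimes> t \<noteq> t" using tT t1 t by (auto simp: l_cancel_one)
  then have tt: "t \<otimes> t = \<one>" using T' by blast
  obtain \<phi> where em: "embedding quaternion_alg \<phi>" and r: "range \<phi> = U \<one>"
    using subalgebra_embedding[OF sub composition_algebra_quaternion aconj_quaternion] .
  have l: "linear \<phi>" and \<phi>0: "\<phi> 0 = 0" using em by (auto simp: embedding_def linear_0)
  obtain w where w: "w \<in> orth A (range \<phi>)" "N w \<noteq> 0"
    using ex_orth_nonzero_norm[OF em nondegenerate_quaternion] by (auto simp: dim_8)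
  note em2 = embedding_cd[OF em w(1) refl]
  have nd2: "nondegenerate_norm (cayley_dickson quaternion_alg (- N w))"
    using nondegenerate_norm_cd[OF nondegenerate_quaternion] w(2) by simp
  have b: "bij (cd_map \<phi> w)" using embedding_bij[OF em2 nd2] by (simp add: dim_8)
  note ow = orth_range_cd_map[OF em nondegenerate_quaternion w(1) bij_is_surj[OF b]]
  have Ug: "U g = cd_map \<phi> w ` cd_grading G (trivial_grading G) t g" if g: "g \<in> carrier G" for g
  proof -
    have X: "cd_grading G (trivial_grading G) t g =
        (if g = \<one> then UNIV else {0}) \<times> (if g = t then UNIV else {0})"
      by (simp only: cd_grading_def trivial_grading_neutral[of g] trivial_grading_shift[OF t tt g])
    consider "g = \<one>" | "g = t" | "g \<notin> T" using T' by blast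
    then show ?thesis
    proof cases
      case 1
      then show ?thesis unfolding X using t1 by (simp add: cd_map_image \<phi>0 r)
    next
      case 2
      show ?thesis unfolding X unfolding 2 Ut r[symmetric] ow using t1 by (simp add: cd_map_image \<phi>0 image_image)
    next
      case 3
      then have "g \<noteq> \<one>" "g \<noteq> t" using T' by auto
      then show ?thesis unfolding X using U0[OF g 3] by (simp add: cd_map_def \<phi>0 mult_simps)
    qed
  qed
  have "grading G (cayley_dickson quaternion_alg (- N w)) (cd_grading G (trivial_grading G) t)"
    using grading_cd_grading(1)[OF grading_trivial_grading conj_invariant_trivial t tt,
      OF composition_algebra.bilinear_mult[OF composition_algebra_quaternion] linear_aconj(3)] .
  then have gr: "grading G A U" using grading_embedding_image[OF em2 nd2 _ _ Ug] by simp
  have "w \<noteq> 0" using w(2) by auto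
  then have "U g \<noteq> {0} \<longleftrightarrow> g \<in> T" if "g \<in> carrier G" for g
    using U0[OF that] T' w(1) Ut r rangeI[of \<phi> "aunit quaternion_alg"] em by (auto simp: embedding_def)
  then show thesis using that[OF anisotropic_gradingI[OF gr em r anorm_quaternion_zero] em r] by simp
qed

text \<open>
  The description of \<open>Gamma_C\<close> speaks of \<open>K (u v)\<close>, but doubling produces \<open>(K u) v\<close>. These
  subspaces agree, because moving the parenthesis replaces the factor from \<open>K\<close> by its conjugate.
\<close>

lemma mult_in_orth_assoc:
  assumes Q: "unital_subalgebra Q" and u: "u \<in> orth A Q" and R: "unital_subalgebra R" "Q \<subseteq> R" "u \<in> R"
    and v: "v \<in> orth A R" and c: "c \<in> Q"
  shows "c \<odot> (u \<odot> v) = (cj c \<odot> u) \<odot> v"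
proof -
  have "c \<odot> (u \<odot> v) = (u \<odot> c) \<odot> v" using double_left[OF R(1) v] c R by blast
  also have "u \<odot> c = cj c \<odot> u" using double_swap[OF Q u unital_subalgebra_cj[OF Q c]] by simp
  finally show ?thesis .
qed

lemma rmul_double:
  assumes em: "embedding B \<phi>" and u: "u \<in> orth A (range \<phi>)" and v: "v \<in> orth A (range (cd_map \<phi> u))"
  shows "rmul A (range \<phi>) (u \<odot> v) = (\<lambda>b. (\<phi> b \<odot> u) \<odot> v) ` UNIV"
proof -
  note em1 = embedding_cd[OF em u refl]
  note Q = unital_subalgebra_range[OF em] and R = unital_subalgebra_range[OF em1]
  have l: "linear \<phi>" and \<phi>0: "\<phi> 0 = 0" using em by (auto simp: embedding_def linear_0)
  have "range \<phi> \<subseteq> range (cd_map \<phi> u)"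
    using rangeI[of "cd_map \<phi> u" "(_, 0)"] by (auto simp: cd_map_def \<phi>0 mult_simps)
  moreover have "u \<in> range (cd_map \<phi> u)"
    using rangeI[of "cd_map \<phi> u" "(0, aunit B)"] em by (simp add: cd_map_def \<phi>0 embedding_def)
  ultimately have *: "c \<odot> (u \<odot> v) = (cj c \<odot> u) \<odot> v" if "c \<in> range \<phi>" for c
    using mult_in_orth_assoc[OF Q u R _ _ v that] by blast
  show ?thesis
  proof (intro equalityI subsetI)
    fix x assume "x \<in> rmul A (range \<phi>) (u \<odot> v)"
    then obtain b where "x = (cj (\<phi> b) \<odot> u) \<odot> v" using * by (auto simp: rmul_def)
    then have "x = (\<phi> (aconj B b) \<odot> u) \<odot> v" using em by (simp add: embedding_def)
    then show "x \<in> range (\<lambda>b. (\<phi> b \<odot> u) \<odot> v)" by blast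
  next
    fix x assume "x \<in> range (\<lambda>b. (\<phi> b \<odot> u) \<odot> v)"
    then obtain b where x: "x = (\<phi> b \<odot> u) \<odot> v" by blast
    have "cj (\<phi> b) \<in> range \<phi>" using unital_subalgebra_cj[OF Q] by blast
    moreover have "x = cj (\<phi> b) \<odot> (u \<odot> v)" using *[OF calculation] x by simp
    ultimately show "x \<in> rmul A (range \<phi>) (u \<odot> v)" by (auto simp: rmul_def)
  qed
qed

lemma Gamma_C_grading:
  assumes T: "T \<in> elementary_abelian_2_subgroups G 4" and U: "Gamma_C G A T \<mu> U"
  obtains \<phi> where "anisotropic_grading A G U" "embedding complex_alg \<phi>" "range \<phi> = U \<one>"
    "\<And>g. g \<in> carrier G \<Longrightarrow> U g \<noteq> {0} \<longleftrightarrow> g \<in> T"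
proof -
  obtain s t u v where gen: "generate G {s, t} = T"
    and sub: "subalgebra_isomorphic_to A (U \<one>) complex_alg"
    and u: "u \<in> orth A (U \<one>)" "N u \<noteq> 0" and v: "v \<in> orth A (U \<one> \<union> rmul A (U \<one>) u)" "N v \<noteq> 0"
    and Us: "U s = rmul A (U \<one>) u" "U t = rmul A (U \<one>) v" "U (s \<otimes> t) = rmul A (U \<one>) (u \<odot> v)"
    and U0: "\<And>g. g \<in> carrier G \<Longrightarrow> g \<notin> T \<Longrightarrow> U g = {0}"
    using U unfolding Gamma_C_def by blast
  note gt = generate_two_distinct[OF T gen]
  obtain \<phi> where em: "embedding complex_alg \<phi>" and r: "range \<phi> = U \<one>"
    using subalgebra_embedding[OF sub composition_algebra_complex aconj_complex] .
  have l: "linear \<phi>" and \<phi>0: "\<phi> 0 = 0" using em by (auto simp: embedding_def linear_0)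
  have u': "u \<in> orth A (range \<phi>)" using u r by simp
  note em1 = embedding_cd[OF em u' refl]
  have v': "v \<in> orth A (range (cd_map \<phi> u))"
    using v(1) unfolding orth_def r[symmetric] rmul_def by (auto simp: cd_map_def polar_simps)
  note em2 = embedding_cd[OF em1 v' refl]
  have nd2: "nondegenerate_norm (cayley_dickson (cayley_dickson complex_alg (- N u)) (- N v))"
    using nondegenerate_complex u(2) v(2) by (simp add: nondegenerate_norm_cd)
  note st = gt(3-6)
  have inv2: "s \<otimes> t \<in> carrier G" "(s \<otimes> t) \<otimes> (s \<otimes> t) = \<one>" using st by (simp_all add: m_ac)
  note inv = involution_cancel[OF st(2,4)]
  let ?X = "cd_grading G (cd_grading G (trivial_grading G) s) t"
  let ?D = "\<lambda>g h. if g = h then UNIV else {0}"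
  have X: "?X g = (?D g \<one> \<times> ?D g s) \<times> (?D g t \<times> ?D g (s \<otimes> t))" if g: "g \<in> carrier G" for g
  proof -
    have "g \<otimes> t \<otimes> s = g \<otimes> (s \<otimes> t)" using g st by (simp add: m_ac)
    then show ?thesis
      by (simp only: cd_grading_def trivial_grading_neutral[of g] trivial_grading_shift[OF st(1,3) g]
          trivial_grading_shift[OF st(2,4) g] trivial_grading_shift[OF inv2 g])
  qed
  have Ug: "U g = cd_map (cd_map \<phi> u) v ` ?X g" if g: "g \<in> carrier G" for g
  proof -
    have ne: "\<one> \<noteq> s" "\<one> \<noteq> t" "\<one> \<noteq> s \<otimes> t" "s \<noteq> t" "s \<noteq> s \<otimes> t" "t \<noteq> s \<otimes> t" using gt(2) by auto
    note ne' = ne ne[symmetric]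
    consider "g = \<one>" | "g = s" | "g = t" | "g = s \<otimes> t" | "g \<notin> T" using gt(1) by blast
    then show ?thesis
    proof cases
      case 1
      show ?thesis unfolding X[OF g] unfolding 1 r[symmetric]
        by (auto simp: cd_map_def \<phi>0 mult_simps image_iff ne' simp del: one_closed)
    next
      case 2
      show ?thesis unfolding X[OF g] unfolding 2 Us r[symmetric]
        by (auto simp: cd_map_def \<phi>0 mult_simps image_iff ne' rmul_def)
    next
      case 3
      show ?thesis unfolding X[OF g] unfolding 3 Us r[symmetric]
        by (auto simp: cd_map_def \<phi>0 mult_simps image_iff ne' rmul_def)
    next
      case 4
      show ?thesis unfolding X[OF g] unfolding 4 Us r[symmetric] rmul_double[OF em u' v']
        by (auto simp: cd_map_def \<phi>0 mult_simps image_iff ne')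
    next
      case 5
      then have "g \<noteq> \<one>" "g \<noteq> s" "g \<noteq> t" "g \<noteq> s \<otimes> t" using gt(1) by auto
      then show ?thesis unfolding X[OF g] U0[OF g 5] by (simp add: cd_map_def \<phi>0 mult_simps)
    qed
  qed
  have "grading G (cayley_dickson complex_alg (- N u)) (cd_grading G (trivial_grading G) s)"
    "conj_invariant G (cayley_dickson complex_alg (- N u)) (cd_grading G (trivial_grading G) s)"
    using grading_cd_grading[OF grading_trivial_grading conj_invariant_trivial st(1,3),
      OF composition_algebra.bilinear_mult[OF composition_algebra_complex] linear_aconj(1)] by simp_all
  then have "grading G (cayley_dickson (cayley_dickson complex_alg (- N u)) (- N v)) ?X"
    using grading_cd_grading(1) st by blast
  then have gr: "grading G A U" using grading_embedding_image[OF em2 nd2 _ _ Ug] by simp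
  have nz: "N u \<noteq> 0" "N v \<noteq> 0" "N (u \<odot> v) \<noteq> 0" "N \<e> \<noteq> 0" using u v by (auto simp: norm_mult)
  have "\<e> \<in> U \<one>" using r em rangeI[of \<phi> "aunit complex_alg"] by (simp add: embedding_def)
  then have mem: "\<e> \<in> U \<one>" "u \<in> U s" "v \<in> U t" "u \<odot> v \<in> U (s \<otimes> t)"
    unfolding Us rmul_def by (auto intro: image_eqI[of _ _ \<e>])
  have ne: "U g \<noteq> {0}" if "x \<in> U g" "N x \<noteq> 0" for x g
    using that norm_zero by (metis singletonD)
  have "U g \<noteq> {0}" if "g \<in> T" for g
    using that ne[OF mem(1) nz(4)] ne[OF mem(2) nz(1)] ne[OF mem(3) nz(2)] ne[OF mem(4) nz(3)]
    unfolding gt(1) by auto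
  then have "U g \<noteq> {0} \<longleftrightarrow> g \<in> T" if "g \<in> carrier G" for g using U0[OF that] by blast
  then show thesis using that[OF anisotropic_gradingI[OF gr em r anorm_complex_zero] em r] by simp
qed

lemma Gamma_R_grading:
  assumes T: "T \<in> elementary_abelian_2_subgroups G 8" and U: "Gamma_R G A T \<mu> U"
  shows "anisotropic_grading A G U" "range (\<lambda>r. r *\<^sub>R \<e>) = U \<one>"
    "\<And>g. g \<in> carrier G \<Longrightarrow> U g \<noteq> {0} \<longleftrightarrow> g \<in> T"
proof -
  obtain a b c u v w where gen: "generate G {a, b, c} = T"
    and u: "u \<in> orth A {\<e>}" "N u \<noteq> 0" and v: "v \<in> orth A {\<e>, u}" "N v \<noteq> 0"
    and w: "w \<in> orth A {\<e>, u, v, u \<odot> v}" "N w \<noteq> 0"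
    and Us: "U \<one> = span {\<e>}" "U a = span {u}" "U b = span {v}" "U (a \<otimes> b) = span {u \<odot> v}" "U c = span {w}"
      "U (a \<otimes> c) = span {u \<odot> w}" "U (b \<otimes> c) = span {v \<odot> w}" "U (a \<otimes> b \<otimes> c) = span {(u \<odot> v) \<odot> w}"
    and U0: "\<And>g. g \<in> carrier G \<Longrightarrow> g \<notin> T \<Longrightarrow> U g = {0}"
    using U unfolding Gamma_R_def by (elim conjE exE) (rule that; blast)
  note gt = generate_three_distinct[OF T gen]
  let ?\<phi> = "\<lambda>r. r *\<^sub>R \<e>"
  note em = embedding_real
  show r: "range ?\<phi> = U \<one>" by (simp add: Us span_singleton)
  have u': "u \<in> orth A (range ?\<phi>)" using u by (auto simp: orth_def polar_simps)
  note em1 = embedding_cd[OF em u' refl]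
  have v': "v \<in> orth A (range (cd_map ?\<phi> u))"
    using v(1) by (auto simp: orth_def cd_map_def polar_simps mult_simps)
  note em2 = embedding_cd[OF em1 v' refl]
  have w': "w \<in> orth A (range (cd_map (cd_map ?\<phi> u) v))"
    using w(1) by (auto simp: orth_def cd_map_def polar_simps mult_simps)
  note em3 = embedding_cd[OF em2 w' refl]
  let ?B = "cayley_dickson (cayley_dickson (cayley_dickson real_alg (- N u)) (- N v)) (- N w)"
  have nd3: "nondegenerate_norm ?B"
    using nondegenerate_real u(2) v(2) w(2) by (simp add: nondegenerate_norm_cd)
  note st = gt(3-8)
  have inv2: "a \<otimes> b \<in> carrier G" "(a \<otimes> b) \<otimes> (a \<otimes> b) = \<one>"
    "a \<otimes> c \<in> carrier G" "(a \<otimes> c) \<otimes> (a \<otimes> c) = \<one>"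
    "b \<otimes> c \<in> carrier G" "(b \<otimes> c) \<otimes> (b \<otimes> c) = \<one>"
    "a \<otimes> b \<otimes> c \<in> carrier G" "(a \<otimes> b \<otimes> c) \<otimes> (a \<otimes> b \<otimes> c) = \<one>"
    using st involution_cancel[of a] involution_cancel[of b] involution_cancel[of c] by (simp_all add: m_ac)
  let ?X = "cd_grading G (cd_grading G (cd_grading G (trivial_grading G) a) b) c"
  let ?D = "\<lambda>g h. if g = h then UNIV else {0}"
  have X: "?X g = ((?D g \<one> \<times> ?D g a) \<times> (?D g b \<times> ?D g (a \<otimes> b))) \<times>
      ((?D g c \<times> ?D g (a \<otimes> c)) \<times> (?D g (b \<otimes> c) \<times> ?D g (a \<otimes> b \<otimes> c)))" if g: "g \<in> carrier G" for g
  proof -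
    have "g \<otimes> b \<otimes> a = g \<otimes> (a \<otimes> b)" "g \<otimes> c \<otimes> a = g \<otimes> (a \<otimes> c)" "g \<otimes> c \<otimes> b = g \<otimes> (b \<otimes> c)"
      "g \<otimes> (b \<otimes> c) \<otimes> a = g \<otimes> (a \<otimes> b \<otimes> c)" using g st by (simp_all add: m_ac)
    then show ?thesis
      by (simp only: cd_grading_def trivial_grading_neutral[of g] trivial_grading_shift[OF st(1,4) g]
          trivial_grading_shift[OF st(2,5) g] trivial_grading_shift[OF st(3,6) g]
          trivial_grading_shift[OF inv2(1,2) g] trivial_grading_shift[OF inv2(3,4) g]
          trivial_grading_shift[OF inv2(5,6) g] trivial_grading_shift[OF inv2(7,8) g])
  qed
  have \<psi>: "cd_map (cd_map (cd_map ?\<phi> u) v) w ` (((S1 \<times> S2) \<times> (S3 \<times> S4)) \<times> ((S5 \<times> S6) \<times> (S7 \<times> S8))) =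
      {r1 *\<^sub>R \<e> + r2 *\<^sub>R u + (r3 *\<^sub>R v + r4 *\<^sub>R (u \<odot> v)) +
       (r5 *\<^sub>R w + r6 *\<^sub>R (u \<odot> w) + (r7 *\<^sub>R (v \<odot> w) + r8 *\<^sub>R ((u \<odot> v) \<odot> w))) | r1 r2 r3 r4 r5 r6 r7 r8.
       r1 \<in> S1 \<and> r2 \<in> S2 \<and> r3 \<in> S3 \<and> r4 \<in> S4 \<and> r5 \<in> S5 \<and> r6 \<in> S6 \<and> r7 \<in> S7 \<and> r8 \<in> S8}"
    for S1 S2 S3 S4 S5 S6 S7 S8
    by (force simp: cd_map_def mult_simps image_iff)
  have Ug: "U g = cd_map (cd_map (cd_map ?\<phi> u) v) w ` ?X g" if g: "g \<in> carrier G" for g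
  proof -
    have ne: "distinct (rev [\<one>, a, b, a \<otimes> b, c, a \<otimes> c, b \<otimes> c, a \<otimes> b \<otimes> c])"
      unfolding distinct_rev by (rule gt(2))
    note ne = gt(2)[simplified] ne[simplified]
    consider "g = \<one>" | "g = a" | "g = b" | "g = a \<otimes> b" | "g = c" | "g = a \<otimes> c" | "g = b \<otimes> c"
      | "g = a \<otimes> b \<otimes> c" | "g \<notin> T" using gt(1) by blast
    then show ?thesis
    proof cases
      case 9
      then have "g \<noteq> \<one>" "g \<noteq> a" "g \<noteq> b" "g \<noteq> a \<otimes> b" "g \<noteq> c" "g \<noteq> a \<otimes> c" "g \<noteq> b \<otimes> c" "g \<noteq> a \<otimes> b \<otimes> c"
        using gt(1) by auto
      then show ?thesis unfolding X[OF g] U0[OF g 9] by (simp add: cd_map_def mult_simps)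
    qed (unfold X[OF g] \<psi>, simp_all add: ne Us span_singleton full_SetCompr_eq)
  qed
  have l1: "grading G (cayley_dickson real_alg (- N u)) (cd_grading G (trivial_grading G) a)"
    "conj_invariant G (cayley_dickson real_alg (- N u)) (cd_grading G (trivial_grading G) a)"
    using grading_cd_grading[OF grading_trivial_grading conj_invariant_trivial st(1,4),
      OF bilinear_real linear_aconj(2)] by simp_all
  have "grading G ?B ?X"
    by (intro grading_cd_grading l1) (use st in auto)
  then have gr: "grading G A U" using grading_embedding_image[OF em3 nd3 _ _ Ug] by simp
  show "anisotropic_grading A G U" using anisotropic_gradingI[OF gr em r anorm_real_zero] by simp
  have nz: "N u \<noteq> 0" "N v \<noteq> 0" "N w \<noteq> 0" "N (u \<odot> v) \<noteq> 0" "N (u \<odot> w) \<noteq> 0" "N (v \<odot> w) \<noteq> 0"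
    "N ((u \<odot> v) \<odot> w) \<noteq> 0" "N \<e> \<noteq> 0" using u v w by (auto simp: norm_mult)
  have s: "span {x} \<noteq> {0}" if "N x \<noteq> 0" for x
    using that span_base[of x "{x}"] by force
  have "U g \<noteq> {0}" if "g \<in> T" for g
    using that unfolding gt(1) by (elim insertE emptyE) (simp_all only: Us s nz not_False_eq_True)
  then show "U g \<noteq> {0} \<longleftrightarrow> g \<in> T" if "g \<in> carrier G" for g using U0[OF that] that by blast
qed

end

section \<open>Sign characters and adapted generators\<close>

context comm_group
begin

lemma sign_character_simps:
  assumes "\<mu> \<in> sign_characters G T" and T: "subgroup T G"
  shows "x \<in> T \<Longrightarrow> \<mu> x = 1 \<or> \<mu> x = - 1" and "x \<in> T \<Longrightarrow> y \<in> T \<Longrightarrow> \<mu> (x \<otimes> y) = \<mu> x * \<mu> y" and "\<mu> \<one> = 1"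
proof -
  show v: "\<mu> x = 1 \<or> \<mu> x = - 1" if "x \<in> T" for x
    using assms(1) that by (auto simp: sign_characters_def hom_def sign_img_simps)
  show m: "\<mu> (x \<otimes> y) = \<mu> x * \<mu> y" if "x \<in> T" "y \<in> T" for x y
    using assms(1) that by (auto simp: sign_characters_def hom_def sign_img_simps)
  show "\<mu> \<one> = 1" using v[of \<one>] m[of \<one> \<one>] subgroup.one_closed[OF T] by auto
qed

lemma trivial_character_in: "subgroup T G \<Longrightarrow> trivial_character T \<in> sign_characters G T"
  by (auto simp: sign_characters_def hom_def sign_img_simps trivial_character_def subgroup.m_closed)

lemma trivial_character_iff:
  assumes "\<mu> \<in> sign_characters G T"
  shows "\<mu> = trivial_character T \<longleftrightarrow> (\<forall>t\<in>T. \<mu> t = 1)"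
  using assms unfolding sign_characters_def trivial_character_def extensional_def by (auto simp: fun_eq_iff)

text \<open>
  An element outside \<open>S\<close> on which \<open>\<mu>\<close> is \<open>- 1\<close> is multiplied by \<open>c\<close>, which corrects the sign.
\<close>

lemma ex_in_kernel_outside:
  assumes \<mu>: "\<mu> \<in> sign_characters G T" and T: "subgroup T G" and S: "subgroup S G" "S \<subseteq> T" "S \<noteq> T"
    and c: "c \<in> S" "\<mu> c = - 1 \<or> \<mu> = trivial_character T"
  obtains a where "a \<in> T" "a \<notin> S" "\<mu> a = 1"
proof -
  interpret S: subgroup S G by (rule S)
  interpret T: subgroup T G by (rule T)
  obtain a where a: "a \<in> T" "a \<notin> S" using S by blast
  show thesis
  proof (cases "\<mu> a = 1")
    case False
    then have "\<mu> a = - 1" "\<mu> c = - 1"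
      using sign_character_simps(1)[OF \<mu> T a(1)] c(2) a(1) by (auto simp: trivial_character_def)
    then have "\<mu> (a \<otimes> c) = 1" using sign_character_simps(2)[OF \<mu> T a(1)] c(1) S(2) by auto
    moreover have "a \<otimes> c \<notin> S"
    proof
      assume "a \<otimes> c \<in> S"
      then have "a \<otimes> c \<otimes> inv c \<in> S" using c(1) by blast
      then show False using a c(1) S(2) by (simp add: m_assoc)
    qed
    ultimately show thesis using that a(1) c(1) S(2) by blast
  qed (use that a in blast)
qed

text \<open>
  The condition on \<open>\<sigma>\<close> and \<open>\<mu>\<close> recurs below. It says which characters are possible when the last
  element used for doubling has norm \<open>\<sigma>\<close>: the trivial one for the division algebra, where \<open>\<sigma> = 1\<close>,
  and the others for the split algebra, where \<open>\<sigma> = - 1\<close>.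
\<close>

lemma ex_sign_value:
  assumes \<mu>: "\<mu> \<in> sign_characters G T" and T: "subgroup T G" "T \<noteq> {\<one>}"
    and \<sigma>: "\<sigma> = 1 \<and> \<mu> = trivial_character T \<or> \<sigma> = - 1 \<and> \<mu> \<noteq> trivial_character T"
  obtains c where "c \<in> T" "c \<noteq> \<one>" "\<mu> c = \<sigma>"
proof (cases "\<mu> = trivial_character T")
  case True
  obtain c where "c \<in> T" "c \<noteq> \<one>" using T subgroup.one_closed[OF T(1)] by blast
  then show thesis using that \<sigma> True by (simp add: trivial_character_def)
next
  case False
  then obtain c where c: "c \<in> T" "\<mu> c \<noteq> 1" using trivial_character_iff[OF \<mu>] by blast
  then have "\<mu> c = - 1" using sign_character_simps(1)[OF \<mu> T(1)] by blast
  moreover have "c \<noteq> \<one>" using c sign_character_simps(3)[OF \<mu> T(1)] by auto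
  ultimately show thesis using that[of c] c(1) \<sigma> False by simp
qed

lemma coset_extension_subset:
  "subgroup T G \<Longrightarrow> S \<subseteq> T \<Longrightarrow> t \<in> T \<Longrightarrow> coset_extension G S t \<subseteq> T"
  by (auto simp: coset_extension_def subgroup.m_closed)

lemma extend_by_kernel:
  assumes T: "elementary_abelian_2 G T" and \<mu>: "\<mu> \<in> sign_characters G T"
    and S: "subgroup S G" "S \<subseteq> T" "card S < card T"
    and c: "c \<in> S" "\<mu> c = - 1 \<or> \<mu> = trivial_character T"
  obtains a where "a \<in> T" "\<mu> a = 1" "a \<in> carrier G" "a \<otimes> a = \<one>" "subgroup (coset_extension G S a) G"
    "coset_extension G S a \<subseteq> T" "card (coset_extension G S a) = 2 * card S"
proof -
  have Tg: "subgroup T G" and inv: "\<And>x. x \<in> T \<Longrightarrow> x \<otimes> x = \<one>" using T by (auto simp: elementary_abelian_2_def)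
  have fin: "finite S" using finite_subset[OF S(2)] S(3) by (simp add: card_ge_0_finite)
  obtain a where a: "a \<in> T" "a \<notin> S" "\<mu> a = 1"
    using ex_in_kernel_outside[OF \<mu> Tg S(1,2) _ c] S(3) by blast
  note aa = subgroup.mem_carrier[OF Tg a(1)] inv[OF a(1)]
  show thesis
    by (rule that[OF a(1,3) aa subgroup_coset_extension[OF S(1) aa] coset_extension_subset[OF Tg S(2) a(1)]
          card_coset_extension[OF S(1) aa a(2) fin]])
qed

lemma first_generator:
  assumes T: "elementary_abelian_2 G T" "card T > 1" and \<mu>: "\<mu> \<in> sign_characters G T"
    and \<sigma>: "\<sigma> = 1 \<and> \<mu> = trivial_character T \<or> \<sigma> = - 1 \<and> \<mu> \<noteq> trivial_character T"
  obtains c where "c \<in> T" "\<mu> c = \<sigma>" "\<mu> c = - 1 \<or> \<mu> = trivial_character T" "c \<in> carrier G"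
    "generate G {c} = coset_extension G {\<one>} c" "subgroup (generate G {c}) G" "generate G {c} \<subseteq> T"
    "card (generate G {c}) = 2"
proof -
  have Tg: "subgroup T G" and inv: "\<And>x. x \<in> T \<Longrightarrow> x \<otimes> x = \<one>" using T by (auto simp: elementary_abelian_2_def)
  have "T \<noteq> {\<one>}" using T(2) by auto
  then obtain c where c: "c \<in> T" "c \<noteq> \<one>" "\<mu> c = \<sigma>" using ex_sign_value[OF \<mu> Tg _ \<sigma>] by blast
  note cc = subgroup.mem_carrier[OF Tg c(1)] inv[OF c(1)]
  have g: "generate G {c} = coset_extension G {\<one>} c" by (rule generate_chain(1)[OF cc])
  have sub: "generate G {c} \<subseteq> T" using generate_subgroup_incl[of "{c}" T] c(1) Tg by simp
  show thesis
    using that[OF c(1,3) _ cc(1) g _ sub] \<sigma> c subgroup_coset_extension[OF triv_subgroup cc]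
      card_coset_extension[OF triv_subgroup cc] by (auto simp: g)
qed

text \<open>
  In the standard chain of doublings the last element has norm \<open>\<sigma>\<close> and the earlier ones have norm
  \<open>1\<close>. Generators on which \<open>\<mu>\<close> takes these values are found by choosing the one with value \<open>\<sigma>\<close> and
  completing it by elements of the kernel.
\<close>

lemma adapted_generators_4:
  assumes T: "T \<in> elementary_abelian_2_subgroups G 4" and \<mu>: "\<mu> \<in> sign_characters G T"
    and \<sigma>: "\<sigma> = 1 \<and> \<mu> = trivial_character T \<or> \<sigma> = - 1 \<and> \<mu> \<noteq> trivial_character T"
  obtains s t where "generate G {s, t} = T" "\<mu> s = 1" "\<mu> t = \<sigma>"
proof -
  have Te: "elementary_abelian_2 G T" "card T = 4" using T by (simp_all add: elementary_abelian_2_subgroups_def)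
  have fin: "finite T" using Te(2) by (simp add: card_ge_0_finite)
  obtain c where c: "\<mu> c = \<sigma>" "\<mu> c = - 1 \<or> \<mu> = trivial_character T" "c \<in> carrier G"
    and S: "subgroup (generate G {c}) G" "generate G {c} \<subseteq> T" "card (generate G {c}) = 2"
    by (rule first_generator[OF Te(1) _ \<mu> \<sigma>]) (simp_all add: Te(2))
  have cS: "c \<in> generate G {c}" by (rule generate.incl) simp
  obtain a where a: "\<mu> a = 1" "a \<in> carrier G" "a \<otimes> a = \<one>"
    and R: "coset_extension G (generate G {c}) a \<subseteq> T" "card (coset_extension G (generate G {c}) a) = 2 * card (generate G {c})"
    by (rule extend_by_kernel[OF Te(1) \<mu> S(1,2) _ cS c(2)]) (simp_all add: S(3) Te(2))
  have "generate G {c, a} = T"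
    unfolding generate_chain(2)[OF a(2,3) c(3)] using R S(3) Te(2) fin by (intro card_subset_eq) simp_all
  then show thesis using that[of a c] a(1) c(1) by (simp add: insert_commute[of c])
qed

lemma adapted_generators_8:
  assumes T: "T \<in> elementary_abelian_2_subgroups G 8" and \<mu>: "\<mu> \<in> sign_characters G T"
    and \<sigma>: "\<sigma> = 1 \<and> \<mu> = trivial_character T \<or> \<sigma> = - 1 \<and> \<mu> \<noteq> trivial_character T"
  obtains r s t where "generate G {r, s, t} = T" "\<mu> r = 1" "\<mu> s = 1" "\<mu> t = \<sigma>"
proof -
  have Te: "elementary_abelian_2 G T" "card T = 8" using T by (simp_all add: elementary_abelian_2_subgroups_def)
  have fin: "finite T" using Te(2) by (simp add: card_ge_0_finite)
  obtain c where c: "\<mu> c = \<sigma>" "\<mu> c = - 1 \<or> \<mu> = trivial_character T" "c \<in> carrier G"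
    and S: "subgroup (generate G {c}) G" "generate G {c} \<subseteq> T" "card (generate G {c}) = 2"
    by (rule first_generator[OF Te(1) _ \<mu> \<sigma>]) (simp_all add: Te(2))
  have cS: "c \<in> generate G {c}" by (rule generate.incl) simp
  obtain a where a: "\<mu> a = 1" "a \<in> carrier G" "a \<otimes> a = \<one>"
    and R: "subgroup (coset_extension G (generate G {c}) a) G" "coset_extension G (generate G {c}) a \<subseteq> T"
      "card (coset_extension G (generate G {c}) a) = 2 * card (generate G {c})"
    by (rule extend_by_kernel[OF Te(1) \<mu> S(1,2) _ cS c(2)]) (simp_all add: S(3) Te(2))
  note ca = generate_chain(2)[OF a(2,3) c(3)]
  have cR: "c \<in> generate G {c, a}" by (rule generate.incl) simp
  obtain b where b: "\<mu> b = 1" "b \<in> carrier G" "b \<otimes> b = \<one>"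
    and Q: "coset_extension G (generate G {c, a}) b \<subseteq> T"
      "card (coset_extension G (generate G {c, a}) b) = 2 * card (generate G {c, a})"
    by (rule extend_by_kernel[OF Te(1) \<mu> R(1,2)[folded ca] _ cR c(2)]) (simp_all add: R(3) S(3) Te(2) ca)
  have "generate G {c, a, b} = T"
    unfolding generate_chain(3)[OF b(2,3) a(2) c(3)] using Q R(3) S(3) Te(2) fin
    by (intro card_subset_eq) (simp_all add: ca)
  then show thesis using that[of b a c] a(1) b(1) c(1) by (simp add: insert_commute)
qed

end

section \<open>Existence and uniqueness of the gradings with elementary abelian support\<close>

context eight_dim_composition_algebra
begin

lemma same_signs_if_norm_signs:
  assumes "norm_signs A T \<mu> U" "norm_signs A T \<mu> U'"
    and "\<And>g. g \<in> carrier G \<Longrightarrow> U g \<noteq> {0} \<longleftrightarrow> g \<in> T" "\<And>g. g \<in> carrier G \<Longrightarrow> U' g \<noteq> {0} \<longleftrightarrow> g \<in> T"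
  shows "same_signs G A U U'"
  unfolding same_signs_def
proof (intro ballI conjI)
  fix t assume t: "t \<in> carrier G"
  show "(U t = {0}) = (U' t = {0})" using assms(3,4)[OF t] by blast
  fix x x' assume x: "x \<in> U t - {0}" "x' \<in> U' t - {0}"
  then have "t \<in> T" using assms(3)[OF t] by blast
  then show "sgn (N x) = sgn (N x')" using assms(1,2) x by (simp add: norm_signs_def)
qed

lemma order_2_subgroup_eq:
  assumes "T \<in> order_2_subgroups G" "t \<in> T" "t \<noteq> \<one>" shows "T = {\<one>, t}"
proof -
  have "card T = 2" "\<one> \<in> T" using assms(1) by (auto simp: order_2_subgroups_def subgroup.one_closed)
  then have "{\<one>, t} = T" using assms(2,3) by (intro card_seteq) (auto intro: card_ge_0_finite)
  then show ?thesis ..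
qed

text \<open>
  The description of \<open>Gamma_H\<close> prescribes no signs. Since the norm is positive on the neutral
  component, its sign on the other component is positive exactly when the norm is positive
  semidefinite.
\<close>

lemma sign_off_neutral_order_2:
  assumes an: "anisotropic_grading A G U" and T: "T \<in> order_2_subgroups G"
    and supp: "\<And>g. g \<in> carrier G \<Longrightarrow> U g \<noteq> {0} \<longleftrightarrow> g \<in> T"
    and x: "t \<in> carrier G" "t \<noteq> \<one>" "x \<in> U t" "x \<noteq> 0"
  shows "sgn (N x) = (if \<forall>y. N y \<ge> 0 then 1 else - 1)"
proof -
  interpret U: anisotropic_grading A G U by (rule an)
  have "t \<in> T" using supp[OF x(1)] x by blast
  then have T': "T = {\<one>, t}" using order_2_subgroup_eq[OF T] x(2) by blast
  have ne: "N x \<noteq> 0" using U.homogeneous_norm_nonzero(1)[OF x(3,1,4)] .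
  have "\<forall>y. N y \<ge> 0" if pos: "N x > 0"
  proof
    fix y
    show "N y \<ge> 0"
    proof (rule U.norm_nonneg_if_components_nonneg)
      fix g z assume z: "g \<in> carrier G" "z \<in> U g"
      consider "z = 0" | "z \<noteq> 0" "g = \<one>" | "z \<noteq> 0" "g = t" using supp[OF z(1)] z T' by blast
      then show "N z \<ge> 0"
      proof cases
        case 2
        then show ?thesis using U.neutral_norm_pos[of z] z by simp
      next
        case 3
        then have "sgn (N z) = sgn (N x)" using U.sign_constant[of z t x] z x by simp
        then show ?thesis using pos by (simp add: sgn_if split: if_splits)
      qed simp
    qed
  qed
  moreover have "\<not> (\<forall>y. N y \<ge> 0)" if "N x < 0" using that not_le by blast
  ultimately show ?thesis using ne by (simp add: sgn_if)
qed

lemma grading_iso_Gamma_H: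
  assumes T: "T \<in> order_2_subgroups G" and U: "Gamma_H G A T U" and U': "Gamma_H G A T U'"
  shows "grading_iso G A U U'"
proof -
  obtain \<phi> where an: "anisotropic_grading A G U" and em: "embedding quaternion_alg \<phi>" "range \<phi> = U \<one>"
    and supp: "\<And>g. g \<in> carrier G \<Longrightarrow> U g \<noteq> {0} \<longleftrightarrow> g \<in> T" using Gamma_H_grading[OF T U] by blast
  obtain \<phi>' where an': "anisotropic_grading A G U'" and em': "embedding quaternion_alg \<phi>'" "range \<phi>' = U' \<one>"
    and supp': "\<And>g. g \<in> carrier G \<Longrightarrow> U' g \<noteq> {0} \<longleftrightarrow> g \<in> T" using Gamma_H_grading[OF T U'] by blast
  interpret U: anisotropic_grading A G U by (rule an)
  interpret U': anisotropic_grading A G U' by (rule an')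
  have "same_signs G A U U'"
    unfolding same_signs_def
  proof (intro ballI conjI)
    fix t assume t: "t \<in> carrier G"
    show "(U t = {0}) = (U' t = {0})" using supp[OF t] supp'[OF t] by blast
    fix x x' assume x: "x \<in> U t - {0}" "x' \<in> U' t - {0}"
    show "sgn (N x) = sgn (N x')"
    proof (cases "t = \<one>")
      case True
      then show ?thesis using U.neutral_norm_pos[of x] U'.neutral_norm_pos[of x'] x by simp
    next
      case False
      then show ?thesis
        using sign_off_neutral_order_2[OF an T supp t, of x] sign_off_neutral_order_2[OF an' T supp' t, of x'] x
        by simp
    qed
  qed
  then interpret anisotropic_grading_pair A G U U' by unfold_locales
  show ?thesis
    using grading_iso_if_neutral_components_isomorphic[OF em em' nondegenerate_quaternion] by (simp add: dim_8)
qed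

lemma grading_iso_Gamma_C:
  assumes T: "T \<in> elementary_abelian_2_subgroups G 4" and U: "Gamma_C G A T \<mu> U" and U': "Gamma_C G A T \<mu> U'"
  shows "grading_iso G A U U'"
proof -
  obtain \<phi> where an: "anisotropic_grading A G U" and em: "embedding complex_alg \<phi>" "range \<phi> = U \<one>"
    and supp: "\<And>g. g \<in> carrier G \<Longrightarrow> U g \<noteq> {0} \<longleftrightarrow> g \<in> T" using Gamma_C_grading[OF T U] by blast
  obtain \<phi>' where an': "anisotropic_grading A G U'" and em': "embedding complex_alg \<phi>'" "range \<phi>' = U' \<one>"
    and supp': "\<And>g. g \<in> carrier G \<Longrightarrow> U' g \<noteq> {0} \<longleftrightarrow> g \<in> T" using Gamma_C_grading[OF T U'] by blast
  interpret U: anisotropic_grading A G U by (rule an)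
  interpret U': anisotropic_grading A G U' by (rule an')
  have "norm_signs A T \<mu> U" "norm_signs A T \<mu> U'" using U U' by (simp_all add: Gamma_C_def)
  then have "same_signs G A U U'" using same_signs_if_norm_signs supp supp' by simp
  then interpret anisotropic_grading_pair A G U U' by unfold_locales
  show ?thesis
    using grading_iso_if_neutral_components_isomorphic[OF em em' nondegenerate_complex] by (simp add: dim_8)
qed

lemma grading_iso_Gamma_R:
  assumes T: "T \<in> elementary_abelian_2_subgroups G 8" and U: "Gamma_R G A T \<mu> U" and U': "Gamma_R G A T \<mu> U'"
  shows "grading_iso G A U U'"
proof -
  note g = Gamma_R_grading[OF T U] and g' = Gamma_R_grading[OF T U']
  interpret U: anisotropic_grading A G U by (rule g(1))
  interpret U': anisotropic_grading A G U' by (rule g'(1))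
  have "norm_signs A T \<mu> U" "norm_signs A T \<mu> U'" using U U' by (simp_all add: Gamma_R_def)
  then have "same_signs G A U U'" using same_signs_if_norm_signs g(3) g'(3) by simp
  then interpret anisotropic_grading_pair A G U U' by unfold_locales
  show ?thesis
    using grading_iso_if_neutral_components_isomorphic[OF embedding_real g(2) embedding_real g'(2) nondegenerate_real]
    by (simp add: dim_8)
qed

lemma anisotropic_grading_imp_grading: "anisotropic_grading A G U \<Longrightarrow> grading G A U"
  by (simp add: anisotropic_grading_def graded_composition_algebra_def graded_composition_algebra_axioms_def)

lemma determines_Gamma_H:
  assumes em: "embedding quaternion_alg \<phi>" and T: "T \<in> order_2_subgroups G"
  shows "determines_grading G A (Gamma_H G A T)"
proof -
  have Tg: "subgroup T G" "card T = 2" using T by (auto simp: order_2_subgroups_def)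
  interpret T: subgroup T G by (rule Tg)
  have "T \<noteq> {\<one>}" using Tg(2) by auto
  then obtain t where t: "t \<in> T" "t \<noteq> \<one>" using T.one_closed by blast
  have T': "T = {\<one>, t}" using order_2_subgroup_eq[OF T t] .
  have "generate G {t} \<subseteq> T" using t Tg(1) generate_subgroup_incl[of "{t}" T] by simp
  then have gen: "T = generate G {t}" using T' generate.one generate.incl[of t "{t}" G] by blast
  define U where "U g = (if g = \<one> then range \<phi> else if g = t then orth A (range \<phi>) else {0})" for g
  have "Gamma_H G A T U"
    unfolding Gamma_H_def
    using t gen T' embedding_subalgebra[OF em nondegenerate_quaternion]
    by (intro exI[of _ t]) (auto simp: U_def)
  moreover have "grading G A U" if "Gamma_H G A T U" for U
    using Gamma_H_grading[OF T that] anisotropic_grading_imp_grading by blast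
  ultimately show ?thesis using grading_iso_Gamma_H[OF T] unfolding determines_grading_def by blast
qed

lemma sgn_norm_rmul:
  assumes em: "embedding B \<phi>" and pos: "\<And>z. anorm B z \<ge> 0" and x: "x \<in> rmul A (range \<phi>) y" "x \<noteq> 0"
    and an: "\<And>z. anorm B z = 0 \<Longrightarrow> z = 0"
  shows "sgn (N x) = sgn (N y)"
proof -
  obtain z where z: "x = \<phi> z \<odot> y" using x by (auto simp: rmul_def)
  have l: "linear \<phi>" using em by (simp add: embedding_def)
  have "z \<noteq> 0" using z x linear_0[OF l] by (auto simp: mult_simps)
  then have "anorm B z > 0" using pos[of z] an[of z] by force
  then show ?thesis using em by (simp add: z norm_mult sgn_mult embedding_def)
qed

text \<open>
  For existence, the elements \<open>u\<close> and \<open>v\<close> are placed in degrees \<open>s\<close> and \<open>t\<close> such that \<open>\<mu> s\<close> and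
  \<open>\<mu> t\<close> are their norms. Multiplicativity of \<open>\<mu>\<close> and of the norm then gives the sign in degree
  \<open>s \<otimes> t\<close>.
\<close>

lemma determines_Gamma_C:
  assumes T: "T \<in> elementary_abelian_2_subgroups G 4" and \<mu>: "\<mu> \<in> sign_characters G T"
    and em: "embedding complex_alg \<phi>" and u: "u \<in> orth A (range \<phi>)" "N u = 1"
    and v: "v \<in> orth A (range (cd_map \<phi> u))" "N v = of_int \<sigma>"
    and \<sigma>: "\<sigma> = 1 \<and> \<mu> = trivial_character T \<or> \<sigma> = - 1 \<and> \<mu> \<noteq> trivial_character T"
  shows "determines_grading G A (Gamma_C G A T \<mu>)"
proof -
  have Tg: "subgroup T G"
    using T by (auto simp: elementary_abelian_2_subgroups_def elementary_abelian_2_def)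
  obtain s t where gen: "generate G {s, t} = T" and st: "\<mu> s = 1" "\<mu> t = \<sigma>"
    using adapted_generators_4[OF T \<mu> \<sigma>] .
  note gt = generate_two_distinct[OF T gen]
  have m: "\<mu> \<one> = 1" "\<mu> (s \<otimes> t) = \<sigma>"
    using sign_character_simps[OF \<mu> Tg] gt(1) st by auto
  have \<phi>0: "\<phi> 0 = 0" using em by (auto simp: embedding_def linear_0)
  let ?K = "range \<phi>"
  define U where "U g = (if g = \<one> then ?K else if g = s then rmul A ?K u else if g = t then rmul A ?K v
    else if g = s \<otimes> t then rmul A ?K (u \<odot> v) else {0})" for g
  have Us: "U \<one> = ?K" "U s = rmul A ?K u" "U t = rmul A ?K v" "U (s \<otimes> t) = rmul A ?K (u \<odot> v)"
    using gt(2) by (auto simp: U_def)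
  have K: "x \<in> rmul A ?K \<e>" if "x \<in> ?K" for x using that by (auto simp: rmul_def)
  have "norm_signs A T \<mu> U"
    unfolding norm_signs_def
  proof (intro ballI)
    fix g x assume g: "g \<in> T" and x: "x \<in> U g - {0}"
    have pos: "anorm complex_alg z \<ge> 0" for z by (simp add: complex_alg_def)
    note s = sgn_norm_rmul[OF em pos _ _ anorm_complex_zero]
    have "\<sigma> = 1 \<or> \<sigma> = - 1" using \<sigma> by blast
    then show "sgn (N x) = real_of_int (\<mu> g)"
      using g[unfolded gt(1)] x K s[of x \<e>] s[of x u] s[of x v] s[of x "u \<odot> v"] m st u v
      by (elim insertE emptyE) (auto simp: Us norm_mult)
  qed
  moreover have "v \<in> orth A (?K \<union> rmul A ?K u)"
  proof -
    have "P v (\<phi> a + \<phi> b \<odot> u) = 0" for a b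
      using v(1) rangeI[of "cd_map \<phi> u" "(a, b)"] by (auto simp: orth_def cd_map_def)
    from this[of _ 0] this[of 0] show ?thesis by (auto simp: orth_def rmul_def \<phi>0 mult_simps)
  qed
  moreover have "U g = {0}" if "g \<notin> T" for g using that gt(1) by (auto simp: U_def)
  moreover have "s \<in> T" "t \<in> T" using gt(1) by auto
  moreover have "N u \<noteq> 0" "N v \<noteq> 0" using u v \<sigma> by auto
  ultimately have "Gamma_C G A T \<mu> U"
    unfolding Gamma_C_def
    using gen embedding_subalgebra[OF em nondegenerate_complex] u(1) Us
    by - (rule conjI, rule exI[of _ s], rule exI[of _ t], rule exI[of _ u], rule exI[of _ v],
        rule exI[of _ ?K], simp_all)
  moreover have "grading G A U" if "Gamma_C G A T \<mu> U" for U
    using Gamma_C_grading[OF T that] anisotropic_grading_imp_grading by blast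
  ultimately show ?thesis using grading_iso_Gamma_C[OF T] unfolding determines_grading_def by blast
qed

lemma determines_Gamma_R:
  assumes T: "T \<in> elementary_abelian_2_subgroups G 8" and \<mu>: "\<mu> \<in> sign_characters G T"
    and u: "u \<in> orth A {\<e>}" "N u = 1" and v: "v \<in> orth A {\<e>, u}" "N v = 1"
    and w: "w \<in> orth A {\<e>, u, v, u \<odot> v}" "N w = of_int \<sigma>"
    and \<sigma>: "\<sigma> = 1 \<and> \<mu> = trivial_character T \<or> \<sigma> = - 1 \<and> \<mu> \<noteq> trivial_character T"
  shows "determines_grading G A (Gamma_R G A T \<mu>)"
proof -
  have Tg: "subgroup T G"
    using T by (auto simp: elementary_abelian_2_subgroups_def elementary_abelian_2_def)
  obtain a b c where gen: "generate G {a, b, c} = T" and st: "\<mu> a = 1" "\<mu> b = 1" "\<mu> c = \<sigma>"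
    using adapted_generators_8[OF T \<mu> \<sigma>] .
  note gt = generate_three_distinct[OF T gen]
  have mem: "a \<in> T" "b \<in> T" "c \<in> T" "a \<otimes> b \<in> T" using gt(1) by auto
  note mm = sign_character_simps(2)[OF \<mu> Tg]
  have m: "\<mu> \<one> = 1" "\<mu> (a \<otimes> b) = 1" "\<mu> (a \<otimes> c) = \<sigma>" "\<mu> (b \<otimes> c) = \<sigma>" "\<mu> (a \<otimes> b \<otimes> c) = \<sigma>"
    using sign_character_simps(3)[OF \<mu> Tg] mm[OF mem(1,2)] mm[OF mem(1,3)] mm[OF mem(2,3)] mm[OF mem(4,3)] st
    by auto
  have ne: "distinct (rev [\<one>, a, b, a \<otimes> b, c, a \<otimes> c, b \<otimes> c, a \<otimes> b \<otimes> c])"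
    unfolding distinct_rev by (rule gt(2))
  define U where "U g = (if g = \<one> then span {\<e>} else if g = a then span {u} else if g = b then span {v}
    else if g = a \<otimes> b then span {u \<odot> v} else if g = c then span {w} else if g = a \<otimes> c then span {u \<odot> w}
    else if g = b \<otimes> c then span {v \<odot> w} else if g = a \<otimes> b \<otimes> c then span {(u \<odot> v) \<odot> w} else {0})" for g
  have Us: "U \<one> = span {\<e>}" "U a = span {u}" "U b = span {v}" "U (a \<otimes> b) = span {u \<odot> v}" "U c = span {w}"
      "U (a \<otimes> c) = span {u \<odot> w}" "U (b \<otimes> c) = span {v \<odot> w}" "U (a \<otimes> b \<otimes> c) = span {(u \<odot> v) \<odot> w}"
    using gt(2) ne by (simp_all add: U_def)
  have "norm_signs A T \<mu> U"
    unfolding norm_signs_def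
  proof (intro ballI)
    fix g x assume g: "g \<in> T" and x: "x \<in> U g - {0}"
    have s: "sgn (N x) = sgn (N y)" if xy: "x \<in> span {y}" "x \<noteq> 0" for y
    proof -
      obtain k where k: "x = k *\<^sub>R y" using xy(1) by (auto simp: span_singleton)
      then have "k \<noteq> 0" using xy(2) by auto
      then have "sgn (k\<^sup>2) = 1" by (simp add: sgn_if power2_eq_square)
      then show ?thesis by (simp add: k norm_scale sgn_mult)
    qed
    have "\<sigma> = 1 \<or> \<sigma> = - 1" using \<sigma> by blast
    then show "sgn (N x) = real_of_int (\<mu> g)"
      using g[unfolded gt(1)] x s[of \<e>] s[of u] s[of v] s[of "u \<odot> v"] s[of w] s[of "u \<odot> w"] s[of "v \<odot> w"]
        s[of "(u \<odot> v) \<odot> w"] m st u(2) v(2) w(2)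
      by (elim insertE emptyE) (auto simp: Us norm_mult)
  qed
  moreover have "U g = {0}" if "g \<notin> T" for g using that gt(1) by (auto simp: U_def)
  moreover have "N w \<noteq> 0" using w(2) \<sigma> by auto
  ultimately have "Gamma_R G A T \<mu> U"
    unfolding Gamma_R_def
    using gen mem u v w Us
    by - (rule conjI, rule exI[of _ a], rule exI[of _ b], rule exI[of _ c], rule exI[of _ u],
        rule exI[of _ v], rule exI[of _ w], simp_all)
  moreover have "grading G A U" if "Gamma_R G A T \<mu> U" for U
    using Gamma_R_grading(1)[OF T that] anisotropic_grading_imp_grading by blast
  ultimately show ?thesis using grading_iso_Gamma_R[OF T] unfolding determines_grading_def by blast
qed

end

section \<open>Canonical bases and triples\<close>

definition basis_set :: "'v \<Rightarrow> 'v \<Rightarrow> (nat \<Rightarrow> 'v) \<Rightarrow> (nat \<Rightarrow> 'v) \<Rightarrow> 'v set" where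
  "basis_set e1 e2 u v = {e1, e2} \<union> u ` I3 \<union> v ` I3"

text \<open>
  The multiplication table is separated from the condition of being a basis, which reduces to
  spanning because there are at most eight vectors.
\<close>

definition canonical_table :: "('v::real_vector) calg \<Rightarrow> 'v \<Rightarrow> 'v \<Rightarrow> (nat \<Rightarrow> 'v) \<Rightarrow> (nat \<Rightarrow> 'v) \<Rightarrow> bool" where
  "canonical_table A e1 e2 u v \<longleftrightarrow>
    amult A e1 e1 = e1 \<and> amult A e2 e2 = e2 \<and> amult A e1 e2 = 0 \<and> amult A e2 e1 = 0 \<and>
    (\<forall>j\<in>I3.
      amult A e1 (u j) = u j \<and> amult A (u j) e2 = u j \<and>
      amult A e2 (u j) = 0 \<and> amult A (u j) e1 = 0 \<and>
      amult A e2 (v j) = v j \<and> amult A (v j) e1 = v j \<and>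
      amult A e1 (v j) = 0 \<and> amult A (v j) e2 = 0) \<and>
    (\<forall>j\<in>I3. \<forall>k\<in>I3.
      amult A (u j) (u k) = (\<Sum>l\<in>I3. levi_civita j k l *\<^sub>R v l) \<and>
      amult A (v j) (v k) = (\<Sum>l\<in>I3. levi_civita j k l *\<^sub>R u l) \<and>
      amult A (u j) (v k) = (if j = k then - e1 else 0) \<and>
      amult A (v j) (u k) = (if j = k then - e2 else 0))"

lemma canonical_basis_iff:
  fixes A :: "('v::euclidean_space) calg"
  assumes "DIM('v) = 8"
  shows "canonical_basis A e1 e2 u v \<longleftrightarrow> span (basis_set e1 e2 u v) = UNIV \<and> canonical_table A e1 e2 u v"
proof -
  let ?B = "basis_set e1 e2 u v"
  have "card ?B = 8 \<and> independent ?B" if sp: "span ?B = UNIV"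
  proof -
    have fin: "finite ?B" by (simp add: basis_set_def)
    have "card ?B = card (set [e1, e2, u 1, u 2, u 3, v 1, v 2, v 3])"
      by (rule arg_cong[where f = card]) (auto simp: basis_set_def)
    also have "\<dots> \<le> 8" using card_length[of "[e1, e2, u 1, u 2, u 3, v 1, v 2, v 3]"] by simp
    finally have le: "card ?B \<le> 8" .
    have "independent ?B" using card_le_dim_spanning[of ?B UNIV] sp fin le assms by simp
    moreover have "DIM('v) \<le> card ?B" using dim_le_card[of UNIV ?B] sp fin by simp
    ultimately show ?thesis using le assms by simp
  qed
  then show ?thesis
    unfolding canonical_basis_def canonical_table_def Let_def basis_set_def by blast
qed

text \<open>
  The eight basis vectors are indexed uniformly: \<open>(True, i)\<close> stands for \<open>u i\<close> and \<open>(False, i)\<close> for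
  \<open>v i\<close>, with index \<open>0\<close> for the idempotents \<open>e1\<close> and \<open>e2\<close>.
\<close>

definition basis_index :: "(bool \<times> nat) set" where
  "basis_index = UNIV \<times> {0, 1, 2, 3}"

definition basis_family :: "'v \<Rightarrow> 'v \<Rightarrow> (nat \<Rightarrow> 'v) \<Rightarrow> (nat \<Rightarrow> 'v) \<Rightarrow> bool \<times> nat \<Rightarrow> 'v" where
  "basis_family e1 e2 u v = (\<lambda>(s, i). if i = 0 then (if s then e1 else e2) else (if s then u i else v i))"

definition basis_degree :: "('g, 'b) monoid_scheme \<Rightarrow> (nat \<Rightarrow> 'g) \<Rightarrow> bool \<times> nat \<Rightarrow> 'g" where
  "basis_degree G \<gamma> = (\<lambda>(s, i). if i = 0 then \<one>\<^bsub>G\<^esub> else (if s then \<gamma> i else inv\<^bsub>G\<^esub> (\<gamma> i)))"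

lemma finite_basis_index: "finite basis_index" and card_basis_index: "card basis_index = 8"
  by (simp_all add: basis_index_def card_cartesian_product)

lemma basis_family_image: "basis_family e1 e2 u v ` basis_index = basis_set e1 e2 u v"
  by (auto simp: basis_family_def basis_index_def basis_set_def image_iff UNIV_bool)

lemma canonical_basis_family:
  assumes "canonical_basis A e1 e2 u v"
  shows "inj_on (basis_family e1 e2 u v) basis_index"
    "independent (basis_family e1 e2 u v ` basis_index)" "span (basis_family e1 e2 u v ` basis_index) = UNIV"
proof -
  have "card (basis_set e1 e2 u v) = 8" "independent (basis_set e1 e2 u v)" "span (basis_set e1 e2 u v) = UNIV"
    using assms by (auto simp: canonical_basis_def basis_set_def Let_def)
  then show "inj_on (basis_family e1 e2 u v) basis_index"
    "independent (basis_family e1 e2 u v ` basis_index)" "span (basis_family e1 e2 u v ` basis_index) = UNIV"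
    by (auto simp: basis_family_image eq_card_imp_inj_on finite_basis_index card_basis_index)
qed

definition triple_component ::
  "('g, 'b) monoid_scheme \<Rightarrow> (nat \<Rightarrow> 'g) \<Rightarrow> ('v::real_vector) \<Rightarrow> 'v \<Rightarrow> (nat \<Rightarrow> 'v) \<Rightarrow> (nat \<Rightarrow> 'v) \<Rightarrow> 'g \<Rightarrow> 'v set" where
  "triple_component G \<gamma> e1 e2 u v g =
    span (basis_family e1 e2 u v ` {i \<in> basis_index. basis_degree G \<gamma> i = g})"

lemma triple_component_eq:
  "triple_component G \<gamma> e1 e2 u v g = span ({e. e \<in> {e1, e2} \<and> g = \<one>\<^bsub>G\<^esub>} \<union>
    {u i |i. i \<in> I3 \<and> \<gamma> i = g} \<union> {v i |i. i \<in> I3 \<and> inv\<^bsub>G\<^esub> (\<gamma> i) = g})"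
proof -
  have "basis_family e1 e2 u v ` {i \<in> basis_index. basis_degree G \<gamma> i = g} =
    {e. e \<in> {e1, e2} \<and> g = \<one>\<^bsub>G\<^esub>} \<union> {u i |i. i \<in> I3 \<and> \<gamma> i = g} \<union> {v i |i. i \<in> I3 \<and> inv\<^bsub>G\<^esub> (\<gamma> i) = g}"
    (is "?L = ?R1 \<union> ?R2 \<union> ?R3")
  proof (intro equalityI subsetI)
    fix x assume "x \<in> ?L"
    then obtain s i where "x = basis_family e1 e2 u v (s, i)" "i \<in> {0, 1, 2, 3}" "basis_degree G \<gamma> (s, i) = g"
      by (auto simp: basis_index_def)
    then show "x \<in> ?R1 \<union> ?R2 \<union> ?R3"
      by (cases s; cases "i = 0") (auto simp: basis_family_def basis_degree_def)
  next
    fix x assume "x \<in> ?R1 \<union> ?R2 \<union> ?R3"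
    then consider "x = e1" "g = \<one>\<^bsub>G\<^esub>" | "x = e2" "g = \<one>\<^bsub>G\<^esub>" | i where "i \<in> I3" "x = u i" "\<gamma> i = g"
      | i where "i \<in> I3" "x = v i" "inv\<^bsub>G\<^esub> (\<gamma> i) = g" by blast
    then show "x \<in> ?L"
    proof cases
      case 1
      then show ?thesis by (intro image_eqI[of _ _ "(True, 0)"]) (auto simp: basis_family_def basis_degree_def basis_index_def)
    next
      case 2
      then show ?thesis by (intro image_eqI[of _ _ "(False, 0)"]) (auto simp: basis_family_def basis_degree_def basis_index_def)
    next
      case 3
      then show ?thesis by (intro image_eqI[of _ _ "(True, i)"]) (auto simp: basis_family_def basis_degree_def basis_index_def)
    next
      case 4
      then show ?thesis by (intro image_eqI[of _ _ "(False, i)"]) (auto simp: basis_family_def basis_degree_def basis_index_def)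
    qed
  qed
  then show ?thesis by (simp add: triple_component_def)
qed

lemma Gamma_triple_iff:
  "Gamma_triple G A \<gamma> U \<longleftrightarrow> (\<exists>e1 e2 u v. canonical_basis A e1 e2 u v \<and>
    (\<forall>g\<in>carrier G. U g = triple_component G \<gamma> e1 e2 u v g))"
  unfolding Gamma_triple_def triple_component_eq ..

lemma canonical_basis_table: "canonical_basis A e1 e2 u v \<Longrightarrow> canonical_table A e1 e2 u v"
  unfolding canonical_basis_def canonical_table_def by blast

lemma ball_I3: "(\<forall>i\<in>I3. Q i) \<longleftrightarrow> Q 1 \<and> Q 2 \<and> Q 3"
  by auto

lemma sum_I3: "(\<Sum>l\<in>I3. f l) = f 1 + (f 2 + f 3)"
  by simp

lemma levi_civita_simps:
  "levi_civita j j l = 0" "levi_civita j k k = 0" "levi_civita j k j = 0"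
  "levi_civita 1 2 3 = 1" "levi_civita 2 3 1 = 1" "levi_civita 3 1 2 = 1"
  "levi_civita 1 3 2 = - 1" "levi_civita 3 2 1 = - 1" "levi_civita 2 1 3 = - 1"
  by (auto simp: levi_civita_def)

context comm_group
begin

text \<open>
  These are the identities between degrees that correspond to the nonzero products in the
  multiplication table.
\<close>

lemma degree_triple_products:
  assumes "degree_triple G \<gamma>"
  shows "\<gamma> 1 \<in> carrier G" "\<gamma> 2 \<in> carrier G" "\<gamma> 3 \<in> carrier G"
    "\<gamma> 1 \<otimes> \<gamma> 2 = inv \<gamma> 3" "\<gamma> 2 \<otimes> \<gamma> 1 = inv \<gamma> 3" "\<gamma> 2 \<otimes> \<gamma> 3 = inv \<gamma> 1" "\<gamma> 3 \<otimes> \<gamma> 2 = inv \<gamma> 1"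
    "\<gamma> 3 \<otimes> \<gamma> 1 = inv \<gamma> 2" "\<gamma> 1 \<otimes> \<gamma> 3 = inv \<gamma> 2"
    "inv \<gamma> 1 \<otimes> inv \<gamma> 2 = \<gamma> 3" "inv \<gamma> 2 \<otimes> inv \<gamma> 1 = \<gamma> 3" "inv \<gamma> 2 \<otimes> inv \<gamma> 3 = \<gamma> 1" "inv \<gamma> 3 \<otimes> inv \<gamma> 2 = \<gamma> 1"
    "inv \<gamma> 3 \<otimes> inv \<gamma> 1 = \<gamma> 2" "inv \<gamma> 1 \<otimes> inv \<gamma> 3 = \<gamma> 2"
proof -
  show c: "\<gamma> 1 \<in> carrier G" "\<gamma> 2 \<in> carrier G" "\<gamma> 3 \<in> carrier G"
    using assms by (auto simp: degree_triple_def)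
  have e: "\<gamma> 1 \<otimes> \<gamma> 2 \<otimes> \<gamma> 3 = \<one>" using assms by (simp add: degree_triple_def)
  show 12: "\<gamma> 1 \<otimes> \<gamma> 2 = inv \<gamma> 3" using inv_equality[OF e] c by simp
  then show 21: "\<gamma> 2 \<otimes> \<gamma> 1 = inv \<gamma> 3" using c m_comm by metis
  have "\<gamma> 2 \<otimes> \<gamma> 3 \<otimes> \<gamma> 1 = \<one>" using e c by (simp add: m_ac)
  then show 23: "\<gamma> 2 \<otimes> \<gamma> 3 = inv \<gamma> 1" using inv_equality c by simp
  then show 32: "\<gamma> 3 \<otimes> \<gamma> 2 = inv \<gamma> 1" using c m_comm by metis
  have "\<gamma> 3 \<otimes> \<gamma> 1 \<otimes> \<gamma> 2 = \<one>" using e c by (simp add: m_ac)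
  then show 31: "\<gamma> 3 \<otimes> \<gamma> 1 = inv \<gamma> 2" using inv_equality c by simp
  then show 13: "\<gamma> 1 \<otimes> \<gamma> 3 = inv \<gamma> 2" using c m_comm by metis
  show "inv \<gamma> 1 \<otimes> inv \<gamma> 2 = \<gamma> 3" "inv \<gamma> 2 \<otimes> inv \<gamma> 1 = \<gamma> 3" "inv \<gamma> 2 \<otimes> inv \<gamma> 3 = \<gamma> 1" "inv \<gamma> 3 \<otimes> inv \<gamma> 2 = \<gamma> 1"
    "inv \<gamma> 3 \<otimes> inv \<gamma> 1 = \<gamma> 2" "inv \<gamma> 1 \<otimes> inv \<gamma> 3 = \<gamma> 2"
    using c by (simp_all add: inv_mult[symmetric] 12 21 23 32 31 13 del: One_nat_def)
qed

lemma basis_degree_closed: "degree_triple G \<gamma> \<Longrightarrow> i \<in> basis_index \<Longrightarrow> basis_degree G \<gamma> i \<in> carrier G"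
  by (auto simp: basis_degree_def basis_index_def degree_triple_def)

lemma grading_from_basis:
  fixes b :: "'i \<Rightarrow> 'v::euclidean_space"
  assumes bil: "bilinear (amult A)"
    and J: "finite J" "inj_on b J" "independent (b ` J)" "span (b ` J) = UNIV"
    and d: "\<And>i. i \<in> J \<Longrightarrow> d i \<in> carrier G"
    and m: "\<And>i j. i \<in> J \<Longrightarrow> j \<in> J \<Longrightarrow> amult A (b i) (b j) \<in> span (b ` {k \<in> J. d k = d i \<otimes> d j})"
  shows "grading G A (\<lambda>g. span (b ` {i \<in> J. d i = g}))"
  unfolding grading_def
proof (intro conjI ballI)
  show "direct_sum_decomposition (carrier G) (\<lambda>g. span (b ` {i \<in> J. d i = g}))"
    by (rule direct_sum_basis_family[OF J d])
  note s = bilinear_ladd[OF bil] bilinear_radd[OF bil] bilinear_lmul[OF bil] bilinear_rmul[OF bil]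
    bilinear_lzero[OF bil] bilinear_rzero[OF bil]
  fix g h x y
  assume x: "x \<in> span (b ` {i \<in> J. d i = g})" and y: "y \<in> span (b ` {i \<in> J. d i = h})"
  show "amult A x y \<in> span (b ` {i \<in> J. d i = g \<otimes> h})" using x
  proof (induction x rule: span_induct_alt)
    case base then show ?case by (simp add: s span_zero)
  next
    case (step c x z)
    note xb = step(1)
    have "amult A x y \<in> span (b ` {i \<in> J. d i = g \<otimes> h})" using y
    proof (induction y rule: span_induct_alt)
      case base then show ?case by (simp add: s span_zero)
    next
      case (step c' y' z')
      then have "amult A x y' \<in> span (b ` {i \<in> J. d i = g \<otimes> h})" using m xb by auto
      then show ?case using step by (simp add: s span_add span_scale)
    qed
    then show ?case using step by (simp add: s span_add span_scale)
  qed
qed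

lemma grading_triple_component:
  fixes A :: "('v::euclidean_space) calg"
  assumes bil: "bilinear (amult A)" and cb: "canonical_basis A e1 e2 u v" and dt: "degree_triple G \<gamma>"
  shows "grading G A (triple_component G \<gamma> e1 e2 u v)"
proof -
  let ?b = "basis_family e1 e2 u v" and ?d = "basis_degree G \<gamma>"
  let ?S = "\<lambda>g. span (?b ` {k \<in> basis_index. ?d k = g})"
  note dp = degree_triple_products[OF dt]
  note tab = canonical_basis_table[OF cb, unfolded canonical_table_def ball_I3 sum_I3 levi_civita_simps]
  have in_S: "?b k \<in> ?S g" if "k \<in> basis_index" "?d k = g" for k g using that by (auto intro: span_base)
  have mem: "e1 \<in> ?S \<one>" "e2 \<in> ?S \<one>" "u 1 \<in> ?S (\<gamma> 1)" "u 2 \<in> ?S (\<gamma> 2)" "u 3 \<in> ?S (\<gamma> 3)"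
    "v 1 \<in> ?S (inv \<gamma> 1)" "v 2 \<in> ?S (inv \<gamma> 2)" "v 3 \<in> ?S (inv \<gamma> 3)"
    using in_S[of "(True, 0)" \<one>] in_S[of "(False, 0)" \<one>] in_S[of "(True, 1)" "\<gamma> 1"]
      in_S[of "(True, 2)" "\<gamma> 2"] in_S[of "(True, 3)" "\<gamma> 3"] in_S[of "(False, 1)" "inv \<gamma> 1"]
      in_S[of "(False, 2)" "inv \<gamma> 2"] in_S[of "(False, 3)" "inv \<gamma> 3"]
    by (simp_all add: basis_index_def basis_degree_def basis_family_def)
  have "amult A (?b i) (?b j) \<in> ?S (?d i \<otimes> ?d j)" if "i \<in> basis_index" "j \<in> basis_index" for i j
  proof -
    obtain s m t n where ij: "i = (s, m)" "j = (t, n)" by fastforce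
    have "m \<in> {0, 1, 2, 3}" "n \<in> {0, 1, 2, 3}" using that by (auto simp: ij basis_index_def)
    moreover have "?b (True, 0) = e1" "?b (False, 0) = e2" "\<And>k. k \<in> I3 \<Longrightarrow> ?b (True, k) = u k"
      "\<And>k. k \<in> I3 \<Longrightarrow> ?b (False, k) = v k" "?d (r, 0) = \<one>" "\<And>k. k \<in> I3 \<Longrightarrow> ?d (True, k) = \<gamma> k"
      "\<And>k. k \<in> I3 \<Longrightarrow> ?d (False, k) = inv \<gamma> k" for r
      by (auto simp: basis_family_def basis_degree_def)
    note bd = this
    ultimately show ?thesis
      unfolding ij
      by (elim insertE emptyE; cases s; cases t)
        (simp_all only: bd insertI1 insertI2, simp_all add: tab mem dp span_zero span_neg del: One_nat_def)
  qed
  then have "grading G A (\<lambda>g. ?S g)"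
    using canonical_basis_family[OF cb] basis_degree_closed[OF dt] finite_basis_index
    by (intro grading_from_basis[OF bil]) auto
  then show ?thesis unfolding triple_component_def .
qed

end

text \<open>
  All canonical bases have the same multiplication table, so the linear map matching two of them
  is an automorphism.
\<close>

lemma canonical_basis_unique:
  fixes A :: "('v::euclidean_space) calg"
  assumes bil: "bilinear (amult A)" and b: "canonical_basis A e1 e2 u v" and b': "canonical_basis A e1' e2' u' v'"
  obtains f where "linear f" "bij f" "\<And>x y. f (amult A x y) = amult A (f x) (f y)"
    "\<And>i. i \<in> basis_index \<Longrightarrow> f (basis_family e1 e2 u v i) = basis_family e1' e2' u' v' i"
proof -
  let ?b = "basis_family e1 e2 u v" and ?b' = "basis_family e1' e2' u' v'"
  note B = canonical_basis_family[OF b] and B' = canonical_basis_family[OF b']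
  obtain f where f: "linear f" "\<And>x. x \<in> ?b ` basis_index \<Longrightarrow> f x = ?b' (the_inv_into basis_index ?b x)"
    using linear_independent_extend[OF B(2), of "\<lambda>x. ?b' (the_inv_into basis_index ?b x)"] by auto
  have fb: "f (?b i) = ?b' i" if "i \<in> basis_index" for i
    using f(2) that the_inv_into_f_f[OF B(1)] by simp
  have "f ` (?b ` basis_index) = ?b' ` basis_index" using fb by (force simp: image_image)
  then have "surj f" using linear_span_image[OF f(1), of "?b ` basis_index"] B(3) B'(3) by simp
  then have "bij f" using linear_surjective_imp_injective[OF f(1)] by (simp add: bij_def)
  note t = canonical_basis_table[OF b, unfolded canonical_table_def]
  note t' = canonical_basis_table[OF b', unfolded canonical_table_def]
  note ls = linear_0[OF f(1)] linear_neg[OF f(1)]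
  have fe: "f e1 = e1'" "f e2 = e2'" using fb[of "(True, 0)"] fb[of "(False, 0)"]
    by (simp_all add: basis_index_def basis_family_def)
  have fu: "f (u i) = u' i" "f (v i) = v' i" if "i \<in> I3" for i
    using fb[of "(True, i)"] fb[of "(False, i)"] that by (auto simp: basis_index_def basis_family_def)
  have on_basis: "f (amult A x y) = amult A (f x) (f y)"
    if "x \<in> basis_set e1 e2 u v" "y \<in> basis_set e1 e2 u v" for x y
  proof -
    have fs: "f (\<Sum>l\<in>I3. c l *\<^sub>R u l) = (\<Sum>l\<in>I3. c l *\<^sub>R u' l)"
       "f (\<Sum>l\<in>I3. c l *\<^sub>R v l) = (\<Sum>l\<in>I3. c l *\<^sub>R v' l)" for c
      unfolding linear_sum[OF f(1)] linear_scale[OF f(1)] using fu by (auto intro!: sum.cong)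
    have "x = e1 \<or> x = e2 \<or> (\<exists>j\<in>I3. x = u j) \<or> (\<exists>j\<in>I3. x = v j)"
      "y = e1 \<or> y = e2 \<or> (\<exists>j\<in>I3. y = u j) \<or> (\<exists>j\<in>I3. y = v j)"
      using that unfolding basis_set_def by blast+
    then show ?thesis
      by (elim disjE bexE) (simp_all only: t t' fe fu fs ls if_distrib[of f] cong: if_cong)
  qed
  have bf: "bilinear (\<lambda>x y. f (amult A x y))"
    using f(1) bil by (auto simp: bilinear_def intro: linear_compose[unfolded o_def])
  have bg: "bilinear (\<lambda>x y. amult A (f x) (f y))"
    using f(1) bil by (auto simp: bilinear_def intro: linear_compose[unfolded o_def, OF f(1)])
  have "f (amult A x y) = amult A (f x) (f y)" for x y
    using bilinear_eq[OF bf bg, of UNIV "basis_set e1 e2 u v" UNIV "basis_set e1 e2 u v"] on_basis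
      B(3) by (auto simp: basis_family_image)
  then show thesis using that f(1) \<open>bij f\<close> fb by blast
qed

lemma grading_iso_Gamma_triple:
  fixes A :: "('v::euclidean_space) calg"
  assumes bil: "bilinear (amult A)" and U: "Gamma_triple G A \<gamma> U" "Gamma_triple G A \<gamma> U'"
  shows "grading_iso G A U U'"
proof -
  obtain e1 e2 u v where b: "canonical_basis A e1 e2 u v" and U1: "\<forall>g\<in>carrier G. U g = triple_component G \<gamma> e1 e2 u v g"
    using U(1) unfolding Gamma_triple_iff by blast
  obtain e1' e2' u' v' where b': "canonical_basis A e1' e2' u' v'" and U1': "\<forall>g\<in>carrier G. U' g = triple_component G \<gamma> e1' e2' u' v' g"
    using U(2) unfolding Gamma_triple_iff by blast
  obtain f where f: "linear f" "bij f" "\<And>x y. f (amult A x y) = amult A (f x) (f y)"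
    "\<And>i. i \<in> basis_index \<Longrightarrow> f (basis_family e1 e2 u v i) = basis_family e1' e2' u' v' i"
    using canonical_basis_unique[OF bil b b'] by blast
  have "f ` U g = U' g" if "g \<in> carrier G" for g
  proof -
    have "f ` basis_family e1 e2 u v ` {i \<in> basis_index. basis_degree G \<gamma> i = g} =
        basis_family e1' e2' u' v' ` {i \<in> basis_index. basis_degree G \<gamma> i = g}"
      unfolding image_image using f(4) by (intro image_cong) auto
    then show ?thesis
      using U1 U1' that by (simp add: triple_component_def linear_span_image[OF f(1), symmetric])
  qed
  then show ?thesis using f unfolding grading_iso_def by blast
qed

section \<open>Equivalence of triples\<close>

lemma canonical_basis_swap:
  assumes "canonical_basis A e1 e2 u v" shows "canonical_basis A e2 e1 v u"
proof -
  have "{e2, e1} \<union> v ` I3 \<union> u ` I3 = {e1, e2} \<union> u ` I3 \<union> v ` I3" by blast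
  then show ?thesis using assms unfolding canonical_basis_def Let_def by (simp only:) blast
qed

lemma permutes_I3_cases:
  assumes "\<sigma> permutes I3"
  obtains "\<sigma> 1 = 1" "\<sigma> 2 = 2" "\<sigma> 3 = 3" | "\<sigma> 1 = 2" "\<sigma> 2 = 3" "\<sigma> 3 = 1" | "\<sigma> 1 = 3" "\<sigma> 2 = 1" "\<sigma> 3 = 2"
    | "\<sigma> 1 = 1" "\<sigma> 2 = 3" "\<sigma> 3 = 2" | "\<sigma> 1 = 3" "\<sigma> 2 = 2" "\<sigma> 3 = 1" | "\<sigma> 1 = 2" "\<sigma> 2 = 1" "\<sigma> 3 = 3"
proof -
  have "\<sigma> 1 \<in> I3" "\<sigma> 2 \<in> I3" "\<sigma> 3 \<in> I3" using permutes_in_image[OF assms] by auto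
  moreover have "\<sigma> 1 \<noteq> \<sigma> 2" "\<sigma> 1 \<noteq> \<sigma> 3" "\<sigma> 2 \<noteq> \<sigma> 3" using inj_eq[OF permutes_inj[OF assms]] by simp_all
  ultimately show thesis
    by (elim insertE emptyE) (simp_all add: that del: One_nat_def)
qed

text \<open>
  An odd permutation reverses the signs in \<open>u\<^sub>j u\<^sub>k = \<epsilon>\<^sub>j\<^sub>k\<^sub>l v\<^sub>l\<close>. Scaling all \<open>u\<^sub>i\<close> and \<open>v\<^sub>i\<close> by
  the sign \<open>s\<close> of the permutation repairs this: the left-hand side is multiplied by \<open>s\<^sup>2 = 1\<close> and
  the right-hand side by \<open>s\<close>.
\<close>

lemma canonical_basis_permute:
  fixes A :: "('v::euclidean_space) calg"
  assumes dim: "DIM('v) = 8" and bil: "bilinear (amult A)" and b: "canonical_basis A e1 e2 u v" and p: "\<sigma> permutes I3"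
  obtains s where "s\<^sup>2 = 1" "canonical_basis A e1 e2 (\<lambda>i. s *\<^sub>R u (\<sigma> i)) (\<lambda>i. s *\<^sub>R v (\<sigma> i))"
proof
  let ?s = "levi_civita (\<sigma> 1) (\<sigma> 2) (\<sigma> 3)"
  show s2: "?s\<^sup>2 = 1" using p by (cases rule: permutes_I3_cases) (simp_all add: levi_civita_simps del: One_nat_def)
  have sp: "span (basis_set e1 e2 u v) = UNIV" and t: "canonical_table A e1 e2 u v"
    using b canonical_basis_iff[OF dim] by blast+
  let ?B = "basis_set e1 e2 (\<lambda>i. ?s *\<^sub>R u (\<sigma> i)) (\<lambda>i. ?s *\<^sub>R v (\<sigma> i))"
  have "x \<in> span ?B" if x: "x \<in> basis_set e1 e2 u v" for x
  proof -
    have s: "y \<in> span ?B" if "?s *\<^sub>R y \<in> ?B" for y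
    proof -
      have "y = ?s *\<^sub>R (?s *\<^sub>R y)" using s2 by (simp add: power2_eq_square)
      then show ?thesis using span_scale[OF span_base[OF that], of ?s] by simp
    qed
    have "u i \<in> span ?B" "v i \<in> span ?B" if i: "i \<in> I3" for i
    proof -
      obtain j where j: "j \<in> I3" "i = \<sigma> j" using permutes_image[OF p] i by (metis imageE)
      then have "?s *\<^sub>R u i \<in> ?B" "?s *\<^sub>R v i \<in> ?B" unfolding basis_set_def by blast+
      then show "u i \<in> span ?B" "v i \<in> span ?B" by (simp_all only: s)
    qed
    then show ?thesis using x by (auto simp: basis_set_def intro: span_base)
  qed
  then have "span ?B = UNIV" using sp span_mono[of "basis_set e1 e2 u v" "span ?B"] by (auto simp: span_span)
  moreover have "canonical_table A e1 e2 (\<lambda>i. ?s *\<^sub>R u (\<sigma> i)) (\<lambda>i. ?s *\<^sub>R v (\<sigma> i))"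
    using p unfolding canonical_table_def ball_I3 sum_I3 levi_civita_simps
    by (cases rule: permutes_I3_cases)
      (simp_all add: bilinear_lmul[OF bil] bilinear_rmul[OF bil] bilinear_lneg[OF bil] bilinear_rneg[OF bil]
        levi_civita_simps t[unfolded canonical_table_def ball_I3 sum_I3 levi_civita_simps] del: One_nat_def)
  ultimately show "canonical_basis A e1 e2 (\<lambda>i. ?s *\<^sub>R u (\<sigma> i)) (\<lambda>i. ?s *\<^sub>R v (\<sigma> i))"
    using canonical_basis_iff[OF dim] by blast
qed

lemma triple_component_subset:
  assumes U: "e1 \<in> U \<one>\<^bsub>G\<^esub>" "e2 \<in> U \<one>\<^bsub>G\<^esub>" "\<And>i. i \<in> I3 \<Longrightarrow> u i \<in> U (\<gamma> i)" "\<And>i. i \<in> I3 \<Longrightarrow> v i \<in> U (inv\<^bsub>G\<^esub> (\<gamma> i))"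
    and g: "subspace (U g)"
  shows "triple_component G \<gamma> e1 e2 u v g \<subseteq> U g"
  unfolding triple_component_eq by (rule span_minimal[OF _ g]) (use U in auto)

lemma triple_component_mem:
  "e1 \<in> triple_component G \<gamma> e1 e2 u v \<one>\<^bsub>G\<^esub>" "e2 \<in> triple_component G \<gamma> e1 e2 u v \<one>\<^bsub>G\<^esub>"
  unfolding triple_component_eq by (rule span_base; blast)+

lemma triple_component_mem_uv:
  assumes "i \<in> I3"
  shows "u i \<in> triple_component G \<gamma> e1 e2 u v (\<gamma> i)" "v i \<in> triple_component G \<gamma> e1 e2 u v (inv\<^bsub>G\<^esub> (\<gamma> i))"
  unfolding triple_component_eq using assms by (auto intro!: span_base)

context comm_group
begin

lemma grading_cong:
  assumes "grading G A U" "\<And>g. g \<in> carrier G \<Longrightarrow> U' g = U g" shows "grading G A U'"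
  using assms unfolding grading_def direct_sum_decomposition_def by (simp cong: ball_cong)

lemma grading_Gamma_triple:
  fixes A :: "('v::euclidean_space) calg"
  assumes "bilinear (amult A)" "degree_triple G \<gamma>" "Gamma_triple G A \<gamma> U"
  shows "grading G A U"
proof -
  obtain e1 e2 u v where cb: "canonical_basis A e1 e2 u v"
    and Ug: "\<And>g. g \<in> carrier G \<Longrightarrow> U g = triple_component G \<gamma> e1 e2 u v g"
    using assms(3) unfolding Gamma_triple_iff by blast
  show ?thesis by (rule grading_cong[OF grading_triple_component[OF assms(1) cb assms(2)] Ug])
qed

text \<open>
  It is enough that the basis vectors are homogeneous of the right degrees: the decomposition that
  they define is contained in \<open>U\<close> and so equal to it by \<open>direct_sum_mono_eq\<close>.
\<close>

lemma Gamma_tripleI: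
  fixes A :: "('v::euclidean_space) calg"
  assumes bil: "bilinear (amult A)" and dt: "degree_triple G \<gamma>" and cb: "canonical_basis A e1 e2 u v"
    and gr: "grading G A U"
    and U: "e1 \<in> U \<one>" "e2 \<in> U \<one>" "\<And>i. i \<in> I3 \<Longrightarrow> u i \<in> U (\<gamma> i)" "\<And>i. i \<in> I3 \<Longrightarrow> v i \<in> U (inv (\<gamma> i))"
  shows "Gamma_triple G A \<gamma> U"
proof -
  have d: "direct_sum_decomposition (carrier G) U" using gr by (simp add: grading_def)
  have d': "direct_sum_decomposition (carrier G) (triple_component G \<gamma> e1 e2 u v)"
    using grading_triple_component[OF bil cb dt] by (simp add: grading_def)
  have sub: "triple_component G \<gamma> e1 e2 u v g \<subseteq> U g" if "g \<in> carrier G" for g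
    by (rule triple_component_subset[OF U direct_sum_subspace[OF d that]])
  have "\<forall>g\<in>carrier G. U g = triple_component G \<gamma> e1 e2 u v g"
    using direct_sum_mono_eq[OF d' d sub] by simp
  then show ?thesis unfolding Gamma_triple_iff using cb by blast
qed

text \<open>
  A permutation of the degrees is undone by permuting the canonical basis, and their inversion by
  exchanging the roles of \<open>u\<close> and \<open>v\<close>.
\<close>

lemma Gamma_triple_equiv:
  fixes A :: "('v::euclidean_space) calg"
  assumes dim: "DIM('v) = 8" and bil: "bilinear (amult A)"
    and dt: "degree_triple G \<gamma>" "degree_triple G \<gamma>'" and eq: "triple_equiv G \<gamma> \<gamma>'"
    and U: "Gamma_triple G A \<gamma>' U"
  shows "Gamma_triple G A \<gamma> U"
proof -
  obtain e1 e2 u v where cb: "canonical_basis A e1 e2 u v"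
    and Ug: "\<And>g. g \<in> carrier G \<Longrightarrow> U g = triple_component G \<gamma>' e1 e2 u v g"
    using U unfolding Gamma_triple_iff by blast
  note gr = grading_Gamma_triple[OF bil dt(2) U]
  have c: "\<gamma> i \<in> carrier G" "\<gamma>' i \<in> carrier G" if "i \<in> I3" for i
    using dt that by (auto simp: degree_triple_def)
  have sU: "subspace (U g)" if "g \<in> carrier G" for g using gr that direct_sum_subspace by (auto simp: grading_def)
  have eU: "e1 \<in> U \<one>" "e2 \<in> U \<one>" by (simp_all add: Ug triple_component_mem)
  have uU: "u i \<in> U (\<gamma>' i)" "v i \<in> U (inv (\<gamma>' i))" if "i \<in> I3" for i
    using c[OF that] by (simp_all only: Ug inv_closed triple_component_mem_uv[OF that])
  obtain \<pi> where \<pi>: "\<pi> permutes I3"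
    and eq': "(\<forall>i\<in>I3. \<gamma>' i = \<gamma> (\<pi> i)) \<or> (\<forall>i\<in>I3. \<gamma>' i = inv (\<gamma> (\<pi> i)))"
    using eq by (auto simp: triple_equiv_def)
  define \<sigma> where "\<sigma> = inv_into UNIV \<pi>"
  have \<sigma>: "\<sigma> permutes I3" unfolding \<sigma>_def using permutes_inv[OF \<pi>] .
  have \<pi>\<sigma>: "\<pi> (\<sigma> i) = i" for i unfolding \<sigma>_def using permutes_inverses[OF \<pi>] by simp
  have \<sigma>I: "\<sigma> i \<in> I3" if "i \<in> I3" for i using that permutes_in_image[OF \<sigma>] by simp
  show ?thesis
    using eq'
  proof
    assume *: "\<forall>i\<in>I3. \<gamma>' i = \<gamma> (\<pi> i)"
    obtain s where b: "canonical_basis A e1 e2 (\<lambda>i. s *\<^sub>R u (\<sigma> i)) (\<lambda>i. s *\<^sub>R v (\<sigma> i))"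
      using canonical_basis_permute[OF dim bil cb \<sigma>] .
    have d: "\<gamma>' (\<sigma> i) = \<gamma> i" if "i \<in> I3" for i using *[rule_format, OF \<sigma>I[OF that]] \<pi>\<sigma> by simp
    have "s *\<^sub>R u (\<sigma> i) \<in> U (\<gamma> i)" "s *\<^sub>R v (\<sigma> i) \<in> U (inv (\<gamma> i))" if "i \<in> I3" for i
      using uU[OF \<sigma>I[OF that]] c[OF that] by (auto simp: d[OF that] intro!: subspace_scale[OF sU])
    then show ?thesis using Gamma_tripleI[OF bil dt(1) b gr eU] by blast
  next
    assume *: "\<forall>i\<in>I3. \<gamma>' i = inv (\<gamma> (\<pi> i))"
    obtain s where b: "canonical_basis A e2 e1 (\<lambda>i. s *\<^sub>R v (\<sigma> i)) (\<lambda>i. s *\<^sub>R u (\<sigma> i))"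
      using canonical_basis_permute[OF dim bil canonical_basis_swap[OF cb] \<sigma>] .
    have d: "\<gamma>' (\<sigma> i) = inv (\<gamma> i)" if "i \<in> I3" for i using *[rule_format, OF \<sigma>I[OF that]] \<pi>\<sigma> by simp
    have "s *\<^sub>R v (\<sigma> i) \<in> U (\<gamma> i)" "s *\<^sub>R u (\<sigma> i) \<in> U (inv (\<gamma> i))" if "i \<in> I3" for i
      using uU[OF \<sigma>I[OF that]] c[OF that] by (auto simp: d[OF that] intro!: subspace_scale[OF sU])
    then show ?thesis using Gamma_tripleI[OF bil dt(1) b gr eU(2,1)] by blast
  qed
qed

definition degree_count :: "(nat \<Rightarrow> 'a) \<Rightarrow> 'a \<Rightarrow> nat" where
  "degree_count \<gamma> g = card {i \<in> I3. \<gamma> i = g} + card {i \<in> I3. inv (\<gamma> i) = g}"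

lemma dim_triple_component:
  fixes A :: "('v::euclidean_space) calg"
  assumes cb: "canonical_basis A e1 e2 u v"
  shows "dim (triple_component G \<gamma> e1 e2 u v g) = (if g = \<one> then 2 else 0) + degree_count \<gamma> g"
proof -
  let ?b = "basis_family e1 e2 u v" and ?I = "{i \<in> basis_index. basis_degree G \<gamma> i = g}"
  note B = canonical_basis_family[OF cb]
  have sub: "?I \<subseteq> basis_index" by blast
  have "dim (triple_component G \<gamma> e1 e2 u v g) = card (?b ` ?I)"
    unfolding triple_component_def dim_span
    using independent_mono[OF B(2) image_mono[OF sub]] by (rule dim_eq_card_independent)
  also have "\<dots> = card ?I" using B(1) sub by (intro card_image) (rule inj_on_subset)
  also have "?I = (if g = \<one> then {(True, 0), (False, 0)} else {}) \<union>
      (Pair True ` {i \<in> I3. \<gamma> i = g} \<union> Pair False ` {i \<in> I3. inv (\<gamma> i) = g})"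
    by (auto simp: basis_index_def basis_degree_def split: if_splits)
  also have "card \<dots> = card (if g = \<one> then {(True, 0::nat), (False, 0)} else {}) +
      card (Pair True ` {i \<in> I3. \<gamma> i = g} \<union> Pair False ` {i \<in> I3. inv (\<gamma> i) = g})"
    by (rule card_Un_disjoint) auto
  also have "card (Pair True ` {i \<in> I3. \<gamma> i = g} \<union> Pair False ` {i \<in> I3. inv (\<gamma> i) = g}) = degree_count \<gamma> g"
    unfolding degree_count_def
    by (subst card_Un_disjoint) (auto simp: card_image inj_on_def)
  finally show ?thesis by simp
qed

text \<open>
  The counts determine the multiset of the pairs \<open>{\<gamma>\<^sub>i, inv \<gamma>\<^sub>i}\<close>: the pair of \<open>g\<close> occurs
  \<open>degree_count \<gamma> g\<close> times if \<open>g \<noteq> inv g\<close>, and half as often if \<open>g = inv g\<close>, as each of its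
  occurrences is then counted twice. Families with the same multiset of values differ by a
  permutation of the indices.
\<close>

lemma degree_count_eq_imp_permutation:
  assumes dt: "degree_triple G \<gamma>" "degree_triple G \<gamma>'"
    and eq: "\<And>g. g \<in> carrier G \<Longrightarrow> degree_count \<gamma> g = degree_count \<gamma>' g"
  obtains \<pi> where "\<pi> permutes I3" "\<And>i. i \<in> I3 \<Longrightarrow> \<gamma>' i = \<gamma> (\<pi> i) \<or> \<gamma>' i = inv (\<gamma> (\<pi> i))"
proof -
  let ?p = "\<lambda>\<gamma> i. {\<gamma> i, inv (\<gamma> i)}"
  \<comment> \<open>Division by \<open>2\<close> because \<open>\<gamma>\<^sub>i\<close> and its inverse both contribute to the count of an
      involution.\<close>
  have cI: "card {i \<in> I3. ?p \<delta> i = {g, inv g}} = (if g = inv g then degree_count \<delta> g div 2 else degree_count \<delta> g)"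
    if g: "g \<in> carrier G" and d: "degree_triple G \<delta>" for \<delta> g
  proof -
    have c: "\<delta> i \<in> carrier G" if "i \<in> I3" for i using d that by (auto simp: degree_triple_def)
    have iff: "inv (\<delta> i) = g \<longleftrightarrow> \<delta> i = inv g" if "i \<in> I3" for i using c[OF that] g by (metis inv_inv)
    have p: "?p \<delta> i = {g, inv g} \<longleftrightarrow> \<delta> i = g \<or> \<delta> i = inv g" if "i \<in> I3" for i
      using c[OF that] g by (auto simp: doubleton_eq_iff)
    have dc: "degree_count \<delta> g = card {i \<in> I3. \<delta> i = g} + card {i \<in> I3. \<delta> i = inv g}"
      unfolding degree_count_def using iff by (auto intro!: arg_cong[where f = card])
    have "{i \<in> I3. ?p \<delta> i = {g, inv g}} = {i \<in> I3. \<delta> i = g} \<union> {i \<in> I3. \<delta> i = inv g}"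
      using p by blast
    moreover have "card ({i \<in> I3. \<delta> i = g} \<union> {i \<in> I3. \<delta> i = inv g}) =
        card {i \<in> I3. \<delta> i = g} + card {i \<in> I3. \<delta> i = inv g}" if "g \<noteq> inv g"
      using that by (intro card_Un_disjoint) auto
    ultimately show ?thesis using dc by (cases "g = inv g") (auto simp flip: mult_2)
  qed
  have "image_mset (?p \<gamma>') (mset_set I3) = image_mset (?p \<gamma>) (mset_set I3)"
  proof (rule multiset_eqI)
    fix X
    have cnt: "count (image_mset (?p \<delta>) (mset_set I3)) X = card {i \<in> I3. ?p \<delta> i = X}" for \<delta>
    proof -
      have "count (image_mset (?p \<delta>) (mset_set I3)) X =
          (\<Sum>i | i \<in># mset_set I3 \<and> X = ?p \<delta> i. count (mset_set I3) i)" by (rule count_image_mset')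
      also have "\<dots> = (\<Sum>i\<in>{i \<in> I3. ?p \<delta> i = X}. 1)" by (intro sum.cong) auto
      finally show ?thesis by simp
    qed
    show "count (image_mset (?p \<gamma>') (mset_set I3)) X = count (image_mset (?p \<gamma>) (mset_set I3)) X"
    proof (cases "\<exists>g\<in>carrier G. X = {g, inv g}")
      case True
      then obtain g where g: "g \<in> carrier G" and X: "X = {g, inv g}" by blast
      show ?thesis unfolding cnt unfolding X cI[OF g dt(1)] cI[OF g dt(2)] eq[OF g] ..
    next
      case False
      then have e: "{i \<in> I3. ?p \<gamma>' i = X} = {}" "{i \<in> I3. ?p \<gamma> i = X} = {}"
        using dt by (auto simp: degree_triple_def)
      show ?thesis unfolding cnt e ..
    qed
  qed
  then obtain \<pi> where \<pi>: "\<pi> permutes I3" "\<forall>i\<in>I3. ?p \<gamma>' i = ?p \<gamma> (\<pi> i)"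
    using image_mset_eq_implies_permutes[of I3 "?p \<gamma>'" "?p \<gamma>"] by blast
  have "\<gamma>' i = \<gamma> (\<pi> i) \<or> \<gamma>' i = inv (\<gamma> (\<pi> i))" if "i \<in> I3" for i
    using \<pi>(2)[rule_format, OF that] by blast
  then show thesis using that \<pi>(1) by blast
qed

text \<open>
  Let \<open>(a, b, c)\<close> be the permuted triple. If the inversions are not simultaneous, then one of the
  three positions stands alone against the other two. Both triples have product \<open>e\<close>; comparing
  them shows that the entry in that position is its own inverse, so it may be inverted or not at
  will.
\<close>

lemma triple_equiv_if_degree_count_eq:
  assumes dt: "degree_triple G \<gamma>" "degree_triple G \<gamma>'"
    and eq: "\<And>g. g \<in> carrier G \<Longrightarrow> degree_count \<gamma> g = degree_count \<gamma>' g"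
  shows "triple_equiv G \<gamma> \<gamma>'"
proof -
  obtain \<pi> where \<pi>: "\<pi> permutes I3" and pm: "\<And>i. i \<in> I3 \<Longrightarrow> \<gamma>' i = \<gamma> (\<pi> i) \<or> \<gamma>' i = inv (\<gamma> (\<pi> i))"
    using degree_count_eq_imp_permutation[OF dt eq] by blast
  define a b c where "a = \<gamma> (\<pi> 1)" and "b = \<gamma> (\<pi> 2)" and "c = \<gamma> (\<pi> 3)"
  have car: "a \<in> carrier G" "b \<in> carrier G" "c \<in> carrier G" and abc: "a \<otimes> b \<otimes> c = \<one>"
    unfolding a_def b_def c_def
    by (rule permutes_I3_cases[OF \<pi>]; simp add: degree_triple_products[OF dt(1)] del: One_nat_def)+
  have e': "\<gamma>' 1 \<otimes> \<gamma>' 2 \<otimes> \<gamma>' 3 = \<one>" using dt(2) by (simp add: degree_triple_def)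
  have one: "inv x = x" if "x \<in> carrier G" "y \<in> carrier G" "x \<otimes> y = \<one>" "inv x \<otimes> y = \<one>" for x y
    using that inv_equality[of x y] inv_equality[of "inv x" y] by simp
  have neg: "inv a \<otimes> inv b \<otimes> inv c = \<one>" using abc car by (simp add: inv_mult[symmetric])
  have "(\<gamma>' 1 = a \<and> \<gamma>' 2 = b \<and> \<gamma>' 3 = c) \<or> (\<gamma>' 1 = inv a \<and> \<gamma>' 2 = inv b \<and> \<gamma>' 3 = inv c)"
  proof -
    have 1: "inv a = a" if "inv a \<otimes> b \<otimes> c = \<one> \<or> a \<otimes> inv b \<otimes> inv c = \<one>"
      using that one[of a "b \<otimes> c"] one[of "inv a" "inv b \<otimes> inv c"] abc neg car by (auto simp: m_assoc)
    have 2: "inv b = b" if "a \<otimes> inv b \<otimes> c = \<one> \<or> inv a \<otimes> b \<otimes> inv c = \<one>"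
      using that one[of b "a \<otimes> c"] one[of "inv b" "inv a \<otimes> inv c"] abc neg car by (auto simp: m_ac)
    have 3: "inv c = c" if "a \<otimes> b \<otimes> inv c = \<one> \<or> inv a \<otimes> inv b \<otimes> c = \<one>"
      using that one[of c "a \<otimes> b"] one[of "inv c" "inv a \<otimes> inv b"] abc neg car by (auto simp: m_ac)
    have "\<gamma>' 1 = a \<or> \<gamma>' 1 = inv a" "\<gamma>' 2 = b \<or> \<gamma>' 2 = inv b" "\<gamma>' 3 = c \<or> \<gamma>' 3 = inv c"
      using pm[of 1] pm[of 2] pm[of 3] by (simp_all add: a_def b_def c_def)
    then show ?thesis using e' 1 2 3 by (elim disjE) (simp_all del: One_nat_def)
  qed
  then show ?thesis unfolding triple_equiv_def a_def b_def c_def using \<pi> by auto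
qed

lemma triple_equiv_if_grading_iso:
  fixes A :: "('v::euclidean_space) calg"
  assumes dt: "degree_triple G \<gamma>" "degree_triple G \<gamma>'"
    and U: "Gamma_triple G A \<gamma> U" "Gamma_triple G A \<gamma>' U'" and iso: "grading_iso G A U U'"
  shows "triple_equiv G \<gamma> \<gamma>'"
proof (rule triple_equiv_if_degree_count_eq[OF dt])
  fix g assume g: "g \<in> carrier G"
  obtain f where f: "linear f" "bij f" "f ` U g = U' g" using iso g by (auto simp: grading_iso_def)
  have "dim (U' g) = dim (U g)"
    unfolding f(3)[symmetric] using f(1) inj_on_subset[OF bij_is_inj[OF f(2)]] by (intro dim_image_eq) auto
  then show "degree_count \<gamma> g = degree_count \<gamma>' g"
    using U g unfolding Gamma_triple_iff by (auto simp: dim_triple_component)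
qed

end

section \<open>Isotropic neutral component\<close>

text \<open>
  This is the double of the reals with parameter \<open>1\<close>, written in the coordinates of its two
  orthogonal idempotents.
\<close>

definition split_alg :: "(real \<times> real) calg" where
  "split_alg = \<lparr> amult = (\<lambda>(a, b) (c, d). (a * c, b * d)), aunit = (1, 1), aconj = (\<lambda>(a, b). (b, a)),
    anorm = (\<lambda>(a, b). a * b) \<rparr>"

lemma nondegenerate_split: "nondegenerate_norm split_alg"
proof -
  have p: "polar split_alg (a, b) (c, d) = a * d + c * b" for a b c d
    by (simp add: polar_def split_alg_def algebra_simps)
  have "x = 0" if x: "\<forall>y. polar split_alg x y = 0" for x
    using x[rule_format, of "(1, 0)"] x[rule_format, of "(0, 1)"]
    by (cases x) (simp add: p zero_prod_def)
  then show ?thesis unfolding nondegenerate_norm_def by (simp add: split_alg_def zero_prod_def)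
qed

definition split_quaternion_model :: "((real \<times> real) \<times> (real \<times> real)) calg" where
  "split_quaternion_model = cayley_dickson split_alg (- 1)"

definition split_octonion_model :: "(((real \<times> real) \<times> (real \<times> real)) \<times> ((real \<times> real) \<times> (real \<times> real))) calg" where
  "split_octonion_model = cayley_dickson split_quaternion_model (- 1)"

text \<open>
  A canonical basis in the coordinates of repeated doubling: \<open>u\<^sub>1, v\<^sub>1\<close> and \<open>u\<^sub>2, v\<^sub>2\<close> are the
  products of the two idempotents with the elements used for the first and the second doubling,
  and \<open>u\<^sub>3 = v\<^sub>1 v\<^sub>2\<close>, \<open>v\<^sub>3 = u\<^sub>1 u\<^sub>2\<close>.
\<close>

definition model_u :: "nat \<Rightarrow> ((real \<times> real) \<times> (real \<times> real)) \<times> ((real \<times> real) \<times> (real \<times> real))" where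
  "model_u i = (if i = 1 then ((0, (1, 0)), 0) else if i = 2 then (0, ((1, 0), 0)) else (0, (0, (0, 1))))"

definition model_v :: "nat \<Rightarrow> ((real \<times> real) \<times> (real \<times> real)) \<times> ((real \<times> real) \<times> (real \<times> real))" where
  "model_v i = (if i = 1 then ((0, (0, 1)), 0) else if i = 2 then (0, ((0, 1), 0)) else (0, (0, (1, 0))))"

abbreviation "model_e1 \<equiv> (((1, 0), 0), 0) :: ((real \<times> real) \<times> (real \<times> real)) \<times> ((real \<times> real) \<times> (real \<times> real))"
abbreviation "model_e2 \<equiv> (((0, 1), 0), 0) :: ((real \<times> real) \<times> (real \<times> real)) \<times> ((real \<times> real) \<times> (real \<times> real))"

lemma model_canonical_table: "canonical_table split_octonion_model model_e1 model_e2 model_u model_v"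
  unfolding canonical_table_def ball_I3 sum_I3 levi_civita_simps
  by (simp add: split_octonion_model_def split_quaternion_model_def split_alg_def cayley_dickson_def
      model_u_def model_v_def zero_prod_def)

lemma model_span: "span (basis_set model_e1 model_e2 model_u model_v) = UNIV"
proof -
  let ?B = "basis_set model_e1 model_e2 model_u model_v"
  have mem: "model_e1 \<in> span ?B" "model_e2 \<in> span ?B" "model_u 1 \<in> span ?B" "model_u 2 \<in> span ?B" "model_u 3 \<in> span ?B"
    "model_v 1 \<in> span ?B" "model_v 2 \<in> span ?B" "model_v 3 \<in> span ?B"
    by (rule span_base; simp add: basis_set_def)+
  have "x \<in> span ?B" for x
  proof -
    obtain a b c d p q r s where x: "x = (((a, b), (c, d)), ((p, q), (r, s)))" by (metis surj_pair)
    have "x = a *\<^sub>R model_e1 + b *\<^sub>R model_e2 + c *\<^sub>R model_u 1 + d *\<^sub>R model_v 1 + p *\<^sub>R model_u 2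
        + q *\<^sub>R model_v 2 + r *\<^sub>R model_v 3 + s *\<^sub>R model_u 3"
      by (simp add: x model_u_def model_v_def zero_prod_def)
    also have "\<dots> \<in> span ?B" by (intro span_add span_scale mem)
    finally show ?thesis .
  qed
  then show ?thesis by blast
qed

lemma canonical_basis_image:
  fixes A :: "('v::euclidean_space) calg" and B :: "('w::euclidean_space) calg"
  assumes dim: "DIM('v) = 8"
    and t: "canonical_table B e1 e2 u v" and sp: "span (basis_set e1 e2 u v) = UNIV"
    and \<phi>: "linear \<phi>" "bij \<phi>" and m: "\<And>x y. \<phi> (amult B x y) = amult A (\<phi> x) (\<phi> y)"
  shows "canonical_basis A (\<phi> e1) (\<phi> e2) (\<lambda>i. \<phi> (u i)) (\<lambda>i. \<phi> (v i))"
  unfolding canonical_basis_iff[OF dim]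
proof
  have "basis_set (\<phi> e1) (\<phi> e2) (\<lambda>i. \<phi> (u i)) (\<lambda>i. \<phi> (v i)) = \<phi> ` basis_set e1 e2 u v"
    by (simp add: basis_set_def image_Un image_image)
  then show "span (basis_set (\<phi> e1) (\<phi> e2) (\<lambda>i. \<phi> (u i)) (\<lambda>i. \<phi> (v i))) = UNIV"
    using linear_span_image[OF \<phi>(1)] sp bij_is_surj[OF \<phi>(2)] by simp
  note t' = t[unfolded canonical_table_def]
  have s: "(\<Sum>l\<in>I3. c l *\<^sub>R \<phi> (w l)) = \<phi> (\<Sum>l\<in>I3. c l *\<^sub>R w l)" for c w
    unfolding linear_sum[OF \<phi>(1)] linear_scale[OF \<phi>(1)] ..
  show "canonical_table A (\<phi> e1) (\<phi> e2) (\<lambda>i. \<phi> (u i)) (\<lambda>i. \<phi> (v i))"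
    unfolding canonical_table_def s m[symmetric]
    using t' by (simp add: linear_0[OF \<phi>(1)] linear_neg[OF \<phi>(1)] del: sum.insert sum.empty)
qed

context graded_composition_algebra
begin

definition graded_range :: "('d \<Rightarrow> 'v) \<Rightarrow> bool" where
  "graded_range \<phi> \<longleftrightarrow> range \<phi> \<subseteq> span {x \<in> range \<phi>. \<exists>g\<in>carrier G. x \<in> U g}"

text \<open>
  The orthogonal complement of a graded nondegenerate subalgebra is graded and again
  nondegenerate, so it contains homogeneous elements that pair nontrivially; their degrees are
  necessarily inverse.
\<close>

lemma ex_dual_homogeneous_pair:
  assumes em: "embedding (B :: 'd::euclidean_space calg) \<phi>" and nd: "nondegenerate_norm B"
    and dim: "DIM('d) < DIM('v)" and gr: "graded_range \<phi>"
  obtains g x y where "g \<in> carrier G" "x \<in> U g" "y \<in> U (inv g)" "x \<in> orth A (range \<phi>)" "y \<in> orth A (range \<phi>)" "P x y \<noteq> 0"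
proof -
  note dec = embedding_decomposition[OF em nd]
  have hproj_orth: "hproj g s \<in> orth A (range \<phi>)" if s: "s \<in> orth A (range \<phi>)" and g: "g \<in> carrier G" for s g
  proof -
    have "P (hproj g s) x = 0" if "x \<in> span {x \<in> range \<phi>. \<exists>g\<in>carrier G. x \<in> U g}" for x using that
    proof (induction rule: span_induct_alt)
      case (step c r y)
      then obtain h where h: "h \<in> carrier G" "r \<in> U h" and r: "r \<in> range \<phi>" by blast
      have "P (hproj g s) r = 0"
      proof (cases "g \<otimes> h = \<one>")
        case True
        then have "g = inv h" using h g by (metis inv_equality)
        then have "P (hproj g s) r = P s r" using polar_hproj[OF h(2,1), of s] polar_commute by simp
        then show ?thesis using s r by (auto simp: orth_def)
      next
        case False
        then show ?thesis using polar_zero[OF hproj_in[OF g] h(2) g h(1)] by blast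
      qed
      then show ?case using step by (simp add: polar_simps)
    qed (simp add: polar_simps)
    then show ?thesis using gr by (auto simp: graded_range_def orth_def)
  qed
  obtain z where z: "z \<notin> range \<phi>" using embedding_not_surj[OF em dim] .
  obtain r s where rs: "r \<in> range \<phi>" "s \<in> orth A (range \<phi>)" "z = r + s" using dec[of z] by blast
  then have "s \<noteq> 0" using z by auto
  have "\<exists>g\<in>carrier G. hproj g s \<noteq> 0"
  proof (rule ccontr)
    assume none: "\<not> ?thesis"
    have "P s y = 0" for y
    proof (induction y rule: homogeneous_induct)
      case (homogeneous h y)
      then have "P y s = 0" using polar_hproj[of y h s] none by (simp add: polar_simps)
      then show ?case by (simp add: polar_commute)
    qed (simp_all add: polar_simps)
    then show False using nondegenerate \<open>s \<noteq> 0\<close> by blast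
  qed
  then obtain g where g: "g \<in> carrier G" "hproj g s \<noteq> 0" by blast
  let ?x = "hproj g s"
  note xo = hproj_orth[OF rs(2) g(1)]
  obtain w where "P ?x w \<noteq> 0" using nondegenerate g(2) by blast
  moreover obtain r' s' where rs': "r' \<in> range \<phi>" "s' \<in> orth A (range \<phi>)" "w = r' + s'" using dec[of w] by blast
  ultimately have "P ?x s' \<noteq> 0" using xo by (auto simp: polar_simps orth_def)
  then have "P ?x (hproj (inv g) s') \<noteq> 0" using polar_hproj[OF hproj_in[OF g(1)] g(1)] by metis
  then show thesis
    using that[of g ?x "hproj (inv g) s'"] g(1) hproj_in[OF g(1)] hproj_in[of "inv g"] xo hproj_orth[OF rs'(2)] by simp
qed

text \<open>
  By \<open>z = c z + (1 - c) z\<close> every element is a sum of two isotropic ones, and the images of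
  multiplication by \<open>c\<close> and by \<open>1 - c\<close> are totally isotropic. Thus \<open>P x y\<close> is the sum of the
  pairings between \<open>c x\<close> and \<open>(1 - c) y\<close> and between \<open>(1 - c) x\<close> and \<open>c y\<close>, one of which is
  nonzero. Its two arguments, one of them rescaled, are \<open>p\<close> and \<open>q\<close>.
\<close>

lemma ex_peirce_pair:
  assumes em: "embedding (B :: 'd::euclidean_space calg) \<phi>" and nd: "nondegenerate_norm B"
    and dim: "DIM('d) < DIM('v)" and gr: "graded_range \<phi>"
    and c: "c \<in> range \<phi>" "c \<in> U \<one>" "N c = 0" "P c \<e> = 1"
  obtains g p q where "g \<in> carrier G" "p \<in> U g" "q \<in> U (inv g)" "p + q \<in> orth A (range \<phi>)" "N (p + q) = 1"
    "c \<odot> (p + q) = p" "cj c \<odot> (p + q) = q"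
proof -
  note result = that
  obtain g x y where g: "g \<in> carrier G" and x: "x \<in> U g" "x \<in> orth A (range \<phi>)"
    and y: "y \<in> U (inv g)" "y \<in> orth A (range \<phi>)" and xy: "P x y \<noteq> 0"
    using ex_dual_homogeneous_pair[OF em nd dim gr] by metis
  note Q = unital_subalgebra_range[OF em]
  let ?d = "cj c"
  have d: "?d = \<e> - c" using c(4) by (simp add: cj_def)
  have dR: "?d \<in> range \<phi>" using unital_subalgebra_cj[OF Q c(1)] .
  have d1: "?d \<in> U \<one>" using cj_in[OF c(2)] by simp
  have cd: "c \<odot> (?d \<odot> z) = 0" "?d \<odot> (c \<odot> z) = 0" for z
    using cj_mult_cancel[of ?d z] cj_mult_cancel[of c z] c(3) by simp_all
  have cc: "c \<odot> (c \<odot> z) = c \<odot> z" "?d \<odot> (?d \<odot> z) = ?d \<odot> z" for z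
    using cd[of z] by (simp_all add: d mult_simps)
  have z_split: "z = c \<odot> z + ?d \<odot> z" for z by (simp add: d mult_simps)
  have orthm: "k \<odot> z \<in> orth A (range \<phi>)" if "k \<in> range \<phi>" "z \<in> orth A (range \<phi>)" for k z
  proof -
    have "P (k \<odot> z) w = 0" if w: "w \<in> range \<phi>" for w
    proof -
      have "cj k \<odot> w \<in> range \<phi>"
        using Q unital_subalgebra_cj[OF Q \<open>k \<in> _\<close>] w unfolding unital_subalgebra_def by blast
      then show ?thesis using \<open>z \<in> _\<close> unfolding adjoint_left orth_def by blast
    qed
    then show ?thesis by (simp add: orth_def)
  qed
  have Pcc: "P (c \<odot> a) (c \<odot> b) = 0" "P (?d \<odot> a) (?d \<odot> b) = 0" for a b
    using c(3) by (simp_all add: polar_mult_left)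
  have "P (c \<odot> x + ?d \<odot> x) (c \<odot> y + ?d \<odot> y) = P (c \<odot> x) (?d \<odot> y) + P (?d \<odot> x) (c \<odot> y)"
    by (simp add: polar_simps Pcc)
  then have "P x y = P (c \<odot> x) (?d \<odot> y) + P (?d \<odot> x) (c \<odot> y)" by (simp only: z_split[symmetric])
  moreover have "thesis" if h: "h \<in> carrier G" and x: "x \<in> U h" "x \<in> orth A (range \<phi>)"
    and y: "y \<in> U (inv h)" "y \<in> orth A (range \<phi>)" and ne: "P (c \<odot> x) (?d \<odot> y) \<noteq> 0" for h x y
  proof -
    let ?p = "c \<odot> x" and ?q = "(1 / P (c \<odot> x) (?d \<odot> y)) *\<^sub>R (?d \<odot> y)"
    have N0: "N ?p = 0" "N ?q = 0" using c(3) by (simp_all add: norm_mult norm_scale)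
    have pq: "P ?p ?q = 1" using ne by (simp add: polar_simps)
    have "subspace (orth A (range \<phi>))" by (auto simp: orth_def polar_simps intro!: subspaceI)
    then have "?p + ?q \<in> orth A (range \<phi>)"
      using orthm[OF c(1) x(2)] orthm[OF dR y(2)] by (intro subspace_add subspace_scale)
    moreover have "?p \<in> U h" "?q \<in> U (inv h)"
      using mult_in[OF c(2) x(1)] mult_in[OF d1 y(1)] h by (auto intro: subspace_scale[OF subspace_component])
    moreover have "c \<odot> (?p + ?q) = ?p" "?d \<odot> (?p + ?q) = ?q" by (simp_all add: mult_simps cd cc)
    ultimately show thesis using result[of h ?p ?q] h N0 pq by (simp add: norm_add)
  qed
  note * = this
  ultimately consider "P (c \<odot> x) (?d \<odot> y) \<noteq> 0" | "P (c \<odot> y) (?d \<odot> x) \<noteq> 0"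
    using xy polar_commute by fastforce
  then show thesis
  proof cases
    case 1
    then show thesis using *[OF g x y] by blast
  next
    case 2
    then show thesis using *[of "inv g" y x] g x y by simp
  qed
qed

text \<open>
  The product of \<open>x\<close> with the conjugate of an element \<open>y\<close> paired with it has norm zero and trace
  \<open>P x y\<close>, which is normalized to \<open>1\<close>. By the quadratic equation the result is idempotent.
\<close>

lemma ex_neutral_idempotent:
  assumes x: "x \<in> U \<one>" "x \<noteq> 0" "N x = 0"
  obtains c where "c \<in> U \<one>" "N c = 0" "P c \<e> = 1"
proof -
  obtain y where y: "y \<in> U \<one>" "P x y \<noteq> 0" using polar_partner[OF x(1) _ x(2)] by auto
  let ?c = "(1 / P x y) *\<^sub>R (x \<odot> cj y)"
  have "?c \<in> U \<one>" using mult_in[OF x(1) cj_in[OF y(1)]] by (auto intro: subspace_scale[OF subspace_component])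
  moreover have "N ?c = 0" using x(3) by (simp add: norm_scale norm_mult)
  moreover have "P ?c \<e> = 1" using y(2) by (simp add: polar_simps polar_unit_mult_cj)
  ultimately show thesis by (rule that)
qed

lemma embedding_split:
  assumes c: "N c = 0" "P c \<e> = 1"
  shows "embedding split_alg (\<lambda>(a, b). a *\<^sub>R c + b *\<^sub>R cj c)"
proof -
  have d: "cj c = \<e> - c" using c(2) by (simp add: cj_def)
  have cc: "c \<odot> c = c" using quadratic_equation[of c] c by simp
  then have dd: "cj c \<odot> cj c = cj c" by (metis cj_mult)
  have cd: "c \<odot> cj c = 0" "cj c \<odot> c = 0"
    using mult_cj[of c] mult_cj[of "cj c"] c(1) by simp_all
  have p: "P c (cj c) = 1" using c by (simp add: d polar_simps polar_self)
  have u: "c + cj c = \<e>" by (simp add: d)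
  have "linear (\<lambda>(a, b). a *\<^sub>R c + b *\<^sub>R cj c)"
    by (rule linearI) (auto simp: algebra_simps)
  then show ?thesis
    unfolding embedding_def
    by (auto simp: split_alg_def mult_simps cc dd cd norm_add norm_scale polar_simps cj_simps c(1) p u mult.commute)
qed

text \<open>
  Two doublings of \<open>\<real> c + \<real> (1 - c)\<close> by elements \<open>p + q\<close> and \<open>p' + q'\<close> as in \<open>ex_peirce_pair\<close> fill
  the algebra. The canonical basis of the model is mapped to \<open>c\<close>, \<open>1 - c\<close>, \<open>p\<close>, \<open>p'\<close>, \<open>q q'\<close> and
  \<open>q\<close>, \<open>q'\<close>, \<open>p p'\<close>, all of which are homogeneous.
\<close>

theorem Gamma_triple_if_neutral_isotropic:
  assumes x: "x \<in> U \<one>" "x \<noteq> 0" "N x = 0" and dim: "DIM('v) = 8"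
  obtains \<gamma> where "degree_triple G \<gamma>" "Gamma_triple G A \<gamma> U"
proof -
  obtain c where c: "c \<in> U \<one>" "N c = 0" "P c \<e> = 1" using ex_neutral_idempotent[OF x] .
  have d1: "cj c \<in> U \<one>" using cj_in[OF c(1)] by simp
  define f0 where "f0 = (\<lambda>(a, b). a *\<^sub>R c + b *\<^sub>R cj c)"
  have em0: "embedding split_alg f0" unfolding f0_def by (rule embedding_split[OF c(2,3)])
  have f0_eq: "f0 (a, b) = a *\<^sub>R c + b *\<^sub>R cj c" for a b by (simp add: f0_def)
  have \<phi>0: "f0 (1, 0) = c" "f0 (0, 1) = cj c" by (simp_all add: f0_eq)
  have m0: "c \<in> range f0" "cj c \<in> range f0" using \<phi>0 by (metis rangeI)+
  let ?H0 = "{x \<in> range f0. \<exists>g\<in>carrier G. x \<in> U g}"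
  have h0: "c \<in> span ?H0" "cj c \<in> span ?H0" using m0 c(1) d1 by (blast intro: span_base)+
  have gr0: "graded_range f0"
    unfolding graded_range_def using h0 by (force simp: f0_eq intro!: span_add span_scale)
  obtain g1 p q where g1: "g1 \<in> carrier G" and p: "p \<in> U g1" and q: "q \<in> U (inv g1)"
    and pq: "p + q \<in> orth A (range f0)" "N (p + q) = 1" "c \<odot> (p + q) = p" "cj c \<odot> (p + q) = q"
    using ex_peirce_pair[OF em0 nondegenerate_split _ gr0 m0(1) c] by (simp add: dim, blast)
  define f1 where "f1 = cd_map f0 (p + q)"
  have em1: "embedding split_quaternion_model f1"
    unfolding split_quaternion_model_def f1_def using embedding_cd[OF em0 pq(1)] pq(2) by simp
  have nd1: "nondegenerate_norm split_quaternion_model"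
    unfolding split_quaternion_model_def by (simp add: nondegenerate_norm_cd nondegenerate_split)
  have f1_eq: "f1 ((a, b), (r, s)) = (a *\<^sub>R c + b *\<^sub>R cj c) + (r *\<^sub>R p + s *\<^sub>R q)" for a b r s
    by (simp add: f1_def cd_map_def f0_eq) (simp only: mult_simps(1,3) pq(3,4))
  have \<phi>1: "f1 ((1, 0), 0) = c" "f1 ((0, 1), 0) = cj c" "f1 (0, (1, 0)) = p" "f1 (0, (0, 1)) = q"
    by (simp_all add: f1_eq zero_prod_def)
  have m1: "c \<in> range f1" "cj c \<in> range f1" "p \<in> range f1" "q \<in> range f1" using \<phi>1 by (metis rangeI)+
  let ?H1 = "{x \<in> range f1. \<exists>g\<in>carrier G. x \<in> U g}"
  have h1: "c \<in> span ?H1" "cj c \<in> span ?H1" "p \<in> span ?H1" "q \<in> span ?H1"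
    using m1 c(1) d1 p q g1 by (blast intro: span_base inv_closed)+
  have gr1: "graded_range f1"
    unfolding graded_range_def using h1 by (force simp: f1_eq intro!: span_add span_scale)
  obtain g2 p' q' where g2: "g2 \<in> carrier G" and p': "p' \<in> U g2" and q': "q' \<in> U (inv g2)"
    and pq': "p' + q' \<in> orth A (range f1)" "N (p' + q') = 1" "c \<odot> (p' + q') = p'" "cj c \<odot> (p' + q') = q'"
    using ex_peirce_pair[OF em1 nd1 _ gr1 m1(1) c] by (simp add: dim, blast)
  define f2 where "f2 = cd_map f1 (p' + q')"
  have em2: "embedding split_octonion_model f2"
    unfolding split_octonion_model_def f2_def using embedding_cd[OF em1 pq'(1)] pq'(2) by simp
  have nd2: "nondegenerate_norm split_octonion_model"
    unfolding split_octonion_model_def by (simp add: nondegenerate_norm_cd nd1)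
  have bij: "bij f2" using embedding_bij[OF em2 nd2] by (simp add: dim)
  have l2: "linear f2" and mul2: "\<And>x y. f2 (amult split_octonion_model x y) = f2 x \<odot> f2 y"
    using em2 by (auto simp: embedding_def)
  have \<phi>10: "f1 0 = 0" using em1 by (auto simp: embedding_def linear_0)
  have \<phi>2: "f2 (z, 0) = f1 z" "f2 (0, z) = f1 z \<odot> (p' + q')" for z
    by (simp_all add: f2_def cd_map_def \<phi>10 mult_simps(9,10))
  let ?e1 = "f2 model_e1" and ?e2 = "f2 model_e2" and ?u = "\<lambda>i. f2 (model_u i)" and ?v = "\<lambda>i. f2 (model_v i)"
  have cb: "canonical_basis A ?e1 ?e2 ?u ?v"
    using canonical_basis_image[OF dim model_canonical_table model_span l2 bij mul2] .
  note t = model_canonical_table[unfolded canonical_table_def ball_I3 sum_I3 levi_civita_simps]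
  have b: "?e1 = c" "?e2 = cj c" "?u 1 = p" "?v 1 = q" "?u 2 = p'" "?v 2 = q'"
    by (simp_all add: \<phi>2 \<phi>1 model_u_def model_v_def pq'(3,4))
  have "amult split_octonion_model (model_v 1) (model_v 2) = model_u 3"
    "amult split_octonion_model (model_u 1) (model_u 2) = model_v 3" using t by simp_all
  then have b3: "?u 3 = q \<odot> q'" "?v 3 = p \<odot> p'" using mul2 b by metis+
  define \<gamma> where "\<gamma> i = (if i = 1 then g1 else if i = 2 then g2 else inv (g1 \<otimes> g2))" for i :: nat
  have \<gamma>: "\<gamma> 1 = g1" "\<gamma> 2 = g2" "\<gamma> 3 = inv (g1 \<otimes> g2)" by (simp_all add: \<gamma>_def)
  have dt: "degree_triple G \<gamma>" using g1 g2 by (auto simp: degree_triple_def \<gamma>_def)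
  have "q \<odot> q' \<in> U (inv (g1 \<otimes> g2))" using mult_in[OF q q'] g1 g2 by (simp add: inv_mult)
  moreover have "p \<odot> p' \<in> U (inv (inv (g1 \<otimes> g2)))" using mult_in[OF p p'] g1 g2 by simp
  ultimately have uv: "\<forall>i\<in>I3. ?u i \<in> U (\<gamma> i) \<and> ?v i \<in> U (inv (\<gamma> i))"
    unfolding ball_I3 \<gamma> b b3 using p q p' q' by simp
  have "f2 model_e1 \<in> U \<one>" "f2 model_e2 \<in> U \<one>" using c(1) d1 by (simp_all only: b)
  then have "Gamma_triple G A \<gamma> U"
    using Gamma_tripleI[OF bilinear_mult dt cb grading] uv by blast
  then show thesis using that dt by blast
qed

end

section \<open>Counting sign characters\<close>

context comm_group
begin

text \<open>
  A character of \<open>S\<close> is extended by choosing its value at \<open>t\<close> freely.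
\<close>

lemma card_sign_characters_coset_extension:
  assumes S: "subgroup S G" and fin: "finite S" and t: "t \<in> carrier G" "t \<otimes> t = \<one>" "t \<notin> S"
  shows "card (sign_characters G (coset_extension G S t)) = 2 * card (sign_characters G S)"
proof -
  interpret S: subgroup S G by (rule S)
  let ?T = "coset_extension G S t"
  have T: "subgroup ?T G" using subgroup_coset_extension[OF S t(1,2)] .
  have "\<one> \<otimes> t \<in> ?T" unfolding coset_extension_def using S.one_closed by blast
  then have ST: "S \<subseteq> ?T" "t \<in> ?T" using t(1) by (auto simp: coset_extension_def)
  note disj = coset_extension_disjoint[OF S t]
  note inv = involution_cancel[OF t(1,2)]
  have st: "s \<otimes> t \<in> ?T" if "s \<in> S" for s using that by (simp add: coset_extension_def)
  let ?F = "\<lambda>\<mu>. (restrict \<mu> S, \<mu> t)"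
  have "bij_betw ?F (sign_characters G ?T) (sign_characters G S \<times> {1, - 1})"
    unfolding bij_betw_def
  proof
    show "inj_on ?F (sign_characters G ?T)"
    proof (rule inj_onI)
      fix \<mu> \<nu> assume \<mu>: "\<mu> \<in> sign_characters G ?T" and \<nu>: "\<nu> \<in> sign_characters G ?T" and eq: "?F \<mu> = ?F \<nu>"
      have S_eq: "\<mu> s = \<nu> s" if "s \<in> S" for s using eq that by (auto dest!: fun_cong[of _ _ s])
      have "\<mu> (s \<otimes> t) = \<nu> (s \<otimes> t)" if "s \<in> S" for s
        using sign_character_simps(2)[OF \<mu> T _ ST(2)] sign_character_simps(2)[OF \<nu> T _ ST(2)] that ST(1) S_eq eq
        by auto
      then have "\<mu> x = \<nu> x" if "x \<in> ?T" for x using that S_eq by (auto simp: coset_extension_def)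
      then show "\<mu> = \<nu>"
        using \<mu> \<nu> unfolding sign_characters_def by (intro extensionalityI[of _ ?T]) auto
    qed
    show "?F ` sign_characters G ?T = sign_characters G S \<times> {1, - 1}"
    proof (intro equalityI subsetI)
      fix y assume "y \<in> ?F ` sign_characters G ?T"
      then obtain \<mu> where \<mu>: "\<mu> \<in> sign_characters G ?T" and y: "y = ?F \<mu>" by blast
      have v: "\<mu> s \<in> {- 1, 1}" "r \<in> S \<Longrightarrow> \<mu> (s \<otimes> r) = \<mu> s * \<mu> r" if "s \<in> S" for s r
        using sign_character_simps(1,2)[OF \<mu> T] that ST(1) by blast+
      have "restrict \<mu> S \<in> sign_characters G S"
        unfolding sign_characters_def hom_def using v by (auto simp: sign_img_simps)
      then show "y \<in> sign_characters G S \<times> {1, - 1}"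
        using sign_character_simps(1)[OF \<mu> T ST(2)] y by auto
    next
      fix y assume "y \<in> sign_characters G S \<times> {1, - 1 :: int}"
      then obtain \<nu> e where y: "y = (\<nu>, e)" and \<nu>: "\<nu> \<in> sign_characters G S" and e: "e = 1 \<or> e = - 1" by auto
      note \<nu>s = sign_character_simps[OF \<nu> S]
      define \<mu> where "\<mu> = (\<lambda>x\<in>?T. if x \<in> S then \<nu> x else \<nu> (x \<otimes> t) * e)"
      have mS: "\<mu> s = \<nu> s" if "s \<in> S" for s using that ST(1) by (auto simp: \<mu>_def)
      have mt: "\<mu> (s \<otimes> t) = \<nu> s * e" if "s \<in> S" for s
        using that disj[OF that] st[OF that] inv[of s] by (auto simp: \<mu>_def)
      have "\<mu> (x \<otimes> y) = \<mu> x * \<mu> y" if xy: "x \<in> ?T" "y \<in> ?T" for x y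
      proof -
        have E: "a \<otimes> (b \<otimes> t) = a \<otimes> b \<otimes> t" "a \<otimes> t \<otimes> b = a \<otimes> b \<otimes> t" "a \<otimes> t \<otimes> (b \<otimes> t) = a \<otimes> b"
          if "a \<in> S" "b \<in> S" for a b
          using that t inv[of b] by (simp_all add: m_ac)
        show ?thesis
          using xy e unfolding coset_extension_def
          by (auto simp: mS mt E \<nu>s(2))
      qed
      moreover have "\<mu> x \<in> {- 1, 1}" if "x \<in> ?T" for x
      proof -
        have "\<nu> s \<in> {- 1, 1}" if "s \<in> S" for s using \<nu>s(1)[OF that] by auto
        then show ?thesis using that e unfolding coset_extension_def by (fastforce simp: mS mt)
      qed
      moreover have "\<mu> \<in> extensional ?T" by (simp add: \<mu>_def)
      ultimately have "\<mu> \<in> sign_characters G ?T"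
        unfolding sign_characters_def hom_def by (auto simp: sign_img_simps)
      moreover have "?F \<mu> = y"
      proof -
        have "restrict \<mu> S = \<nu>"
          using \<nu> mS unfolding sign_characters_def by (intro extensionalityI[of _ S]) auto
        moreover have "\<mu> t = e" using mt[OF S.one_closed] \<nu>s(3) t by simp
        ultimately show ?thesis by (simp add: y)
      qed
      ultimately show "y \<in> ?F ` sign_characters G ?T" by blast
    qed
  qed
  then have "card (sign_characters G ?T) = card (sign_characters G S \<times> {1, - 1 :: int})"
    by (rule bij_betw_same_card)
  then show ?thesis by (simp add: card_cartesian_product)
qed

lemma sign_characters_trivial_group: "sign_characters G {\<one>} = {trivial_character {\<one>}}"
proof -
  have "\<mu> = trivial_character {\<one>}" if "\<mu> \<in> sign_characters G {\<one>}" for \<mu>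
    using trivial_character_iff[OF that] sign_character_simps(3)[OF that triv_subgroup] by simp
  then show ?thesis using trivial_character_in[OF triv_subgroup] by blast
qed

text \<open>
  The subgroups between the trivial group and \<open>T\<close> are climbed by adjoining one involution at a
  time; each step doubles the order of the subgroup as well as the number of its characters.
\<close>

lemma card_sign_characters:
  assumes T: "elementary_abelian_2 G T" and fin: "finite T"
  shows "card (sign_characters G T) = card T"
proof -
  have Tg: "subgroup T G" and inv: "\<And>x. x \<in> T \<Longrightarrow> x \<otimes> x = \<one>" using T by (auto simp: elementary_abelian_2_def)
  have "card (sign_characters G T) = card T"
    if "subgroup S G" "S \<subseteq> T" "card (sign_characters G S) = card S" for S
    using that
  proof (induction "card T - card S" arbitrary: S rule: less_induct)
    case less
    have finS: "finite S" using less.prems(2) fin finite_subset by blast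
    show ?case
    proof (cases "S = T")
      case False
      then obtain t where t: "t \<in> T" "t \<notin> S" using less.prems(2) by blast
      note tt = subgroup.mem_carrier[OF Tg t(1)] inv[OF t(1)]
      let ?S = "coset_extension G S t"
      have sub: "?S \<subseteq> T" using coset_extension_subset[OF Tg less.prems(2) t(1)] .
      have c: "card ?S = 2 * card S" using card_coset_extension[OF less.prems(1) tt t(2) finS] .
      have "card S > 0" using finS subgroup.one_closed[OF less.prems(1)] by (auto simp: card_gt_0_iff)
      then have "card S < card ?S" using c by simp
      moreover have "card ?S \<le> card T" using sub fin by (rule card_mono[rotated])
      ultimately have "card T - card ?S < card T - card S" by linarith
      then show ?thesis
        using less.hyps[of ?S] subgroup_coset_extension[OF less.prems(1) tt] sub c less.prems(3)
          card_sign_characters_coset_extension[OF less.prems(1) finS tt t(2)] by simp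
    qed (use less.prems in simp)
  qed
  then show ?thesis
    using triv_subgroup subgroup.one_closed[OF Tg] sign_characters_trivial_group by force
qed

lemma card_nontrivial_sign_characters:
  assumes T: "T \<in> elementary_abelian_2_subgroups G n" and n: "n > 0"
  shows "card (nontrivial_sign_characters G T) = n - 1"
proof -
  have e: "elementary_abelian_2 G T" "card T = n" using T by (auto simp: elementary_abelian_2_subgroups_def)
  have "finite T" using e(2) n by (intro card_ge_0_finite) simp
  then have "card (sign_characters G T) = n" using card_sign_characters e by simp
  moreover have "trivial_character T \<in> sign_characters G T"
    using trivial_character_in e(1) by (simp add: elementary_abelian_2_def)
  ultimately show ?thesis unfolding nontrivial_sign_characters_def by (simp add: card_Diff_singleton)
qed

end

context eight_dim_composition_algebra
begin

text \<open>
  Automorphisms preserve the norm, hence the signs on the components.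
\<close>

lemma grading_iso_norm_signs_eq:
  assumes n: "norm_signs A T \<mu> U" "norm_signs A T \<mu>' U'" and iso: "grading_iso G A U U'"
    and supp: "\<And>g. g \<in> carrier G \<Longrightarrow> U g \<noteq> {0} \<longleftrightarrow> g \<in> T" and T: "subgroup T G"
    and U: "grading G A U"
    and \<mu>: "\<mu> \<in> sign_characters G T" "\<mu>' \<in> sign_characters G T"
  shows "\<mu> = \<mu>'"
proof -
  obtain f where f: "linear f" "bij f" "\<And>x y. f (x \<odot> y) = f x \<odot> f y" "\<And>g. g \<in> carrier G \<Longrightarrow> f ` U g = U' g"
    using iso unfolding grading_iso_def by blast
  have "\<mu> t = \<mu>' t" if t: "t \<in> T" for t
  proof -
    have c: "t \<in> carrier G" using subgroup.mem_carrier[OF T t] .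
    have "0 \<in> U t" using U c by (auto simp: grading_def intro: subspace_0 direct_sum_subspace)
    then obtain x where x: "x \<in> U t" "x \<noteq> 0" using supp[OF c] t by blast
    have "f x \<noteq> 0" using x(2) f(2) linear_injective_0[OF f(1)] bij_is_inj by blast
    moreover have "f x \<in> U' t" using x f(4)[OF c] by blast
    ultimately have "sgn (N (f x)) = real_of_int (\<mu>' t)" using n(2) t by (simp add: norm_signs_def)
    moreover have "sgn (N x) = real_of_int (\<mu> t)" using n(1) t x by (simp add: norm_signs_def)
    moreover have "N (f x) = N x" using automorphism_norm[OF f(1-3)] .
    ultimately show ?thesis by simp
  qed
  then show ?thesis using \<mu> unfolding sign_characters_def by (intro extensionalityI[of _ T]) auto
qed

lemma isomorphic_to_support:
  assumes "isomorphic_to G A U Q"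
    and "\<And>U'. Q U' \<Longrightarrow> (\<forall>g\<in>carrier G. U' g \<noteq> {0} \<longleftrightarrow> g \<in> T)" and T: "subgroup T G"
  shows "T = {g \<in> carrier G. U g \<noteq> {0}}"
proof -
  obtain U' f where U': "Q U'" and f: "linear f" "bij f" "\<And>g. g \<in> carrier G \<Longrightarrow> f ` U g = U' g"
    using assms(1) unfolding isomorphic_to_def grading_iso_def by blast
  have "U g \<noteq> {0} \<longleftrightarrow> g \<in> T" if g: "g \<in> carrier G" for g
  proof -
    have "f ` {0} = {0}" using f(1) by (simp add: linear_0)
    then have "U' g = {0} \<longleftrightarrow> U g = {0}" unfolding f(3)[OF g, symmetric] using inj_image_eq_iff[OF bij_is_inj[OF f(2)]] by metis
    then show ?thesis using assms(2)[OF U'] g by blast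
  qed
  then show ?thesis using subgroup.subset[OF T] by blast
qed

lemma isomorphic_to_self: "Q U \<Longrightarrow> isomorphic_to G A U Q"
  unfolding isomorphic_to_def grading_iso_def
  by (intro exI[of _ U] conjI exI[of _ id]) (auto simp: linear_id)

end

section \<open>The two Cayley algebras\<close>

lemma octonion_eq: "octonion_alg = cayley_alg (- 1)" and split_octonion_eq: "split_octonion_alg = cayley_alg 1"
  by (simp_all add: octonion_alg_def split_octonion_alg_def cayley_alg_def)

lemmas cayley_simps = cayley_alg_def quaternion_alg_def cayley_dickson_def complex_alg_def

lemma anorm_cayley:
  "anorm (cayley_alg \<delta>) ((a, b), (c, d)) = (cmod a)\<^sup>2 + (cmod b)\<^sup>2 - \<delta> * ((cmod c)\<^sup>2 + (cmod d)\<^sup>2)"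
  by (simp add: cayley_simps)

text \<open>
  The standard element \<open>w\<close> that doubles the quaternions has norm \<open>\<sigma>\<close> and square \<open>\<delta> = - \<sigma>\<close>. Thus
  \<open>\<sigma> = 1\<close> for the octonions and \<open>\<sigma> = - 1\<close> for the split octonions.
\<close>

locale cayley_form = comm_group G for G :: "('g, 'b) monoid_scheme" (structure) +
  fixes \<delta> :: real and \<sigma> :: int
  assumes \<delta>: "\<sigma> = 1 \<or> \<sigma> = - 1" "\<delta> = - of_int \<sigma>"
begin

lemma \<delta>_nonzero: "\<delta> \<noteq> 0" using \<delta> by auto

sublocale eight_dim_composition_algebra "cayley_alg \<delta>" G
proof -
  interpret composition_algebra "cayley_alg \<delta>" by (rule composition_algebra_cayley[OF \<delta>_nonzero])
  show "eight_dim_composition_algebra (cayley_alg \<delta>) G" by unfold_locales simp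
qed

abbreviation "std_i \<equiv> ((\<i>, 0), (0, 0)) :: oct"
abbreviation "std_j \<equiv> ((0, 1), (0, 0)) :: oct"
abbreviation "std_w \<equiv> ((0, 0), (1, 0)) :: oct"

lemma embedding_quaternion: "embedding quaternion_alg (\<lambda>a. (a, 0))"
  by (rule injective_hom_embedding[OF composition_algebra_quaternion aconj_quaternion])
    (auto simp: cayley_simps zero_prod_def intro!: linearI injI)

lemma embedding_complex_std: "embedding complex_alg (\<lambda>z. ((z, 0), (0, 0)))"
  by (rule injective_hom_embedding[OF composition_algebra_complex aconj_complex])
    (auto simp: cayley_simps zero_prod_def intro!: linearI injI)

lemma std_j: "std_j \<in> orth (cayley_alg \<delta>) (range (\<lambda>z. ((z, 0), (0, 0))))" "N std_j = 1"
  by (auto simp: orth_def polar_def anorm_cayley)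

lemma std_w: "std_w \<in> orth (cayley_alg \<delta>) (range (cd_map (\<lambda>z. ((z, 0), (0, 0))) std_j))" "N std_w = of_int \<sigma>"
proof -
  have "amult (cayley_alg \<delta>) ((b, 0), (0, 0)) std_j = ((0, b), (0, 0))" for b
    by (simp add: cayley_simps zero_prod_def)
  then have "cd_map (\<lambda>z. ((z, 0), (0, 0))) std_j = (\<lambda>(a, b). ((a, b), (0, 0)))"
    by (auto simp: cd_map_def fun_eq_iff)
  then show "std_w \<in> orth (cayley_alg \<delta>) (range (cd_map (\<lambda>z. ((z, 0), (0, 0))) std_j))"
    by (auto simp: orth_def polar_def anorm_cayley)
  show "N std_w = of_int \<sigma>" using \<delta> by (simp add: anorm_cayley)
qed

lemma std_real:
  "std_i \<in> orth (cayley_alg \<delta>) {aunit (cayley_alg \<delta>)}" "N std_i = 1" "std_j \<in> orth (cayley_alg \<delta>) {aunit (cayley_alg \<delta>), std_i}"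
  "std_w \<in> orth (cayley_alg \<delta>) {aunit (cayley_alg \<delta>), std_i, std_j, amult (cayley_alg \<delta>) std_i std_j}"
proof -
  have e: "aunit (cayley_alg \<delta>) = ((1, 0), (0, 0))" by (simp add: cayley_simps zero_prod_def)
  have ij: "amult (cayley_alg \<delta>) std_i std_j = ((0, \<i>), (0, 0))" by (simp add: cayley_simps zero_prod_def)
  have i1: "(cmod (1 + \<i>))\<^sup>2 = 2" "(cmod (\<i> + 1))\<^sup>2 = 2" by (simp_all add: cmod_power2)
  show "std_i \<in> orth (cayley_alg \<delta>) {aunit (cayley_alg \<delta>)}" "N std_i = 1" "std_j \<in> orth (cayley_alg \<delta>) {aunit (cayley_alg \<delta>), std_i}"
    "std_w \<in> orth (cayley_alg \<delta>) {aunit (cayley_alg \<delta>), std_i, std_j, amult (cayley_alg \<delta>) std_i std_j}"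
    unfolding e ij by (simp_all add: orth_def polar_def anorm_cayley i1)
qed

lemma cayley_determines_Gamma_H: "T \<in> order_2_subgroups G \<Longrightarrow> determines_grading G (cayley_alg \<delta>) (Gamma_H G (cayley_alg \<delta>) T)"
  by (rule determines_Gamma_H[OF embedding_quaternion])

lemma cayley_determines_Gamma_C:
  assumes "T \<in> elementary_abelian_2_subgroups G 4" "\<mu> \<in> sign_characters G T"
    and "\<sigma> = 1 \<and> \<mu> = trivial_character T \<or> \<sigma> = - 1 \<and> \<mu> \<noteq> trivial_character T"
  shows "determines_grading G (cayley_alg \<delta>) (Gamma_C G (cayley_alg \<delta>) T \<mu>)"
  by (rule determines_Gamma_C[OF assms(1,2) embedding_complex_std std_j std_w assms(3)])

lemma cayley_determines_Gamma_R:
  assumes "T \<in> elementary_abelian_2_subgroups G 8" "\<mu> \<in> sign_characters G T"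
    and "\<sigma> = 1 \<and> \<mu> = trivial_character T \<or> \<sigma> = - 1 \<and> \<mu> \<noteq> trivial_character T"
  shows "determines_grading G (cayley_alg \<delta>) (Gamma_R G (cayley_alg \<delta>) T \<mu>)"
  by (rule determines_Gamma_R[OF assms(1,2) std_real(1,2,3) std_j(2) std_real(4) std_w(2) assms(3)])

text \<open>
  A trivial sign character means that the norm is nonnegative on all components, hence everywhere.
  This holds for the octonions and fails for the split octonions, where \<open>w\<close> has norm \<open>- 1\<close>.
\<close>

lemma sign_char_trivial_iff:
  assumes an: "anisotropic_grading (cayley_alg \<delta>) G U" and T: "subgroup T G"
    and supp: "\<And>g. g \<in> carrier G \<Longrightarrow> U g \<noteq> {0} \<longleftrightarrow> g \<in> T"
  shows "\<sigma> = 1 \<and> anisotropic_grading.sign_char (cayley_alg \<delta>) U T = trivial_character T \<or>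
    \<sigma> = - 1 \<and> anisotropic_grading.sign_char (cayley_alg \<delta>) U T \<noteq> trivial_character T"
proof -
  interpret U: anisotropic_grading "cayley_alg \<delta>" G U by (rule an)
  show ?thesis using \<delta>(1)
  proof
    assume s: "\<sigma> = 1"
    have pos: "N x > 0" if "x \<noteq> 0" for x
    proof -
      obtain a b c d where x: "x = ((a, b), (c, d))" by (metis surj_pair)
      have n: "N x = (cmod a)\<^sup>2 + (cmod b)\<^sup>2 + (cmod c)\<^sup>2 + (cmod d)\<^sup>2"
        using s \<delta>(2) by (simp add: x anorm_cayley)
      have d: "a \<noteq> 0 \<or> b \<noteq> 0 \<or> c \<noteq> 0 \<or> d \<noteq> 0" using that by (auto simp: x zero_prod_def)
      show ?thesis
      proof (rule ccontr)
        assume "\<not> 0 < N x"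
        then have "(cmod a)\<^sup>2 = 0" "(cmod b)\<^sup>2 = 0" "(cmod c)\<^sup>2 = 0" "(cmod d)\<^sup>2 = 0"
          using n zero_le_power2[of "cmod a"] zero_le_power2[of "cmod b"]
            zero_le_power2[of "cmod c"] zero_le_power2[of "cmod d"] by linarith+
        then show False using d by simp
      qed
    qed
    have "U.sign_char T t = 1" if t: "t \<in> T" for t
    proof -
      have c: "t \<in> carrier G" using subgroup.mem_carrier[OF T t] .
      obtain x where "x \<in> U t" "x \<noteq> 0" using supp[OF c] t U.zero_in[OF c] by blast
      then have "\<exists>x\<in>U t. N x > 0" using pos[of x] by blast
      then show ?thesis using t by (simp add: U.sign_char_def)
    qed
    then have "U.sign_char T t = trivial_character T t" for t
      by (cases "t \<in> T") (simp_all add: trivial_character_def, simp add: U.sign_char_def)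
    then have "U.sign_char T = trivial_character T" by (rule ext)
    then show ?thesis using s by blast
  next
    assume s: "\<sigma> = - 1"
    have "U.sign_char T \<noteq> trivial_character T"
    proof
      assume eq: "U.sign_char T = trivial_character T"
      have "N x \<ge> 0" for x
      proof (rule U.norm_nonneg_if_components_nonneg)
        fix g x assume g: "g \<in> carrier G" "x \<in> U g"
        show "N x \<ge> 0"
        proof (cases "x = 0")
          case False
          then have "g \<in> T" using supp[OF g(1)] g(2) by blast
          then have "sgn (N x) = 1"
            using U.sign_char_eq[of g T x] g False eq by (simp add: trivial_character_def)
          then show ?thesis by (simp add: sgn_if split: if_splits)
        qed simp
      qed
      from this[of std_w] show False using s std_w(2) by simp
    qed
    then show ?thesis using s by blast
  qed
qed

lemma anisotropic_classification:
  assumes an: "anisotropic_grading (cayley_alg \<delta>) G U" and nt: "U \<one> \<noteq> UNIV"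
  obtains (H) T where "T \<in> order_2_subgroups G" "Gamma_H G (cayley_alg \<delta>) T U"
  | (C) T \<mu> where "T \<in> elementary_abelian_2_subgroups G 4" "Gamma_C G (cayley_alg \<delta>) T \<mu> U"
      "\<mu> \<in> sign_characters G T" "\<sigma> = 1 \<and> \<mu> = trivial_character T \<or> \<sigma> = - 1 \<and> \<mu> \<noteq> trivial_character T"
  | (R) T \<mu> where "T \<in> elementary_abelian_2_subgroups G 8" "Gamma_R G (cayley_alg \<delta>) T \<mu> U"
      "\<mu> \<in> sign_characters G T" "\<sigma> = 1 \<and> \<mu> = trivial_character T \<or> \<sigma> = - 1 \<and> \<mu> \<noteq> trivial_character T"
proof -
  interpret U: anisotropic_grading "cayley_alg \<delta>" G U by (rule an)
  have sub: "subgroup T G" if "T \<in> elementary_abelian_2_subgroups G n" for T n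
    using that by (simp add: elementary_abelian_2_subgroups_def elementary_abelian_2_def)
  show thesis
  proof (rule U.neutral_component_cases[OF dim_8 nt])
    assume r: "range (\<lambda>r. r *\<^sub>R aunit (cayley_alg \<delta>)) = U \<one>"
    obtain T where T: "T \<in> elementary_abelian_2_subgroups G 8" "Gamma_R G (cayley_alg \<delta>) T (U.sign_char T) U"
      "U.sign_char T \<in> sign_characters G T" by (rule U.Gamma_R_if_neutral_real[OF r dim_8])
    show thesis
      by (rule R[OF T sign_char_trivial_iff[OF an sub[OF T(1)] Gamma_R_grading(3)[OF T(1,2)]]])
  next
    fix \<phi> assume \<phi>: "embedding complex_alg \<phi>" "range \<phi> = U \<one>"
    obtain T where T: "T \<in> elementary_abelian_2_subgroups G 4" "Gamma_C G (cayley_alg \<delta>) T (U.sign_char T) U"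
      "U.sign_char T \<in> sign_characters G T" by (rule U.Gamma_C_if_neutral_complex[OF \<phi> dim_8])
    have s: "U g \<noteq> {0} \<longleftrightarrow> g \<in> T" if "g \<in> carrier G" for g
      by (rule Gamma_C_grading[OF T(1,2)]) (use that in simp)
    show thesis by (rule C[OF T sign_char_trivial_iff[OF an sub[OF T(1)] s]])
  next
    fix \<phi> assume \<phi>: "embedding quaternion_alg \<phi>" "range \<phi> = U \<one>"
    show thesis by (rule U.Gamma_H_if_neutral_quaternion[OF \<phi> dim_8]) (rule H)
  qed
qed

lemma support_Gamma:
  shows "T \<in> order_2_subgroups G \<Longrightarrow> Gamma_H G (cayley_alg \<delta>) T U \<Longrightarrow> \<forall>g\<in>carrier G. U g \<noteq> {0} \<longleftrightarrow> g \<in> T"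
    and "T \<in> elementary_abelian_2_subgroups G 4 \<Longrightarrow> Gamma_C G (cayley_alg \<delta>) T \<mu> U \<Longrightarrow>
      \<forall>g\<in>carrier G. U g \<noteq> {0} \<longleftrightarrow> g \<in> T"
    and "T \<in> elementary_abelian_2_subgroups G 8 \<Longrightarrow> Gamma_R G (cayley_alg \<delta>) T \<mu> U \<Longrightarrow>
      \<forall>g\<in>carrier G. U g \<noteq> {0} \<longleftrightarrow> g \<in> T"
proof -
  show "\<forall>g\<in>carrier G. U g \<noteq> {0} \<longleftrightarrow> g \<in> T"
    if "T \<in> order_2_subgroups G" "Gamma_H G (cayley_alg \<delta>) T U"
    by (rule Gamma_H_grading[OF that]) simp
  show "\<forall>g\<in>carrier G. U g \<noteq> {0} \<longleftrightarrow> g \<in> T"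
    if "T \<in> elementary_abelian_2_subgroups G 4" "Gamma_C G (cayley_alg \<delta>) T \<mu> U"
    by (rule Gamma_C_grading[OF that]) simp
  show "\<forall>g\<in>carrier G. U g \<noteq> {0} \<longleftrightarrow> g \<in> T"
    if "T \<in> elementary_abelian_2_subgroups G 8" "Gamma_R G (cayley_alg \<delta>) T \<mu> U"
    using Gamma_R_grading(3)[OF that] by simp
qed

lemma Gamma_C_character_unique:
  assumes T: "T \<in> elementary_abelian_2_subgroups G 4" and U: "Gamma_C G (cayley_alg \<delta>) T \<mu> U" "Gamma_C G (cayley_alg \<delta>) T \<mu>' U'"
    and \<mu>: "\<mu> \<in> sign_characters G T" "\<mu>' \<in> sign_characters G T" and iso: "grading_iso G (cayley_alg \<delta>) U U'"
  shows "\<mu> = \<mu>'"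
proof -
  have Tg: "subgroup T G" using T by (simp add: elementary_abelian_2_subgroups_def elementary_abelian_2_def)
  have n: "norm_signs (cayley_alg \<delta>) T \<mu> U" "norm_signs (cayley_alg \<delta>) T \<mu>' U'"
    using U by (simp_all add: Gamma_C_def)
  have gr: "grading G (cayley_alg \<delta>) U"
    by (rule Gamma_C_grading[OF T U(1)]) (rule anisotropic_grading_imp_grading)
  show ?thesis
    by (rule grading_iso_norm_signs_eq[OF n iso support_Gamma(2)[OF T U(1), rule_format] Tg gr \<mu>])
qed

lemma Gamma_R_character_unique:
  assumes T: "T \<in> elementary_abelian_2_subgroups G 8" and U: "Gamma_R G (cayley_alg \<delta>) T \<mu> U" "Gamma_R G (cayley_alg \<delta>) T \<mu>' U'"
    and \<mu>: "\<mu> \<in> sign_characters G T" "\<mu>' \<in> sign_characters G T" and iso: "grading_iso G (cayley_alg \<delta>) U U'"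
  shows "\<mu> = \<mu>'"
proof -
  have Tg: "subgroup T G" using T by (simp add: elementary_abelian_2_subgroups_def elementary_abelian_2_def)
  have n: "norm_signs (cayley_alg \<delta>) T \<mu> U" "norm_signs (cayley_alg \<delta>) T \<mu>' U'"
    using U by (simp_all add: Gamma_R_def)
  have gr: "grading G (cayley_alg \<delta>) U"
    by (rule anisotropic_grading_imp_grading[OF Gamma_R_grading(1)[OF T U(1)]])
  show ?thesis
    by (rule grading_iso_norm_signs_eq[OF n iso support_Gamma(3)[OF T U(1), rule_format] Tg gr \<mu>])
qed

end

section \<open>The classification\<close>

context comm_group
begin

text \<open>
  The norm of the octonions is anisotropic, so the neutral component of any grading is, too. The
  subgroup \<open>T\<close> is recovered from the grading as its support; its order then tells the three cases
  apart.
\<close>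

lemma octonion_classification:
  assumes U: "grading G octonion_alg U" "nontrivial_grading G U"
  shows "\<exists>!T. (T \<in> order_2_subgroups G \<and>
                isomorphic_to G octonion_alg U (Gamma_H G octonion_alg T)) \<or>
              (T \<in> elementary_abelian_2_subgroups G 4 \<and>
                isomorphic_to G octonion_alg U (Gamma_C G octonion_alg T (trivial_character T))) \<or>
              (T \<in> elementary_abelian_2_subgroups G 8 \<and>
                isomorphic_to G octonion_alg U (Gamma_R G octonion_alg T (trivial_character T)))"
  (is "\<exists>!T. ?Q T")
proof -
  interpret O: cayley_form G "- 1" 1 by unfold_locales simp_all
  have an: "anisotropic_grading (cayley_alg (- 1)) G U"
  proof
    show "grading G (cayley_alg (- 1)) U" using U(1) by (simp add: octonion_eq)
    fix x :: oct assume "anorm (cayley_alg (- 1)) x = 0"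
    moreover obtain a b c d where x: "x = ((a, b), (c, d))" by (metis surj_pair)
    ultimately have "(cmod a)\<^sup>2 + (cmod b)\<^sup>2 + ((cmod c)\<^sup>2 + (cmod d)\<^sup>2) = 0" by (simp add: anorm_cayley)
    then show "x = 0" by (simp add: x zero_prod_def add_nonneg_eq_0_iff)
  qed
  have nt: "U \<one> \<noteq> UNIV" using U(2) by (simp add: nontrivial_grading_def)
  note self = O.isomorphic_to_self[where U = U, folded octonion_eq]
  have "\<exists>T. ?Q T"
  proof (rule O.anisotropic_classification[OF an nt, folded octonion_eq])
    fix T assume "T \<in> order_2_subgroups G" "Gamma_H G octonion_alg T U"
    then show "\<exists>T. ?Q T" using self[of "Gamma_H G octonion_alg T"] by blast
  next
    fix T \<mu>
    assume T: "T \<in> elementary_abelian_2_subgroups G 4" "Gamma_C G octonion_alg T \<mu> U"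
      and m: "(1 :: int) = 1 \<and> \<mu> = trivial_character T \<or> (1 :: int) = - 1 \<and> \<mu> \<noteq> trivial_character T"
    have "\<mu> = trivial_character T" using m by simp
    then show "\<exists>T. ?Q T" using self[of "Gamma_C G octonion_alg T \<mu>"] T by blast
  next
    fix T \<mu>
    assume T: "T \<in> elementary_abelian_2_subgroups G 8" "Gamma_R G octonion_alg T \<mu> U"
      and m: "(1 :: int) = 1 \<and> \<mu> = trivial_character T \<or> (1 :: int) = - 1 \<and> \<mu> \<noteq> trivial_character T"
    have "\<mu> = trivial_character T" using m by simp
    then show "\<exists>T. ?Q T" using self[of "Gamma_R G octonion_alg T \<mu>"] T by blast
  qed
  \<comment> \<open>Uniqueness: each of the three alternatives forces \<open>T\<close> to be the support of \<open>U\<close>.\<close>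
  moreover have "T = {g \<in> carrier G. U g \<noteq> {0}}" if T: "?Q T" for T
    using T unfolding octonion_eq
  proof (elim disjE conjE)
    assume T: "T \<in> order_2_subgroups G" and i: "isomorphic_to G (cayley_alg (- 1)) U (Gamma_H G (cayley_alg (- 1)) T)"
    show ?thesis
      using O.isomorphic_to_support[OF i O.support_Gamma(1)[OF T]] T by (simp add: order_2_subgroups_def)
  next
    assume T: "T \<in> elementary_abelian_2_subgroups G 4"
      and i: "isomorphic_to G (cayley_alg (- 1)) U (Gamma_C G (cayley_alg (- 1)) T (trivial_character T))"
    show ?thesis
      using O.isomorphic_to_support[OF i O.support_Gamma(2)[OF T]] T
      by (simp add: elementary_abelian_2_subgroups_def elementary_abelian_2_def)
  next
    assume T: "T \<in> elementary_abelian_2_subgroups G 8"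
      and i: "isomorphic_to G (cayley_alg (- 1)) U (Gamma_R G (cayley_alg (- 1)) T (trivial_character T))"
    show ?thesis
      using O.isomorphic_to_support[OF i O.support_Gamma(3)[OF T]] T
      by (simp add: elementary_abelian_2_subgroups_def elementary_abelian_2_def)
  qed
  ultimately show ?thesis by blast
qed

lemma split_octonion_isotropic:
  obtains x where "x \<noteq> 0" "anorm split_octonion_alg x = 0"
proof
  let ?x = "((1, 0), (1, 0)) :: oct"
  show "?x \<noteq> 0" by (simp add: zero_prod_def)
  show "anorm split_octonion_alg ?x = 0" by (simp add: split_octonion_eq anorm_cayley)
qed

lemma split_octonion_classification:
  assumes U: "grading G split_octonion_alg U"
  shows "(\<exists>\<gamma>. degree_triple G \<gamma> \<and>
           isomorphic_to G split_octonion_alg U (Gamma_triple G split_octonion_alg \<gamma>)) \<or>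
        (\<exists>T\<in>order_2_subgroups G.
           isomorphic_to G split_octonion_alg U (Gamma_H G split_octonion_alg T)) \<or>
        (\<exists>T\<in>elementary_abelian_2_subgroups G 4. \<exists>\<mu>\<in>nontrivial_sign_characters G T.
           isomorphic_to G split_octonion_alg U (Gamma_C G split_octonion_alg T \<mu>)) \<or>
        (\<exists>T\<in>elementary_abelian_2_subgroups G 8. \<exists>\<mu>\<in>nontrivial_sign_characters G T.
           isomorphic_to G split_octonion_alg U (Gamma_R G split_octonion_alg T \<mu>))"
  unfolding split_octonion_eq
proof -
  interpret S: cayley_form G 1 "- 1" by unfold_locales simp_all
  interpret U: graded_composition_algebra "cayley_alg 1" G U
    by unfold_locales (use U in \<open>simp add: split_octonion_eq\<close>)
  note self = S.isomorphic_to_self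
  show "(\<exists>\<gamma>. degree_triple G \<gamma> \<and>
           isomorphic_to G (cayley_alg 1) U (Gamma_triple G (cayley_alg 1) \<gamma>)) \<or>
        (\<exists>T\<in>order_2_subgroups G.
           isomorphic_to G (cayley_alg 1) U (Gamma_H G (cayley_alg 1) T)) \<or>
        (\<exists>T\<in>elementary_abelian_2_subgroups G 4. \<exists>\<mu>\<in>nontrivial_sign_characters G T.
           isomorphic_to G (cayley_alg 1) U (Gamma_C G (cayley_alg 1) T \<mu>)) \<or>
        (\<exists>T\<in>elementary_abelian_2_subgroups G 8. \<exists>\<mu>\<in>nontrivial_sign_characters G T.
           isomorphic_to G (cayley_alg 1) U (Gamma_R G (cayley_alg 1) T \<mu>))" (is ?goal)
  proof (cases "\<exists>x\<in>U \<one>. x \<noteq> 0 \<and> anorm (cayley_alg 1) x = 0")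
    case True
    then obtain x where "x \<in> U \<one>" "x \<noteq> 0" "anorm (cayley_alg 1) x = 0" by blast
    then obtain \<gamma> where "degree_triple G \<gamma>" "Gamma_triple G (cayley_alg 1) \<gamma> U"
      using U.Gamma_triple_if_neutral_isotropic[OF _ _ _ S.dim_8] by blast
    then show ?goal using self[of "Gamma_triple G (cayley_alg 1) \<gamma>" U] by blast
  next
    case False
    have an: "anisotropic_grading (cayley_alg 1) G U" by unfold_locales (use False in blast)
    have nt: "U \<one> \<noteq> UNIV" using False split_octonion_isotropic by (metis UNIV_I split_octonion_eq)
    show ?goal
    proof (rule S.anisotropic_classification[OF an nt])
      fix T assume "T \<in> order_2_subgroups G" "Gamma_H G (cayley_alg 1) T U"
      then show ?goal using self[of "Gamma_H G (cayley_alg 1) T" U] by blast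
    next
      fix T \<mu>
      assume "T \<in> elementary_abelian_2_subgroups G 4" "Gamma_C G (cayley_alg 1) T \<mu> U" "\<mu> \<in> sign_characters G T"
        "(- 1 :: int) = 1 \<and> \<mu> = trivial_character T \<or> (- 1 :: int) = - 1 \<and> \<mu> \<noteq> trivial_character T"
      then show ?goal
        using self[of "Gamma_C G (cayley_alg 1) T \<mu>" U] by (auto simp: nontrivial_sign_characters_def)
    next
      fix T \<mu>
      assume "T \<in> elementary_abelian_2_subgroups G 8" "Gamma_R G (cayley_alg 1) T \<mu> U" "\<mu> \<in> sign_characters G T"
        "(- 1 :: int) = 1 \<and> \<mu> = trivial_character T \<or> (- 1 :: int) = - 1 \<and> \<mu> \<noteq> trivial_character T"
      then show ?goal
        using self[of "Gamma_R G (cayley_alg 1) T \<mu>" U] by (auto simp: nontrivial_sign_characters_def)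
    qed
  qed
qed

text \<open>
  The isotropic case of the classification is applied to the trivial grading.
\<close>

lemma ex_canonical_basis_split_octonion:
  obtains e1 e2 u v where "canonical_basis split_octonion_alg e1 e2 u v"
proof -
  interpret S: cayley_form G 1 "- 1" by unfold_locales simp_all
  interpret U: graded_composition_algebra "cayley_alg 1" G "trivial_grading G"
    by unfold_locales (rule grading_trivial_grading[OF S.bilinear_mult])
  obtain x :: oct where x: "x \<noteq> 0" "anorm (cayley_alg 1) x = 0"
    using split_octonion_isotropic by (metis split_octonion_eq)
  obtain \<gamma> where "Gamma_triple G (cayley_alg 1) \<gamma> (trivial_grading G)"
    using U.Gamma_triple_if_neutral_isotropic[OF _ x S.dim_8] by (auto simp: trivial_grading_def)
  then show thesis using that unfolding Gamma_triple_def split_octonion_eq by blast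
qed

lemma determines_Gamma_triple:
  assumes dt: "degree_triple G \<gamma>"
  shows "determines_grading G split_octonion_alg (Gamma_triple G split_octonion_alg \<gamma>)"
proof -
  interpret S: cayley_form G 1 "- 1" by unfold_locales simp_all
  obtain e1 e2 u v where "canonical_basis split_octonion_alg e1 e2 u v"
    using ex_canonical_basis_split_octonion .
  then have "Gamma_triple G split_octonion_alg \<gamma> (triple_component G \<gamma> e1 e2 u v)"
    unfolding Gamma_triple_iff by blast
  then show ?thesis
    unfolding determines_grading_def split_octonion_eq
    using grading_Gamma_triple[OF S.bilinear_mult dt] grading_iso_Gamma_triple[OF S.bilinear_mult] by blast
qed

lemma grading_iso_Gamma_triple_iff:
  assumes "degree_triple G \<gamma>" "degree_triple G \<gamma>'"
    and "Gamma_triple G split_octonion_alg \<gamma> U" "Gamma_triple G split_octonion_alg \<gamma>' U'"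
  shows "grading_iso G split_octonion_alg U U' \<longleftrightarrow> triple_equiv G \<gamma> \<gamma>'"
proof -
  interpret S: cayley_form G 1 "- 1" by unfold_locales simp_all
  note b = S.bilinear_mult[folded split_octonion_eq]
  show ?thesis
    using triple_equiv_if_grading_iso[OF assms] Gamma_triple_equiv[OF S.dim_8 b assms(1,2) _ assms(4)]
      grading_iso_Gamma_triple[OF b assms(3)] by blast
qed

end

theorem corollary13:
  fixes G :: "('g, 'b) monoid_scheme"
  assumes "comm_group G"
  shows
    "((\<forall>T\<in>order_2_subgroups G.
         determines_grading G octonion_alg (Gamma_H G octonion_alg T)) \<and>
      (\<forall>T\<in>elementary_abelian_2_subgroups G 4.
         determines_grading G octonion_alg (Gamma_C G octonion_alg T (trivial_character T))) \<and>
      (\<forall>T\<in>elementary_abelian_2_subgroups G 8.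
         determines_grading G octonion_alg (Gamma_R G octonion_alg T (trivial_character T))) \<and>
      (\<forall>U. grading G octonion_alg U \<and> nontrivial_grading G U \<longrightarrow>
        (\<exists>!T. (T \<in> order_2_subgroups G \<and>
                isomorphic_to G octonion_alg U (Gamma_H G octonion_alg T)) \<or>
              (T \<in> elementary_abelian_2_subgroups G 4 \<and>
                isomorphic_to G octonion_alg U (Gamma_C G octonion_alg T (trivial_character T))) \<or>
              (T \<in> elementary_abelian_2_subgroups G 8 \<and>
                isomorphic_to G octonion_alg U (Gamma_R G octonion_alg T (trivial_character T)))))) \<and>
     ((\<forall>\<gamma>. degree_triple G \<gamma> \<longrightarrow>
         determines_grading G split_octonion_alg (Gamma_triple G split_octonion_alg \<gamma>)) \<and>
      (\<forall>\<gamma> \<gamma>' U U'. degree_triple G \<gamma> \<and> degree_triple G \<gamma>' \<and>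
         Gamma_triple G split_octonion_alg \<gamma> U \<and> Gamma_triple G split_octonion_alg \<gamma>' U' \<longrightarrow>
         (grading_iso G split_octonion_alg U U' \<longleftrightarrow> triple_equiv G \<gamma> \<gamma>')) \<and>
      (\<forall>T\<in>order_2_subgroups G.
         determines_grading G split_octonion_alg (Gamma_H G split_octonion_alg T)) \<and>
      (\<forall>T\<in>elementary_abelian_2_subgroups G 4.
         card (nontrivial_sign_characters G T) = 3 \<and>
         (\<forall>\<mu>\<in>nontrivial_sign_characters G T.
            determines_grading G split_octonion_alg (Gamma_C G split_octonion_alg T \<mu>)) \<and>
         (\<forall>\<mu>\<in>nontrivial_sign_characters G T. \<forall>\<mu>'\<in>nontrivial_sign_characters G T. \<forall>U U'.
            \<mu> \<noteq> \<mu>' \<and> Gamma_C G split_octonion_alg T \<mu> U \<and>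
            Gamma_C G split_octonion_alg T \<mu>' U' \<longrightarrow> \<not> grading_iso G split_octonion_alg U U')) \<and>
      (\<forall>T\<in>elementary_abelian_2_subgroups G 8.
         card (nontrivial_sign_characters G T) = 7 \<and>
         (\<forall>\<mu>\<in>nontrivial_sign_characters G T.
            determines_grading G split_octonion_alg (Gamma_R G split_octonion_alg T \<mu>)) \<and>
         (\<forall>\<mu>\<in>nontrivial_sign_characters G T. \<forall>\<mu>'\<in>nontrivial_sign_characters G T. \<forall>U U'.
            \<mu> \<noteq> \<mu>' \<and> Gamma_R G split_octonion_alg T \<mu> U \<and>
            Gamma_R G split_octonion_alg T \<mu>' U' \<longrightarrow> \<not> grading_iso G split_octonion_alg U U')) \<and>
      (\<forall>U. grading G split_octonion_alg U \<longrightarrow>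
        (\<exists>\<gamma>. degree_triple G \<gamma> \<and>
           isomorphic_to G split_octonion_alg U (Gamma_triple G split_octonion_alg \<gamma>)) \<or>
        (\<exists>T\<in>order_2_subgroups G.
           isomorphic_to G split_octonion_alg U (Gamma_H G split_octonion_alg T)) \<or>
        (\<exists>T\<in>elementary_abelian_2_subgroups G 4. \<exists>\<mu>\<in>nontrivial_sign_characters G T.
           isomorphic_to G split_octonion_alg U (Gamma_C G split_octonion_alg T \<mu>)) \<or>
        (\<exists>T\<in>elementary_abelian_2_subgroups G 8. \<exists>\<mu>\<in>nontrivial_sign_characters G T.
           isomorphic_to G split_octonion_alg U (Gamma_R G split_octonion_alg T \<mu>))))"
proof -
  interpret comm_group G by (rule assms)
  interpret O: cayley_form G "- 1" 1 by unfold_locales simp_all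
  interpret S: cayley_form G 1 "- 1" by unfold_locales simp_all
  have sub: "subgroup T G" if "T \<in> elementary_abelian_2_subgroups G n" for T n
    using that by (simp add: elementary_abelian_2_subgroups_def elementary_abelian_2_def)
  note O_C = O.cayley_determines_Gamma_C[OF _ trivial_character_in[OF sub], folded octonion_eq]
  note O_R = O.cayley_determines_Gamma_R[OF _ trivial_character_in[OF sub], folded octonion_eq]
  have \<mu>: "\<mu> \<in> sign_characters G T" "\<mu> \<noteq> trivial_character T" if "\<mu> \<in> nontrivial_sign_characters G T" for \<mu> T
    using that by (simp_all add: nontrivial_sign_characters_def)
  note S_C = S.cayley_determines_Gamma_C[OF _ \<mu>(1), folded split_octonion_eq]
  note S_R = S.cayley_determines_Gamma_R[OF _ \<mu>(1), folded split_octonion_eq]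
  note S_unique = S.Gamma_C_character_unique[folded split_octonion_eq] S.Gamma_R_character_unique[folded split_octonion_eq]
  have niso_C: "\<not> grading_iso G split_octonion_alg U U'"
    if T: "T \<in> elementary_abelian_2_subgroups G 4"
      and m: "\<mu> \<in> nontrivial_sign_characters G T" "\<mu>' \<in> nontrivial_sign_characters G T"
      and U: "\<mu> \<noteq> \<mu>' \<and> Gamma_C G split_octonion_alg T \<mu> U \<and> Gamma_C G split_octonion_alg T \<mu>' U'"
    for T \<mu> \<mu>' U U'
    using S_unique(1)[OF T _ _ \<mu>(1)[OF m(1)] \<mu>(1)[OF m(2)]] U by blast
  have niso_R: "\<not> grading_iso G split_octonion_alg U U'"
    if T: "T \<in> elementary_abelian_2_subgroups G 8"
      and m: "\<mu> \<in> nontrivial_sign_characters G T" "\<mu>' \<in> nontrivial_sign_characters G T"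
      and U: "\<mu> \<noteq> \<mu>' \<and> Gamma_R G split_octonion_alg T \<mu> U \<and> Gamma_R G split_octonion_alg T \<mu>' U'"
    for T \<mu> \<mu>' U U'
    using S_unique(2)[OF T _ _ \<mu>(1)[OF m(1)] \<mu>(1)[OF m(2)]] U by blast
  have O: "(\<forall>T\<in>order_2_subgroups G.
         determines_grading G octonion_alg (Gamma_H G octonion_alg T)) \<and>
      (\<forall>T\<in>elementary_abelian_2_subgroups G 4.
         determines_grading G octonion_alg (Gamma_C G octonion_alg T (trivial_character T))) \<and>
      (\<forall>T\<in>elementary_abelian_2_subgroups G 8.
         determines_grading G octonion_alg (Gamma_R G octonion_alg T (trivial_character T)))"
    using O.cayley_determines_Gamma_H[folded octonion_eq] O_C O_R by simp
  show ?thesis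
    apply (intro conjI)
    subgoal using O by blast
    subgoal using O by blast
    subgoal using O by blast
    subgoal using octonion_classification by blast
    subgoal using determines_Gamma_triple by blast
    subgoal using grading_iso_Gamma_triple_iff by blast
    subgoal using S.cayley_determines_Gamma_H[folded split_octonion_eq] by blast
    subgoal using card_nontrivial_sign_characters[of _ 4] S_C \<mu>(2) niso_C by simp
    subgoal using card_nontrivial_sign_characters[of _ 8] S_R \<mu>(2) niso_R by simp
    subgoal using split_octonion_classification by blast
    done
qed

end
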